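(* Let $p$ be a prime and let $G$ be a nontrivial finite abelian $p$-group. Then there exists a geometric Galois extension $L/\mathbb{F}_p(t)$ with $\mathrm{Gal}(L/\mathbb{F}_p(t))\cong G$ that is ramified at exactly one place of $\mathbb{F}_p(t)$ (places counted including the infinite place $1/t$), and there is no geometric Galois extension of $\mathbb{F}_p(t)$ with group $G$ that is unramified at every place. Consequently $\mathrm{ram}_{\mathbb{F}_p(t)}(G)=1$.
   Context: An extension $L/\mathbb{F}_p(t)$ is called geometric if $\mathbb{F}_p$ is algebraically closed in $L$ (no extension of the constant field). For a nontrivial finite group $G$, $\mathrm{ram}_{\mathbb{F}_p(t)}(G)$ denotes the minimum, over all geometric Galois extensions $L/\mathbb{F}_p(t)$ with $\mathrm{Gal}(L/\mathbb{F}_p(t))\cong G$, of the number of places of $\mathbb{F}_p(t)$ (finite places and the infinite place) that ramify in $L$. *)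

theory Defs
  imports
    "HOL-Algebra.Bij"
    "HOL-Algebra.Embedded_Algebras"
    "HOL-Algebra.Algebraic_Closure_Type"
    "HOL-Computational_Algebra.Polynomial_Factorial"
    "Berlekamp_Zassenhaus.Finite_Field"
begin

text \<open>
  Every algebraic extension of a field \<open>'k\<close> embeds over \<open>'k\<close> into the algebraic closure
  \<open>'k alg_closure\<close>. So extensions of \<open>'k\<close> are represented by intermediate fields
  \<open>L\<close> of \<open>'k alg_closure\<close> over (the image under \<^const>\<open>to_ac\<close> of) \<open>'k\<close>.
\<close>

definition finite_extension :: "'k::field alg_closure set \<Rightarrow> bool" where
  "finite_extension L \<longleftrightarrow>
     subfield L ring_of_type_algebra \<and> range to_ac \<subseteq> L \<and>
     ring.finite_dimension ring_of_type_algebra (range to_ac) L"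

definition normal_extension :: "'k::field alg_closure set \<Rightarrow> bool" where
  "normal_extension L \<longleftrightarrow>
     (\<forall>f :: 'k poly. Factorial_Ring.irreducible f \<longrightarrow>
        (\<exists>x\<in>L. poly (map_poly to_ac f) x = 0) \<longrightarrow>
        (\<forall>x. poly (map_poly to_ac f) x = 0 \<longrightarrow> x \<in> L))"

text \<open>Since \<open>'k alg_closure\<close> is algebraically closed, \<^const>\<open>rsquarefree\<close> says that the
  minimal polynomial \<open>f\<close> of \<open>x\<close> (up to a constant factor) has no multiple roots in any
  extension.\<close>

definition separable_extension :: "'k::field alg_closure set \<Rightarrow> bool" where
  "separable_extension L \<longleftrightarrow>
     (\<forall>x\<in>L. \<forall>f :: 'k poly. Factorial_Ring.irreducible f \<longrightarrow>
        poly (map_poly to_ac f) x = 0 \<longrightarrow> rsquarefree (map_poly to_ac f))"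

definition galois_extension :: "'k::field alg_closure set \<Rightarrow> bool" where
  "galois_extension L \<longleftrightarrow>
     finite_extension L \<and> normal_extension L \<and> separable_extension L"

definition galois_group ::
  "'k::field alg_closure set \<Rightarrow> ('k alg_closure \<Rightarrow> 'k alg_closure) monoid" where
  "galois_group L = (BijGroup L)\<lparr>carrier :=
     {\<sigma> \<in> Bij L. \<sigma> \<in> Ring.ring_hom (ring_of_type_algebra\<lparr>carrier := L\<rparr>) (ring_of_type_algebra\<lparr>carrier := L\<rparr>)
               \<and> (\<forall>c. \<sigma> (to_ac c) = to_ac c)}\<rparr>"

text \<open>
  A place of a field \<open>F\<close> (a subset of its ambient type) is represented by its normalized discrete
  valuation. The value at \<open>0\<close>, which would be infinite, and the values outside \<open>F\<close> are fixed to
  be \<^const>\<open>undefined\<close>, so that distinct functions are distinct places. For a finite extension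
  of \<open>F\<^sub>p(t)\<close> triviality on the constants is automatic, because nonzero constants
  are roots of unity. The places of \<open>F\<^sub>p(t)\<close> in this sense are the \<open>\<pi>\<close>-adic valuations
  for monic irreducible polynomials \<open>\<pi>\<close> (the finite places) and \<open>f / g \<mapsto> deg g - deg f\<close>
  (the infinite place, with uniformizer \<open>1 / t\<close>).
\<close>

definition place_on :: "'a::field set \<Rightarrow> ('a \<Rightarrow> int) \<Rightarrow> bool" where
  "place_on F v \<longleftrightarrow>
     v \<in> extensional (F - {0}) \<and>
     v ` (F - {0}) = UNIV \<and>
     (\<forall>x\<in>F - {0}. \<forall>y\<in>F - {0}. v (x * y) = v x + v y) \<and>
     (\<forall>x\<in>F - {0}. \<forall>y\<in>F - {0}. x + y \<noteq> 0 \<longrightarrow> min (v x) (v y) \<le> v (x + y))"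

definition lies_over_with_index ::
  "('k::field alg_closure \<Rightarrow> int) \<Rightarrow> ('k \<Rightarrow> int) \<Rightarrow> nat \<Rightarrow> bool" where
  "lies_over_with_index w v e \<longleftrightarrow>
     e > 0 \<and> (\<forall>x. x \<noteq> 0 \<longrightarrow> w (to_ac x) = int e * v x)"

text \<open>Ramification means that some ramification index exceeds 1. The residue fields
  occurring over \<open>F\<^sub>p(t)\<close> are finite, hence perfect, so that no separability condition on
  the residue extensions is needed.\<close>

definition ramified_places :: "'k::field alg_closure set \<Rightarrow> ('k \<Rightarrow> int) set" where
  "ramified_places L =
     {v. place_on UNIV v \<and> (\<exists>w e. place_on L w \<and> lies_over_with_index w v e \<and> e > 1)}"

type_synonym 'p ratfun = "'p mod_ring poly fract"

definition ratfun_const :: "'p::prime_card mod_ring \<Rightarrow> 'p ratfun" where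
  "ratfun_const c = to_fract [:c:]"

definition geometric_extension :: "'p::prime_card ratfun alg_closure set \<Rightarrow> bool" where
  "geometric_extension L \<longleftrightarrow>
     (\<forall>x\<in>L. (\<exists>f :: 'p mod_ring poly. f \<noteq> 0 \<and>
                poly (map_poly (\<lambda>c. to_ac (ratfun_const c)) f) x = 0) \<longrightarrow>
             x \<in> range (\<lambda>c. to_ac (ratfun_const c)))"

definition geometric_galois_realization ::
  "('g, 'm) monoid_scheme \<Rightarrow> 'p::prime_card ratfun alg_closure set \<Rightarrow> bool" where
  "geometric_galois_realization G L \<longleftrightarrow>
     galois_extension L \<and> geometric_extension L \<and> galois_group L \<cong> G"

text \<open>Finiteness is required because \<^const>\<open>card\<close> is 0 on infinite sets.\<close>

definition ram :: "'p::prime_card itself \<Rightarrow> ('g, 'm) monoid_scheme \<Rightarrow> nat" where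
  "ram _ G = (LEAST n. \<exists>L :: 'p ratfun alg_closure set.
     geometric_galois_realization G L \<and> finite (ramified_places L) \<and> card (ramified_places L) = n)"

end

theory Submission
  imports Defs
begin

text \<open>
  Both halves rest on Artin-Schreier extensions. A geometric Galois extension \<open>L\<close> of \<open>F\<^sub>p(t)\<close>
  whose group is a nontrivial \<open>p\<close>-group contains some \<open>y\<close> outside \<open>F\<^sub>p(t)\<close> with
  \<open>y ^ p - y = f \<in> F\<^sub>p(t)\<close>. Subtracting elements \<open>h ^ p - h\<close>, one may assume that \<open>f\<close> is constant
  or has a pole of order prime to \<open>p\<close>. The first is impossible since \<open>L\<close> is geometric, and in the
  second case \<open>p v(y) = e v(f)\<close> at the pole, so that \<open>p\<close> divides the ramification index \<open>e\<close>.

  Conversely, \<open>G\<close> is realized by a tower of extensions of degree \<open>p\<close> that are integral away from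
  infinity. Suppose that \<open>G / H\<close> acts on \<open>L\<close> and on a ring \<open>R \<subseteq> L\<close> containing \<open>F\<^sub>p[t]\<close>, that
  \<open>\<theta> \<in> R\<close> has trace 1, and that \<open>N\<close> has index \<open>p\<close> in \<open>H\<close>. Averaging with \<open>\<theta>\<close> extends
  the character \<open>H / N \<rightarrow> F\<^sub>p\<close> to a cocycle \<open>B\<close> on \<open>G\<close> with values in \<open>R\<close>, and yields \<open>a \<in> R\<close> with
  \<open>g a - a = (B g) ^ p - B g\<close>. Then \<open>g y = y + B g\<close> defines an action of \<open>G / N\<close> on \<open>L(y)\<close>,
  where \<open>y ^ p - y = a + t ^ m\<close>, and a suitable \<open>m\<close> makes this a geometric extension of degree \<open>p\<close>.
  The finite places stay unramified because the following property passes from \<open>R\<close> to \<open>R[y]\<close>: for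
  every irreducible polynomial \<open>\<pi>\<close> there is a power \<open>q > 1\<close> of \<open>p\<close> such that \<open>b ^ q \<equiv> b\<close>
  modulo \<open>\<pi>\<close> for all \<open>b\<close>.
\<close>

section \<open>Subrings and polynomials over them\<close>

text \<open>A tower for \<open>G\<close> cannot be built from freely chosen generators, as cyclic
  groups of order \<open>p ^ 2\<close> show: \<open>g y = y + B g\<close> must respect the group law
  and be compatible with the value of \<open>y ^ p - y\<close>. The first asks that the character of
  \<open>H / N\<close> extend to a 1-cocycle, the second that the p-th power map minus the identity
  turn this cocycle into a coboundary. Both are possible because the higher cohomology of
  \<open>G / H\<close> with values in a ring containing an element of trace 1 vanishes; explicit
  averages keep everything in \<open>R\<close>, hence integral. The solution \<open>a\<close> is
  determined only up to elements fixed by \<open>G\<close>, and this freedom is where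
  \<open>t ^ m\<close> enters. The congruence \<open>b ^ q \<equiv> b\<close> stands in for
  discriminants and residue fields: it is a statement about elements of \<open>R\<close> alone. All
  of \<open>G\<close> acts on every stage, with a kernel that shrinks, which avoids quotient groups.
  The lower bound needs an actual place of \<open>L\<close> over the given pole; its existence is
  Chevalley's theorem, proved with maximal subrings. The fixed field of
  \<open>galois_group L\<close> has to be identified from normality and separability, through a
  primitive element.\<close>

definition subring_set :: "'a::comm_ring_1 set \<Rightarrow> bool" where
  "subring_set S \<longleftrightarrow> 1 \<in> S \<and> (\<forall>x\<in>S. \<forall>y\<in>S. x - y \<in> S \<and> x * y \<in> S)"

text \<open>As \<open>inverse 0 = 0\<close>, closure under \<open>inverse\<close> can be asked of
  all elements.\<close>

definition subfield_set :: "'a::field set \<Rightarrow> bool" where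
  "subfield_set S \<longleftrightarrow> subring_set S \<and> (\<forall>x\<in>S. inverse x \<in> S)"

lemma subring_setI:
  assumes "1 \<in> S" "\<And>x y. x \<in> S \<Longrightarrow> y \<in> S \<Longrightarrow> x - y \<in> S"
    "\<And>x y. x \<in> S \<Longrightarrow> y \<in> S \<Longrightarrow> x * y \<in> S"
  shows "subring_set S"
  using assms by (auto simp: subring_set_def)

lemma subring_setI':
  assumes "1 \<in> S" "\<And>x y. x \<in> S \<Longrightarrow> y \<in> S \<Longrightarrow> x + y \<in> S"
    "\<And>x. x \<in> S \<Longrightarrow> - x \<in> S"
    "\<And>x y. x \<in> S \<Longrightarrow> y \<in> S \<Longrightarrow> x * y \<in> S"
  shows "subring_set S"
proof (rule subring_setI)
  fix x y assume "x \<in> S" "y \<in> S"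
  then have "x + - y \<in> S" using assms by blast
  then show "x - y \<in> S" by simp
qed (use assms in auto)

lemma subfield_set_imp_subring_set [simp, intro]: "subfield_set S \<Longrightarrow> subring_set S"
  by (simp add: subfield_set_def)

lemma subfield_set_inverse: "subfield_set S \<Longrightarrow> x \<in> S \<Longrightarrow> inverse x \<in> S"
  by (simp add: subfield_set_def)

context
  fixes S :: "'a::comm_ring_1 set"
  assumes S: "subring_set S"
begin

lemma subring_set_1: "1 \<in> S"
  using S by (simp add: subring_set_def)

lemma subring_set_diff: "x \<in> S \<Longrightarrow> y \<in> S \<Longrightarrow> x - y \<in> S"
  using S by (simp add: subring_set_def)

lemma subring_set_mult: "x \<in> S \<Longrightarrow> y \<in> S \<Longrightarrow> x * y \<in> S"
  using S by (simp add: subring_set_def)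

lemma subring_set_0: "0 \<in> S"
  using subring_set_diff[OF subring_set_1 subring_set_1] by simp

lemma subring_set_uminus: "x \<in> S \<Longrightarrow> - x \<in> S"
  using subring_set_diff[OF subring_set_0] by fastforce

lemma subring_set_add: "x \<in> S \<Longrightarrow> y \<in> S \<Longrightarrow> x + y \<in> S"
  using subring_set_diff[OF _ subring_set_uminus] by fastforce

lemma subring_set_power: "x \<in> S \<Longrightarrow> x ^ n \<in> S"
  by (induction n) (auto intro: subring_set_1 subring_set_mult)

lemma subring_set_of_nat: "of_nat n \<in> S"
  by (induction n) (auto intro: subring_set_1 subring_set_0 subring_set_add)

lemma subring_set_sum: "(\<And>x. x \<in> A \<Longrightarrow> f x \<in> S) \<Longrightarrow> sum f A \<in> S"
  by (induction A rule: infinite_finite_induct) (auto intro: subring_set_0 subring_set_add)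

lemma subring_set_prod: "(\<And>x. x \<in> A \<Longrightarrow> f x \<in> S) \<Longrightarrow> prod f A \<in> S"
  by (induction A rule: infinite_finite_induct) (auto intro: subring_set_1 subring_set_mult)

end

lemmas subring_set_closed =
  subring_set_1 subring_set_0 subring_set_diff subring_set_mult subring_set_uminus
  subring_set_add subring_set_power subring_set_of_nat subring_set_sum subring_set_prod

lemma subfield_set_divide: "subfield_set S \<Longrightarrow> x \<in> S \<Longrightarrow> y \<in> S \<Longrightarrow> x / y \<in> S"
  by (simp add: divide_inverse subfield_set_inverse subring_set_mult)

definition poly_over :: "'a::comm_ring_1 set \<Rightarrow> 'a poly set" where
  "poly_over S = {P. \<forall>i. coeff P i \<in> S}"

lemma poly_overI: "(\<And>i. coeff P i \<in> S) \<Longrightarrow> P \<in> poly_over S"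
  and poly_overD: "P \<in> poly_over S \<Longrightarrow> coeff P i \<in> S"
  by (auto simp: poly_over_def)

lemma poly_over_mono: "S \<subseteq> T \<Longrightarrow> P \<in> poly_over S \<Longrightarrow> P \<in> poly_over T"
  by (auto simp: poly_over_def)

context
  fixes S :: "'a::comm_ring_1 set"
  assumes S: "subring_set S"
begin

lemma subring_poly_over: "subring_set (poly_over S)"
  by (rule subring_setI)
    (auto simp: poly_over_def coeff_mult coeff_1 intro!: subring_set_closed[OF S])

lemma const_poly_over: "c \<in> S \<Longrightarrow> [:c:] \<in> poly_over S"
  by (auto simp: poly_over_def coeff_pCons subring_set_0[OF S] split: nat.split)

lemma pCons_poly_over: "c \<in> S \<Longrightarrow> P \<in> poly_over S \<Longrightarrow> pCons c P \<in> poly_over S"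
  by (auto simp: poly_over_def coeff_pCons split: nat.split)

lemma monom_poly_over: "c \<in> S \<Longrightarrow> monom c n \<in> poly_over S"
  by (auto simp: poly_over_def subring_set_0[OF S])

lemma smult_poly_over: "c \<in> S \<Longrightarrow> P \<in> poly_over S \<Longrightarrow> smult c P \<in> poly_over S"
  by (auto simp: poly_over_def subring_set_mult[OF S])

lemma poly_poly_over: "P \<in> poly_over S \<Longrightarrow> x \<in> S \<Longrightarrow> poly P x \<in> S"
  by (auto simp: poly_altdef intro!: subring_set_closed[OF S] poly_overD)

lemma pcompose_poly_over: "P \<in> poly_over S \<Longrightarrow> Q \<in> poly_over S \<Longrightarrow> pcompose P Q \<in> poly_over S"
proof (induction P)
  case (pCons a P)
  have "a \<in> S" using poly_overD[OF pCons.prems(1), of 0] by simp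
  moreover have "P \<in> poly_over S"
    using poly_overD[OF pCons.prems(1), of "Suc i" for i] by (auto intro!: poly_overI)
  ultimately show ?case using pCons
    by (auto simp: pcompose_pCons intro!: subring_set_closed[OF subring_poly_over] const_poly_over)
qed (use subring_set_0[OF subring_poly_over] in auto)

end

text \<open>The ring \<open>S[y]\<close>. Between the base field and its algebraic closure such a
  ring is already a field, by \<open>subring_over_base_is_subfield\<close>, so this also serves as
  the field generated by \<open>y\<close>.\<close>

definition adjoin :: "'a::comm_ring_1 set \<Rightarrow> 'a \<Rightarrow> 'a set" where
  "adjoin S y = (\<lambda>P. poly P y) ` poly_over S"

context
  fixes S :: "'a::comm_ring_1 set"
  assumes S: "subring_set S"
begin

lemma subring_adjoin: "subring_set (adjoin S y)"
proof (rule subring_setI)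
  note [intro] = subring_set_closed[OF subring_poly_over[OF S]]
  show "1 \<in> adjoin S y"
    unfolding adjoin_def by (rule image_eqI[of _ _ 1]) auto
  fix u v assume "u \<in> adjoin S y" "v \<in> adjoin S y"
  then obtain P Q where PQ: "P \<in> poly_over S" "Q \<in> poly_over S" "u = poly P y" "v = poly Q y"
    by (auto simp: adjoin_def)
  have "P - Q \<in> poly_over S" "P * Q \<in> poly_over S" using PQ by auto
  moreover have "u - v = poly (P - Q) y" "u * v = poly (P * Q) y" using PQ by auto
  ultimately show "u - v \<in> adjoin S y" "u * v \<in> adjoin S y"
    unfolding adjoin_def by blast+
qed

lemma adjoin_superset: "S \<subseteq> adjoin S y"
proof
  fix x assume "x \<in> S"
  then show "x \<in> adjoin S y"
    unfolding adjoin_def by (intro image_eqI[of _ _ "[:x:]"] const_poly_over[OF S]) auto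
qed

lemma adjoin_gen: "y \<in> adjoin S y"
proof -
  have "[:0, 1:] \<in> poly_over S"
    using pCons_poly_over[OF S subring_set_0[OF S] const_poly_over[OF S subring_set_1[OF S]]] .
  moreover have "y = poly [:0, 1:] y" by simp
  ultimately show ?thesis unfolding adjoin_def by (rule rev_image_eqI)
qed

end

lemma adjoin_least:
  assumes "subring_set T" "S \<subseteq> T" "y \<in> T"
  shows "adjoin S y \<subseteq> T"
proof -
  have "poly P y \<in> T" if "P \<in> poly_over S" for P
    using poly_poly_over[OF assms(1) poly_over_mono[OF assms(2) that] assms(3)] .
  then show ?thesis by (auto simp: adjoin_def)
qed

text \<open>Each step of the division only divides by the leading coefficient of \<open>D\<close>,
  so quotient and remainder keep coefficients in \<open>S\<close>, a fact that division in the
  ambient polynomial ring hides.\<close>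

lemma poly_over_division:
  fixes P D :: "'a::field poly"
  assumes S: "subfield_set S" and "D \<in> poly_over S" "D \<noteq> 0" "P \<in> poly_over S"
  shows "\<exists>Q\<in>poly_over S. \<exists>R\<in>poly_over S. P = Q * D + R \<and> (R = 0 \<or> degree R < degree D)"
  using assms(4)
proof (induction "degree P" arbitrary: P rule: less_induct)
  case less
  note subr = subring_poly_over[OF subfield_set_imp_subring_set[OF S]]
  show ?case
  proof (cases "P = 0 \<or> degree P < degree D")
    case True
    then show ?thesis using less.prems subring_set_0[OF subr] by (intro bexI[of _ 0] bexI[of _ P]) auto
  next
    case False
    define c where "c = lead_coeff P / lead_coeff D"
    define M where "M = monom c (degree P - degree D)"
    have c: "c \<in> S" "c \<noteq> 0"
      using False assms(2,3) less.prems by (auto simp: c_def intro!: subfield_set_divide[OF S] poly_overD)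
    then have M: "M \<in> poly_over S" by (auto simp: M_def intro!: monom_poly_over S)
    have degM: "degree M = degree P - degree D" "M \<noteq> 0"
      unfolding M_def using c(2) by (auto intro: Polynomial.degree_monom_eq simp: monom_eq_0_iff)
    have lM: "lead_coeff M = c"
      unfolding degM(1) by (simp add: M_def)
    have deg: "degree (M * D) = degree P"
      using False assms(3) degM by (subst degree_mult_eq) auto
    have lc: "coeff (M * D) (degree P) = coeff P (degree P)"
    proof -
      have "coeff (M * D) (degree P) = lead_coeff (M * D)" using deg by simp
      also have "\<dots> = c * lead_coeff D"
        by (simp add: lead_coeff_mult lM)
      finally show ?thesis using assms(3) by (simp add: c_def)
    qed
    define P' where "P' = P - M * D"
    have P': "P' \<in> poly_over S"
      unfolding P'_def using M assms(2) less.prems by (intro subring_set_closed[OF subr])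
    have "P' = 0 \<or> degree P' < degree P"
    proof (cases "degree P = 0")
      case True
      then have "degree P' = 0" using deg unfolding P'_def
        by (metis degree_diff_le_max le_zero_eq max.idem)
      moreover have "coeff P' 0 = 0" using lc True by (simp add: P'_def)
      ultimately show ?thesis by (metis leading_coeff_0_iff)
    next
      case False
      have "degree P' \<le> degree P" unfolding P'_def using deg by (metis degree_diff_le_max max.idem)
      moreover have "coeff P' (degree P) = 0" using lc by (simp add: P'_def)
      ultimately show ?thesis
        by (metis le_neq_implies_less leading_coeff_0_iff)
    qed
    then obtain Q R where QR: "Q \<in> poly_over S" "R \<in> poly_over S" "P' = Q * D + R" "R = 0 \<or> degree R < degree D"
    proof
      assume "P' = 0"
      then show ?thesis using that[of 0 0] subring_set_0[OF subr] by auto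
    next
      assume "degree P' < degree P"
      from less.hyps[OF this P'] show ?thesis using that by blast
    qed
    have "P = (Q + M) * D + R" using QR(3) by (simp add: P'_def algebra_simps)
    then show ?thesis using QR M by (intro bexI[of _ "Q + M"] bexI[of _ R]) (auto intro: subring_set_closed[OF subr])
  qed
qed

text \<open>\<open>I\<close> is an ideal of \<open>S[X]\<close>, given as a set of polynomials over
  the ambient type; an element of least degree divides the others. The last conclusion makes
  \<open>D\<close> a minimal polynomial, and \<open>D \<in> I\<close> carries Bezout coefficients
  when \<open>I\<close> is generated by two polynomials.\<close>

lemma poly_over_principal:
  fixes I :: "'a::field poly set"
  assumes S: "subfield_set S" and I: "I \<subseteq> poly_over S"
    and diff: "\<And>P Q. P \<in> I \<Longrightarrow> Q \<in> I \<Longrightarrow> P - Q \<in> I"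
    and mult: "\<And>P Q. P \<in> poly_over S \<Longrightarrow> Q \<in> I \<Longrightarrow> P * Q \<in> I"
    and "P0 \<in> I" "P0 \<noteq> 0"
  obtains D where "D \<in> I" "lead_coeff D = 1" "\<And>P. P \<in> I \<Longrightarrow> D dvd P"
    "\<And>P. P \<in> I \<Longrightarrow> degree P < degree D \<Longrightarrow> P = 0"
proof -
  define n where "n = (LEAST n. \<exists>P\<in>I. P \<noteq> 0 \<and> degree P = n)"
  have "\<exists>P\<in>I. P \<noteq> 0 \<and> degree P = n" unfolding n_def
    by (rule LeastI_ex) (use assms(5,6) in blast)
  then obtain P where P: "P \<in> I" "P \<noteq> 0" "degree P = n" by blast
  have min: "Q = 0" if "Q \<in> I" "degree Q < n" for Q
    using not_less_Least[of "degree Q" "\<lambda>n. \<exists>P\<in>I. P \<noteq> 0 \<and> degree P = n"] that by (auto simp: n_def)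
  define D where "D = [:inverse (lead_coeff P):] * P"
  have D: "D \<in> I" unfolding D_def
    using P I by (intro mult const_poly_over) (auto intro!: subfield_set_inverse S poly_overD)
  have monic: "lead_coeff D = 1" "degree D = n" using P by (auto simp: D_def)
  have D0: "D \<noteq> 0" using monic by auto
  show ?thesis
  proof
    fix Q assume Q: "Q \<in> I"
    obtain U R where UR: "U \<in> poly_over S" "Q = U * D + R" "R = 0 \<or> degree R < degree D"
      using poly_over_division[OF S _ D0, of Q] D Q I by blast
    have "Q - U * D \<in> I" by (intro diff Q mult UR D)
    then have "R \<in> I" using UR by simp
    then have "R = 0" using UR min monic by auto
    then show "D dvd Q" using UR by simp
  qed (use D monic min in auto)
qed

section \<open>Finite groups acting on a field\<close>

text \<open>\<open>\<sigma>\<close> is a total function of which only the restriction to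
  \<open>L\<close> matters; where its values lie is left to the context.\<close>

locale hom_on =
  fixes L :: "'a::field set" and \<sigma> :: "'a \<Rightarrow> 'a"
  assumes L: "subring_set L"
    and hom_1: "\<sigma> 1 = 1"
    and hom_add: "x \<in> L \<Longrightarrow> y \<in> L \<Longrightarrow> \<sigma> (x + y) = \<sigma> x + \<sigma> y"
    and hom_mult: "x \<in> L \<Longrightarrow> y \<in> L \<Longrightarrow> \<sigma> (x * y) = \<sigma> x * \<sigma> y"
begin

lemma hom_0: "\<sigma> 0 = 0"
  using hom_add[OF subring_set_0[OF L] subring_set_0[OF L]] by (metis add_0 add_cancel_right_left)

lemma hom_uminus: "x \<in> L \<Longrightarrow> \<sigma> (- x) = - \<sigma> x"
  using hom_add[of x "- x"] subring_set_uminus[OF L, of x] hom_0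
  by (simp add: minus_unique)

lemma hom_diff: "x \<in> L \<Longrightarrow> y \<in> L \<Longrightarrow> \<sigma> (x - y) = \<sigma> x - \<sigma> y"
  using hom_add[of x "- y"] subring_set_uminus[OF L, of y] hom_uminus by simp

lemma hom_power: "x \<in> L \<Longrightarrow> \<sigma> (x ^ n) = \<sigma> x ^ n"
  by (induction n) (auto simp: hom_1 hom_mult subring_set_power[OF L])

lemma hom_of_nat: "\<sigma> (of_nat n) = of_nat n"
  by (induction n) (auto simp: hom_0 hom_1 hom_add subring_set_1[OF L] subring_set_of_nat[OF L])

lemma hom_sum: "(\<And>i. i \<in> A \<Longrightarrow> f i \<in> L) \<Longrightarrow> \<sigma> (sum f A) = (\<Sum>i\<in>A. \<sigma> (f i))"
  by (induction A rule: infinite_finite_induct)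
    (auto simp: hom_0 hom_add subring_set_sum[OF L])

lemma hom_poly:
  assumes "P \<in> poly_over L" "x \<in> L"
  shows "\<sigma> (poly P x) = poly (map_poly \<sigma> P) (\<sigma> x)"
  using assms(1)
proof (induction P)
  case (pCons a P)
  have a: "a \<in> L" using poly_overD[OF pCons.prems, of 0] by simp
  have P: "P \<in> poly_over L" using poly_overD[OF pCons.prems, of "Suc i" for i] by (auto intro!: poly_overI)
  have "\<sigma> (a + x * poly P x) = \<sigma> a + \<sigma> x * \<sigma> (poly P x)"
    by (simp add: hom_add hom_mult a assms(2) subring_set_mult[OF L] poly_poly_over[OF L P])
  then show ?case
    using pCons.IH[OF P] pCons.hyps by (simp add: map_poly_pCons hom_0)
qed (simp add: hom_0)

lemma map_poly_mult_on:
  assumes "P \<in> poly_over L" "Q \<in> poly_over L"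
  shows "map_poly \<sigma> (P * Q) = map_poly \<sigma> P * map_poly \<sigma> Q"
proof (rule poly_eqI)
  fix n
  have "\<sigma> (\<Sum>i\<le>n. coeff P i * coeff Q (n - i)) = (\<Sum>i\<le>n. \<sigma> (coeff P i * coeff Q (n - i)))"
    by (rule hom_sum) (use assms in \<open>auto intro!: subring_set_mult[OF L] poly_overD\<close>)
  also have "\<dots> = (\<Sum>i\<le>n. \<sigma> (coeff P i) * \<sigma> (coeff Q (n - i)))"
    by (intro sum.cong refl hom_mult) (use assms in \<open>auto intro!: poly_overD\<close>)
  finally show "coeff (map_poly \<sigma> (P * Q)) n = coeff (map_poly \<sigma> P * map_poly \<sigma> Q) n"
    by (simp add: coeff_map_poly hom_0 coeff_mult)
qed

lemma linear_poly_over: "z \<in> L \<Longrightarrow> [:- z, 1:] \<in> poly_over L"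
  by (rule pCons_poly_over[OF L subring_set_uminus[OF L] const_poly_over[OF L subring_set_1[OF L]]])

lemma prod_linear_poly_over: "Z \<subseteq> L \<Longrightarrow> (\<Prod>z\<in>Z. [:- z, 1:]) \<in> poly_over L"
  by (rule subring_set_prod[OF subring_poly_over[OF L]]) (auto intro: linear_poly_over)

text \<open>Injectivity keeps the factors distinct, so the product over the set \<open>Z\<close>
  goes to the product over its image set.\<close>

lemma map_poly_prod_linear:
  assumes "finite Z" "Z \<subseteq> L" "inj_on \<sigma> Z"
  shows "map_poly \<sigma> (\<Prod>z\<in>Z. [:- z, 1:]) = (\<Prod>z\<in>\<sigma> ` Z. [:- z, 1:])"
proof -
  have lin: "map_poly \<sigma> [:- z, 1:] = [:- \<sigma> z, 1:]" if "z \<in> L" for z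
    using that by (simp add: map_poly_pCons hom_0 hom_1 hom_uminus)
  have "map_poly \<sigma> (\<Prod>z\<in>Z. [:- z, 1:]) = (\<Prod>z\<in>Z. [:- \<sigma> z, 1:])"
    using assms(1,2)
  proof (induction Z)
    case empty
    then show ?case by (simp add: hom_1 map_poly_1')
  next
    case (insert z Z)
    then show ?case
      using map_poly_mult_on[OF linear_poly_over prod_linear_poly_over, of z Z] lin[of z] by simp
  qed
  also have "\<dots> = (\<Prod>z\<in>\<sigma> ` Z. [:- z, 1:])"
    using prod.reindex[OF assms(3), of "\<lambda>z. [:- z, 1:]"] by (simp add: o_def)
  finally show ?thesis .
qed

lemma hom_eq_0_iff:
  assumes "subfield_set L" "x \<in> L"
  shows "\<sigma> x = 0 \<longleftrightarrow> x = 0"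
proof
  assume *: "\<sigma> x = 0"
  show "x = 0"
  proof (rule ccontr)
    assume "x \<noteq> 0"
    then have "\<sigma> (x * inverse x) = 1" by (simp add: hom_1)
    then show False
      using * hom_mult[OF assms(2) subfield_set_inverse[OF assms]] by simp
  qed
qed (simp add: hom_0)

lemma hom_inj_on: "subfield_set L \<Longrightarrow> inj_on \<sigma> L"
  using hom_diff hom_eq_0_iff subring_set_diff[OF L]
  by (metis (no_types, opaque_lifting) eq_iff_diff_eq_0 inj_onI)

end

section \<open>Fixed fields and orbit polynomials\<close>

lemma order_prod_linear:
  fixes Z :: "'a::field set"
  assumes "finite Z"
  shows "order a (\<Prod>z\<in>Z. [:- z, 1:]) = (if a \<in> Z then 1 else 0)"
  using assms
proof (induction Z)
  case (insert z Z)
  have nz: "(\<Prod>z\<in>Z. [:- z, 1:]) \<noteq> 0" using insert by (auto simp: prod_zero_iff)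
  have "order a ([:- z, 1:] * (\<Prod>z\<in>Z. [:- z, 1:])) = order a [:- z, 1:] + order a (\<Prod>z\<in>Z. [:- z, 1:])"
    by (rule order_mult) (use nz in \<open>intro no_zero_divisors, auto\<close>)
  moreover have "order a [:- z, 1:] = (if a = z then 1 else 0)"
    using order_power_n_n[of z 1] by (auto simp: order_0I simp del: order_power_n_n)
  ultimately show ?case using insert by auto
qed (auto simp: order_0I)

text \<open>The action may have a kernel, so that one group \<open>G\<close> can act on all stages
  of the tower. \<open>act_fixed\<close> and \<open>act_K\<close> together say that \<open>K\<close>
  is the fixed field.\<close>

locale galois_data =
  fixes G :: "('g, 'm) monoid_scheme" and \<rho> :: "'g \<Rightarrow> 'a::field \<Rightarrow> 'a" and L K :: "'a set"
  assumes G: "group G" and fin_G: "finite (carrier G)"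
    and L: "subfield_set L" and K: "subfield_set K" and K_L: "K \<subseteq> L"
    and act_hom: "g \<in> carrier G \<Longrightarrow> hom_on L (\<rho> g)"
    and act_closed: "g \<in> carrier G \<Longrightarrow> x \<in> L \<Longrightarrow> \<rho> g x \<in> L"
    and act_mult: "g \<in> carrier G \<Longrightarrow> h \<in> carrier G \<Longrightarrow> x \<in> L \<Longrightarrow> \<rho> (g \<otimes>\<^bsub>G\<^esub> h) x = \<rho> g (\<rho> h x)"
    and act_fixed: "x \<in> L \<Longrightarrow> (\<And>g. g \<in> carrier G \<Longrightarrow> \<rho> g x = x) \<Longrightarrow> x \<in> K"
    and act_K: "g \<in> carrier G \<Longrightarrow> x \<in> K \<Longrightarrow> \<rho> g x = x"
begin

lemma act_inj: "g \<in> carrier G \<Longrightarrow> inj_on (\<rho> g) L"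
  using hom_on.hom_inj_on[OF act_hom L] .

text \<open>Derived, not assumed: \<open>\<rho> \<one>\<close> is idempotent by
  \<open>act_mult\<close> and injective, being a homomorphism of fields.\<close>

lemma act_one: "x \<in> L \<Longrightarrow> \<rho> \<one>\<^bsub>G\<^esub> x = x"
proof -
  assume x: "x \<in> L"
  interpret G: group G by (rule G)
  have "\<rho> \<one>\<^bsub>G\<^esub> (\<rho> \<one>\<^bsub>G\<^esub> x) = \<rho> \<one>\<^bsub>G\<^esub> x"
    using act_mult[of "\<one>\<^bsub>G\<^esub>" "\<one>\<^bsub>G\<^esub>" x] x by simp
  then show ?thesis
    using act_inj[of "\<one>\<^bsub>G\<^esub>"] act_closed[of "\<one>\<^bsub>G\<^esub>" x] x by (simp add: inj_on_eq_iff)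
qed

definition orbit :: "'a \<Rightarrow> 'a set" where "orbit x = (\<lambda>g. \<rho> g x) ` carrier G"

text \<open>The product runs over the orbit as a set, hence over distinct linear factors. For
  \<open>x \<in> L\<close> its roots are thus simple and lie in \<open>L\<close>, which yields both
  separability and normality.\<close>

definition orbit_poly :: "'a \<Rightarrow> 'a poly" where "orbit_poly x = (\<Prod>z\<in>orbit x. [:- z, 1:])"

lemma orbit_finite: "finite (orbit x)"
  using fin_G by (simp add: orbit_def)

lemma orbit_subset: "x \<in> L \<Longrightarrow> orbit x \<subseteq> L"
  using act_closed by (auto simp: orbit_def)

lemma act_orbit: "g \<in> carrier G \<Longrightarrow> x \<in> L \<Longrightarrow> \<rho> g ` orbit x = orbit x"
proof -
  assume g: "g \<in> carrier G" and x: "x \<in> L"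
  interpret G: group G by (rule G)
  have "\<rho> g ` orbit x \<subseteq> orbit x"
    using g x by (auto simp: orbit_def act_mult[symmetric])
  moreover have "card (\<rho> g ` orbit x) = card (orbit x)"
    by (rule card_image) (use act_inj[OF g] orbit_subset[OF x] in \<open>auto intro: inj_on_subset\<close>)
  ultimately show ?thesis using orbit_finite card_subset_eq by metis
qed

text \<open>\<open>G\<close> permutes the orbit, so the coefficients are fixed by \<open>G\<close>
  and lie in \<open>K\<close>.\<close>

lemma orbit_poly_over: "x \<in> L \<Longrightarrow> orbit_poly x \<in> poly_over K"
proof (rule poly_overI)
  fix i assume x: "x \<in> L"
  interpret G: group G by (rule G)
  interpret h: hom_on L "\<rho> \<one>\<^bsub>G\<^esub>" by (rule act_hom) simp
  have PL: "orbit_poly x \<in> poly_over L"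
    unfolding orbit_poly_def by (rule h.prod_linear_poly_over) (rule orbit_subset[OF x])
  show "coeff (orbit_poly x) i \<in> K"
  proof (rule act_fixed)
    show "coeff (orbit_poly x) i \<in> L" using PL by (rule poly_overD)
    fix g assume g: "g \<in> carrier G"
    interpret g: hom_on L "\<rho> g" by (rule act_hom) fact
    have "map_poly (\<rho> g) (orbit_poly x) = orbit_poly x"
      unfolding orbit_poly_def
      using g.map_poly_prod_linear[OF orbit_finite orbit_subset[OF x] inj_on_subset[OF act_inj[OF g] orbit_subset[OF x]]]
      by (simp add: act_orbit[OF g x])
    then show "\<rho> g (coeff (orbit_poly x) i) = coeff (orbit_poly x) i"
      by (metis coeff_map_poly g.hom_0)
  qed
qed

lemma orbit_poly_nz: "orbit_poly x \<noteq> 0"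
  using orbit_finite by (auto simp: orbit_poly_def prod_zero_iff)

lemma poly_orbit_poly: "poly (orbit_poly x) y = 0 \<longleftrightarrow> y \<in> orbit x"
  using orbit_finite by (auto simp: orbit_poly_def poly_prod prod_zero_iff)

lemma orbit_refl: "x \<in> L \<Longrightarrow> x \<in> orbit x"
  using act_one[of x] group.is_monoid[OF G] unfolding orbit_def
  by (metis image_eqI monoid.one_closed)

lemma degree_orbit_poly: "degree (orbit_poly x) \<le> card (carrier G)"
proof -
  have "degree (orbit_poly x) = card (orbit x)"
    unfolding orbit_poly_def by (subst degree_prod_eq_sum_degree) auto
  also have "\<dots> \<le> card (carrier G)"
    unfolding orbit_def by (rule card_image_le[OF fin_G])
  finally show ?thesis .
qed

lemma order_orbit_poly: "order a (orbit_poly x) \<le> 1"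
  by (simp add: orbit_poly_def order_prod_linear[OF orbit_finite])

text \<open>Over an infinite field \<open>K\<close>, finitely many witnesses against
  \<open>\<sigma> = \<rho> g\<close> combine into one, whose image under \<open>\<sigma>\<close> would leave the orbit.\<close>

lemma hom_eq_act:
  assumes "infinite K" and \<sigma>: "hom_on L \<sigma>" and \<sigma>K: "\<And>c. c \<in> K \<Longrightarrow> \<sigma> c = c"
  shows "\<exists>g\<in>carrier G. \<forall>x\<in>L. \<sigma> x = \<rho> g x"
proof (rule ccontr)
  interpret \<sigma>: hom_on L \<sigma> by (rule \<sigma>)
  note Lr = subfield_set_imp_subring_set[OF L]
  assume "\<not> ?thesis"
  then have "\<forall>g\<in>carrier G. \<exists>x\<in>L. \<sigma> x \<noteq> \<rho> g x" by blast
  then obtain w where w: "\<And>g. g \<in> carrier G \<Longrightarrow> w g \<in> L" "\<And>g. g \<in> carrier G \<Longrightarrow> \<sigma> (w g) \<noteq> \<rho> g (w g)"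
    by metis
  \<comment> \<open>Distinct exponents \<open>idx h\<close> allow all \<open>w h\<close> to be
    combined into one \<open>x\<close>, the sum of the \<open>w h * c ^ idx h\<close>; that
    \<open>\<sigma> x \<noteq> \<rho> g x\<close> becomes the polynomial condition
    \<open>poly (Q g) c \<noteq> 0\<close> on \<open>c\<close>, which an infinite field can satisfy
    for all \<open>g\<close> at once.\<close>
  obtain idx :: "'g \<Rightarrow> nat" where idx: "inj_on idx (carrier G)"
    using finite_imp_inj_to_nat_seg[OF fin_G] by blast
  define Q where "Q g = (\<Sum>h\<in>carrier G. monom (\<sigma> (w h) - \<rho> g (w h)) (idx h))" for g
  have Q: "Q g \<noteq> 0" if g: "g \<in> carrier G" for g
  proof -
    have "coeff (Q g) (idx g) = (\<Sum>h\<in>carrier G. if h = g then \<sigma> (w h) - \<rho> g (w h) else 0)"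
      unfolding Q_def coeff_sum by (rule sum.cong) (use idx g in \<open>auto simp: inj_on_eq_iff\<close>)
    also have "\<dots> = \<sigma> (w g) - \<rho> g (w g)" using g fin_G by (simp add: sum.delta)
    finally show ?thesis using w(2)[OF g] by auto
  qed
  have "(\<Prod>g\<in>carrier G. Q g) \<noteq> 0" using Q fin_G by (auto simp: prod_zero_iff)
  then have "finite {c. poly (\<Prod>g\<in>carrier G. Q g) c = 0}" by (rule poly_roots_finite)
  with \<open>infinite K\<close> obtain c where c: "c \<in> K" "poly (\<Prod>g\<in>carrier G. Q g) c \<noteq> 0"
    by (metis (mono_tags, lifting) finite_subset mem_Collect_eq subsetI)
  define x where "x = (\<Sum>h\<in>carrier G. w h * c ^ idx h)"
  have cL: "c \<in> L" using c K_L by blast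
  have x: "x \<in> L" unfolding x_def
    by (intro subring_set_sum[OF Lr] subring_set_mult[OF Lr] subring_set_power[OF Lr] w cL)
  have expand: "\<tau> x = (\<Sum>h\<in>carrier G. \<tau> (w h) * c ^ idx h)" if "hom_on L \<tau>" "\<tau> c = c" for \<tau>
  proof -
    interpret \<tau>: hom_on L \<tau> by fact
    show ?thesis unfolding x_def
      by (subst \<tau>.hom_sum)
        (auto intro!: subring_set_mult[OF Lr] subring_set_power[OF Lr] w cL sum.cong
          simp: \<tau>.hom_mult \<tau>.hom_power w cL that subring_set_power[OF Lr])
  qed
  have "\<sigma> x \<noteq> \<rho> g x" if g: "g \<in> carrier G" for g
  proof -
    have "\<sigma> x - \<rho> g x = (\<Sum>h\<in>carrier G. (\<sigma> (w h) - \<rho> g (w h)) * c ^ idx h)"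
      by (simp add: expand[OF \<sigma> \<sigma>K[OF c(1)]] expand[OF act_hom[OF g] act_K[OF g c(1)]]
        sum_subtractf algebra_simps)
    also have "\<dots> = poly (Q g) c"
      by (simp add: Q_def poly_sum poly_monom)
    also have "\<dots> \<noteq> 0" using c(2) g fin_G by (auto simp: poly_prod prod_zero_iff)
    finally show ?thesis by auto
  qed
  moreover have "\<sigma> x \<in> orbit x"
  proof -
    have PK: "orbit_poly x \<in> poly_over K" by (rule orbit_poly_over[OF x])
    have "map_poly \<sigma> (orbit_poly x) = orbit_poly x"
      by (rule poly_eqI) (simp add: coeff_map_poly \<sigma>.hom_0 \<sigma>K poly_overD[OF PK])
    then have "poly (orbit_poly x) (\<sigma> x) = \<sigma> (poly (orbit_poly x) x)"
      using \<sigma>.hom_poly[OF poly_over_mono[OF K_L PK] x] by simp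
    also have "poly (orbit_poly x) x = 0" using poly_orbit_poly orbit_refl[OF x] by blast
    also have "\<sigma> 0 = 0" by (rule \<sigma>.hom_0)
    finally show ?thesis using poly_orbit_poly by blast
  qed
  ultimately show False by (auto simp: orbit_def)
qed

end

section \<open>Galois extensions inside the algebraic closure\<close>

interpretation to_acp: map_poly_inj_idom_hom to_ac
  by unfold_locales auto

lemma subfield_range_to_ac: "subfield_set (range to_ac)"
  unfolding subfield_set_def subring_set_def
  by (auto simp flip: to_ac_diff to_ac_mult to_ac_inverse to_ac_1)

lemma map_to_ac_poly_over: "map_poly to_ac f \<in> poly_over (range to_ac)"
  by (auto simp: poly_over_def)

lemma poly_over_range_to_ac:
  assumes "P \<in> poly_over (range to_ac)"
  obtains f where "P = map_poly to_ac f"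
proof
  show "P = map_poly to_ac (map_poly of_ac P)"
    by (rule poly_eqI) (simp add: coeff_map_poly to_ac_of_ac poly_overD[OF assms])
qed

lemma minimal_poly_exists:
  fixes x :: "'k::field alg_closure"
  obtains f :: "'k poly" where "irreducible f" "poly (map_poly to_ac f) x = 0"
    "\<And>g. poly (map_poly to_ac g) x = 0 \<Longrightarrow> f dvd g"
proof -
  define I where "I = {g :: 'k poly. poly (map_poly to_ac g) x = 0}"
  obtain p where p: "p \<in> I" "p \<noteq> 0"
    using alg_closure_algebraic[of x] unfolding I_def by blast
  have UN: "subfield_set (UNIV :: 'k set)" by (auto simp: subfield_set_def subring_set_def)
  obtain f where f: "f \<in> I" "lead_coeff f = 1" "\<And>g. g \<in> I \<Longrightarrow> f dvd g"
      "\<And>g. g \<in> I \<Longrightarrow> degree g < degree f \<Longrightarrow> g = 0"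
  proof (rule poly_over_principal[OF UN, of I, OF _ _ _ p])
    show "I \<subseteq> poly_over UNIV" by (auto simp: poly_over_def)
  qed (auto simp: I_def to_acp.hom_mult to_acp.hom_minus)
  have f0: "f \<noteq> 0" using f(2) by auto
  have "irreducible f"
  proof (rule irreducibleI[OF f0])
    show "\<not> f dvd 1"
    proof
      assume "f dvd 1"
      then obtain c where "f = [:c:]" "c \<noteq> 0" using is_unit_polyE by (metis is_unit_poly_iff dvd_0_left_iff zero_neq_one)
      then show False using f(1) by (simp add: I_def)
    qed
    fix a b assume ab: "f = a * b"
    then have nz: "a \<noteq> 0" "b \<noteq> 0" using f0 by auto
    have deg: "degree f = degree a + degree b" using nz by (simp add: ab degree_mult_eq)
    from f(1) have "a \<in> I \<or> b \<in> I" by (auto simp: I_def ab to_acp.hom_mult)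
    then show "a dvd 1 \<or> b dvd 1"
    proof
      assume "a \<in> I"
      then have "\<not> degree a < degree f" using f(4) nz by blast
      then have "degree b = 0" using deg by simp
      then show ?thesis using nz by (simp add: is_unit_iff_degree)
    next
      assume "b \<in> I"
      then have "\<not> degree b < degree f" using f(4) nz by blast
      then have "degree a = 0" using deg by simp
      then show ?thesis using nz by (simp add: is_unit_iff_degree)
    qed
  qed
  then show ?thesis using that[of f] f(1,3) by (auto simp: I_def)
qed

text \<open>The minimal polynomial divides \<open>f\<close>, so by irreducibility the two are
  associated and \<open>f\<close> inherits its divisibility property.\<close>

lemma irreducible_root_dvd:
  fixes f g :: "'k::field poly"
  assumes "irreducible f" "poly (map_poly to_ac f) x = 0" "poly (map_poly to_ac g) x = 0"
  shows "f dvd g"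
proof -
  obtain m :: "'k poly" where m: "irreducible m" "poly (map_poly to_ac m) x = 0"
      "\<And>g. poly (map_poly to_ac g) x = 0 \<Longrightarrow> m dvd g"
    by (rule minimal_poly_exists[of x]) simp
  obtain u where u: "f = m * u" using m(3)[OF assms(2)] by (elim dvdE)
  have "u dvd 1" using assms(1) m(1) u by (metis irreducible_def)
  then have "f dvd m" using u by (metis dvd_mult_unit_iff dvd_refl)
  then show ?thesis using m(3)[OF assms(3)] dvd_trans by blast
qed

text \<open>The notions of the theorem speak of substructures of
  \<open>ring_of_type_algebra\<close>, whereas the proof works with the type class operations. This
  equivalence and the next one are the bridge.\<close>

lemma subring_set_iff_subring:
  "subring_set S \<longleftrightarrow> subring S (ring_of_type_algebra :: 'a::field ring)"
proof -
  interpret R: field "ring_of_type_algebra :: 'a ring" by rule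
  have a_inv: "\<ominus>\<^bsub>ring_of_type_algebra\<^esub> x = - x" for x :: 'a
    by (rule R.minus_equality) (auto simp: ring_of_type_algebra_def)
  show ?thesis
  proof
    assume S: "subring_set S"
    show "subring S (ring_of_type_algebra :: 'a ring)"
      by (rule R.subringI) (use subring_set_closed[OF S] in \<open>auto simp: a_inv, auto simp: ring_of_type_algebra_def\<close>)
  next
    assume "subring S (ring_of_type_algebra :: 'a ring)"
    from subringE(3,5,6,7)[OF this] show "subring_set S"
      by (intro subring_setI') (auto simp: a_inv, auto simp: ring_of_type_algebra_def)
  qed
qed

lemma subfield_set_iff_subfield:
  "subfield_set S \<longleftrightarrow> subfield S (ring_of_type_algebra :: 'a::field ring)"
proof -
  interpret R: field "ring_of_type_algebra :: 'a ring" by rule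
  have m_inv: "inv\<^bsub>ring_of_type_algebra\<^esub> x = inverse x" if "x \<noteq> 0" for x :: 'a
    by (rule R.comm_inv_char) (use that in \<open>auto simp: ring_of_type_algebra_def\<close>)
  show ?thesis
  proof
    assume S: "subfield_set S"
    show "subfield S (ring_of_type_algebra :: 'a ring)"
    proof (rule R.subfieldI')
      show "subring S (ring_of_type_algebra :: 'a ring)"
        using S subring_set_iff_subring by blast
      show "inv\<^bsub>ring_of_type_algebra\<^esub> k \<in> S" if "k \<in> S - {\<zero>\<^bsub>ring_of_type_algebra\<^esub>}" for k
        using that m_inv[of k] subfield_set_inverse[OF S, of k] by (auto simp: ring_of_type_algebra_def)
    qed
  next
    assume S: "subfield S (ring_of_type_algebra :: 'a ring)"
    have "inverse x \<in> S" if "x \<in> S" for x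
      using R.subfield_m_inv(1)[OF S, of x] m_inv[of x] that
      by (cases "x = 0") (auto simp: ring_of_type_algebra_def)
    moreover have "subring_set S" using subfieldE(1)[OF S] subring_set_iff_subring by blast
    ultimately show "subfield_set S" by (auto simp: subfield_set_def)
  qed
qed

lemma ring_hom_iff_hom_on:
  assumes "subring_set L" "\<And>x. x \<in> L \<Longrightarrow> \<sigma> x \<in> L"
  shows "\<sigma> \<in> Ring.ring_hom (ring_of_type_algebra\<lparr>carrier := L\<rparr>) (ring_of_type_algebra\<lparr>carrier := L\<rparr>)
    \<longleftrightarrow> hom_on L \<sigma>"
  using assms by (auto simp: hom_on_def Ring.ring_hom_def ring_of_type_algebra_def)

lemma mult_galois_group:
  assumes "\<sigma> \<in> carrier (galois_group L)" "\<tau> \<in> carrier (galois_group L)"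
  shows "\<sigma> \<otimes>\<^bsub>galois_group L\<^esub> \<tau> = compose L \<sigma> \<tau>"
  using assms by (simp add: galois_group_def BijGroup_def)

lemma galois_group_carrier_iff:
  assumes "subring_set L"
  shows "\<sigma> \<in> carrier (galois_group L) \<longleftrightarrow>
    \<sigma> \<in> extensional L \<and> bij_betw \<sigma> L L \<and> hom_on L \<sigma> \<and> (\<forall>c. \<sigma> (to_ac c) = to_ac c)"
  using ring_hom_iff_hom_on[OF assms, of \<sigma>]
  by (auto simp: galois_group_def Bij_def bij_betw_apply)

lemma (in hom_on) cong:
  assumes "\<And>x. x \<in> L \<Longrightarrow> \<tau> x = \<sigma> x"
  shows "hom_on L \<tau>"
  by unfold_locales
    (use assms L in \<open>auto simp: hom_1 hom_add hom_mult subring_set_1 subring_set_add subring_set_mult\<close>)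

locale galois_data_ac = galois_data G \<rho> L "range to_ac"
  for G :: "('g, 'm) monoid_scheme" and \<rho> :: "'g \<Rightarrow> 'k::field alg_closure \<Rightarrow> 'k alg_closure" and L
begin

text \<open>\<open>f\<close> is the minimal polynomial of \<open>x\<close> up to a unit, and the
  orbit polynomial lies over the base field. A divisor of a product of distinct linear factors over
  \<open>L\<close> again splits in \<open>L\<close> with simple roots.\<close>

lemma irreducible_dvd_orbit_poly:
  assumes "x \<in> L" "irreducible f" "poly (map_poly to_ac f) x = 0"
  shows "map_poly to_ac f dvd orbit_poly x"
proof -
  obtain P where P: "orbit_poly x = map_poly to_ac P"
    using poly_over_range_to_ac[OF orbit_poly_over[OF assms(1)]] by blast
  have "poly (map_poly to_ac P) x = 0"
    using poly_orbit_poly[of x x] orbit_refl[OF assms(1)] by (simp flip: P)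
  then have "f dvd P" using irreducible_root_dvd assms by blast
  then show ?thesis unfolding P by (rule to_acp.hom_dvd)
qed

lemma normal: "normal_extension L"
proof -
  have "y \<in> L" if f: "irreducible f" "x \<in> L" "poly (map_poly to_ac f) x = 0"
    and y: "poly (map_poly to_ac f) y = 0" for f x y
  proof -
    have "poly (orbit_poly x) y = 0"
      using irreducible_dvd_orbit_poly[OF f(2,1,3)] y by (auto elim!: dvdE)
    then show ?thesis using poly_orbit_poly orbit_subset[OF f(2)] by blast
  qed
  then show ?thesis unfolding normal_extension_def by blast
qed

lemma separable: "separable_extension L"
proof -
  have "rsquarefree (map_poly to_ac f)"
    if f: "x \<in> L" "irreducible f" "poly (map_poly to_ac f) x = 0" for f x
  proof -
    have "order a (map_poly to_ac f) \<le> 1" for a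
      using dvd_imp_order_le[OF orbit_poly_nz irreducible_dvd_orbit_poly[OF f], of a] order_orbit_poly[of a x] by linarith
    then have "order a (map_poly to_ac f) = 0 \<or> order a (map_poly to_ac f) = 1" for a
      by (metis less_one nat_less_le)
    moreover have "f \<noteq> 0" using f(2) by auto
    ultimately show ?thesis by (simp add: rsquarefree_def)
  qed
  then show ?thesis unfolding separable_extension_def by blast
qed

lemma restrict_act_in_galois_group:
  assumes g: "g \<in> carrier G"
  shows "restrict (\<rho> g) L \<in> carrier (galois_group L)"
proof -
  interpret G: group G by (rule G)
  have "\<rho> g (\<rho> (inv\<^bsub>G\<^esub> g) x) = x" if "x \<in> L" for x
    using act_mult[of g "inv\<^bsub>G\<^esub> g" x] g that act_one by simp
  then have "\<rho> g ` L = L"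
    using act_closed g by (metis G.inv_closed image_subset_iff subset_antisym subsetI rev_image_eqI)
  then have "bij_betw (\<rho> g) L L" using act_inj[OF g] by (simp add: bij_betw_def)
  then have "bij_betw (restrict (\<rho> g) L) L L"
    by (simp add: bij_betw_restrict_eq)
  moreover have "hom_on L (restrict (\<rho> g) L)"
    by (rule hom_on.cong[OF act_hom[OF g]]) simp
  moreover have "restrict (\<rho> g) L (to_ac c) = to_ac c" for c
    using K_L act_K[OF g, of "to_ac c"] by auto
  ultimately show ?thesis
    using galois_group_carrier_iff[OF subfield_set_imp_subring_set[OF L]] by auto
qed

text \<open>Injectivity is faithfulness. Surjectivity comes from \<open>hom_eq_act\<close>, which is
  where the base field has to be infinite.\<close>

lemma galois_group_iso:
  assumes "infinite (UNIV :: 'k set)"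
    and faithful: "\<And>g. g \<in> carrier G \<Longrightarrow> (\<And>x. x \<in> L \<Longrightarrow> \<rho> g x = x) \<Longrightarrow> g = \<one>\<^bsub>G\<^esub>"
  shows "galois_group L \<cong> G"
proof -
  interpret G: group G by (rule G)
  \<comment> \<open>Restriction puts the automorphisms into \<open>extensional L\<close>, as
    \<open>BijGroup\<close> demands.\<close>
  define \<phi> where "\<phi> g = restrict (\<rho> g) L" for g
  have \<phi>: "\<phi> g \<in> carrier (galois_group L)" if "g \<in> carrier G" for g
    using restrict_act_in_galois_group that by (simp add: \<phi>_def)
  have "\<phi> (g \<otimes>\<^bsub>G\<^esub> h) = \<phi> g \<otimes>\<^bsub>galois_group L\<^esub> \<phi> h" if "g \<in> carrier G" "h \<in> carrier G" for g h
    unfolding mult_galois_group[OF \<phi>[OF that(1)] \<phi>[OF that(2)]]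
    by (auto simp: \<phi>_def compose_def act_mult that act_closed)
  moreover have "inj_on \<phi> (carrier G)"
  proof (rule inj_onI)
    fix g h assume gh: "g \<in> carrier G" "h \<in> carrier G" "\<phi> g = \<phi> h"
    have "\<rho> (inv\<^bsub>G\<^esub> g \<otimes>\<^bsub>G\<^esub> h) x = x" if x: "x \<in> L" for x
    proof -
      have "\<rho> h x = \<rho> g x" using fun_cong[OF gh(3), of x] x by (simp add: \<phi>_def)
      then show ?thesis using gh x act_mult[of "inv\<^bsub>G\<^esub> g" h x] act_mult[of "inv\<^bsub>G\<^esub> g" g x] act_one by simp
    qed
    then have "inv\<^bsub>G\<^esub> g \<otimes>\<^bsub>G\<^esub> h = \<one>\<^bsub>G\<^esub>" by (intro faithful) (use gh in auto)
    then show "g = h" using gh by (metis G.inv_closed G.inv_equality G.inv_inv)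
  qed
  moreover have "carrier (galois_group L) \<subseteq> \<phi> ` carrier G"
  proof
    fix \<sigma> assume \<sigma>: "\<sigma> \<in> carrier (galois_group L)"
    have \<sigma>': "hom_on L \<sigma>" "\<sigma> \<in> extensional L" "\<And>c. c \<in> range to_ac \<Longrightarrow> \<sigma> c = c"
      using \<sigma> by (auto simp: galois_group_carrier_iff[OF subfield_set_imp_subring_set[OF L]])
    have inf: "infinite (range (to_ac :: 'k \<Rightarrow> _))"
      using assms(1) inj_to_ac finite_imageD by blast
    obtain g where g: "g \<in> carrier G" "\<forall>x\<in>L. \<sigma> x = \<rho> g x"
      using hom_eq_act[OF inf \<sigma>'(1,3)] by blast
    have "\<sigma> = \<phi> g" using g \<sigma>'(2) by (auto simp: \<phi>_def extensional_def)
    then show "\<sigma> \<in> \<phi> ` carrier G" using g by blast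
  qed
  ultimately have "\<phi> \<in> iso G (galois_group L)"
    using \<phi> by (auto simp: iso_def hom_def bij_betw_def)
  then have "G \<cong> galois_group L" by (auto simp: is_iso_def)
  then show ?thesis by (rule G.iso_sym)
qed

end

section \<open>Primitive elements and the fixed field of the Galois group\<close>

lemma map_poly_to_ac_pCons [simp]: "map_poly to_ac (pCons a p) = pCons (to_ac a) (map_poly to_ac p)"
  by (rule to_acp.base.map_poly_pCons_hom)

lemma size_proots_alg_closed:
  fixes p :: "'a::alg_closed_field poly"
  assumes "p \<noteq> 0"
  shows "size (proots p) = degree p"
proof -
  obtain A where A: "size A = degree p" "p = smult (lead_coeff p) (\<Prod>x\<in>#A. [:- x, 1:])"
    using alg_closed_imp_factorization[OF assms] by blast
  have "proots (\<Prod>x\<in>#A. [:- x, 1:]) = A"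
  proof (induction A)
    case (add x A)
    have "(\<Prod>x\<in>#A. [:- x, 1:]) \<noteq> (0 :: 'a poly)" by (auto simp: prod_mset_zero_iff)
    then have "proots ([:- x, 1:] * (\<Prod>x\<in>#A. [:- x, 1:])) = proots [:- x, 1:] + A"
      using proots_mult[of "[:- x, 1:]" "\<Prod>x\<in>#A. [:- x, 1:]"] add by auto
    then show ?case by simp
  qed simp
  then have "proots p = A" using A(2) assms by (metis leading_coeff_0_iff proots_smult)
  then show ?thesis using A(1) by simp
qed

text \<open>Over an algebraically closed field the roots with multiplicity number
  \<open>degree p\<close>; here each multiplicity is 1.\<close>

lemma card_roots_rsquarefree:
  fixes p :: "'a::alg_closed_field poly"
  assumes "rsquarefree p"
  shows "card {x. poly p x = 0} = degree p"
proof -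
  have p: "p \<noteq> 0" "\<And>a. order a p = 0 \<or> order a p = 1" using assms by (auto simp: rsquarefree_def)
  have "proots p = mset_set {x. poly p x = 0}"
  proof (rule multiset_eqI)
    fix a
    show "count (proots p) a = count (mset_set {x. poly p x = 0}) a"
      using p(2)[of a] order_root[of p a] p(1) poly_roots_finite[OF p(1)]
      by (auto simp: count_mset_set')
  qed
  then show ?thesis using size_proots_alg_closed[OF p(1)] by simp
qed

text \<open>If \<open>f = a + X q\<close> is the minimal polynomial of \<open>x \<noteq> 0\<close>,
  then \<open>a \<noteq> 0\<close> by minimality, and \<open>- q(x) / a\<close> is the inverse of
  \<open>x\<close>.\<close>

lemma subring_over_base_is_subfield:
  fixes S :: "'k::field alg_closure set"
  assumes S: "subring_set S" and KS: "range to_ac \<subseteq> S"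
  shows "subfield_set S"
proof -
  have "inverse x \<in> S" if x: "x \<in> S" "x \<noteq> 0" for x
  proof -
    obtain f :: "'k poly" where f: "irreducible f" "poly (map_poly to_ac f) x = 0"
      "\<And>g. poly (map_poly to_ac g) x = 0 \<Longrightarrow> f dvd g" by (rule minimal_poly_exists[of x]) simp
    obtain a q where aq: "f = pCons a q" by (cases f)
    have eq: "to_ac a + x * poly (map_poly to_ac q) x = 0" using f(2) by (simp add: aq map_poly_pCons)
    have "a \<noteq> 0"
    proof
      assume "a = 0"
      then have "poly (map_poly to_ac q) x = 0" using eq x by simp
      then have "f dvd q" by (rule f(3))
      moreover have q: "q \<noteq> 0" using f(1) aq \<open>a = 0\<close> by auto
      ultimately have "degree f \<le> degree q" by (rule dvd_imp_degree_le)
      then show False using q aq by simp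
    qed
    then have "x * (- poly (map_poly to_ac q) x / to_ac a) = 1"
      using eq by (simp add: field_simps add_eq_0_iff)
    then have "inverse x = - poly (map_poly to_ac q) x * to_ac (inverse a)"
      using inverse_unique by (fastforce simp: divide_inverse)
    moreover have "poly (map_poly to_ac q) x \<in> S"
      by (rule poly_poly_over[OF S poly_over_mono[OF KS map_to_ac_poly_over] x(1)])
    moreover have "to_ac (inverse a) \<in> S" using KS by blast
    ultimately show ?thesis using subring_set_closed[OF S] by metis
  qed
  then show ?thesis unfolding subfield_set_def using S subring_set_0[OF S]
    by (metis inverse_zero)
qed

lemmas subring_range_to_ac = subfield_set_imp_subring_set[OF subfield_range_to_ac]

lemma subfield_adjoin_base: "subfield_set (adjoin (range to_ac) y)"
  by (intro subring_over_base_is_subfield subring_adjoin adjoin_superset subring_range_to_ac)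

lemma adjoin_base_iff: "x \<in> adjoin (range to_ac) y \<longleftrightarrow> (\<exists>q. x = poly (map_poly to_ac q) y)"
  unfolding adjoin_def using map_to_ac_poly_over poly_over_range_to_ac by blast

text \<open>The greatest common divisor \<open>D\<close> of \<open>P\<close> and \<open>Q\<close>
  over \<open>F\<close> has the single root \<open>u\<close>, and this root is simple since
  \<open>Q\<close> is squarefree. So \<open>D = X - u\<close> has coefficients in
  \<open>F\<close>.\<close>

lemma linear_in_subfield_of_unique_root:
  fixes P Q :: "'a::alg_closed_field poly"
  assumes F: "subfield_set F" and PQ: "P \<in> poly_over F" "Q \<in> poly_over F" and Q: "rsquarefree Q"
    and u: "\<And>z. poly P z = 0 \<and> poly Q z = 0 \<longleftrightarrow> z = u"
  shows "u \<in> F"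
proof -
  note Fr = subfield_set_imp_subring_set[OF F]
  note sub = subring_poly_over[OF Fr]
  have Q0: "Q \<noteq> 0" using Q by (simp add: rsquarefree_def)
  define I where "I = {U * P + V * Q | U V. U \<in> poly_over F \<and> V \<in> poly_over F}"
  have PI: "P \<in> I" "Q \<in> I" unfolding I_def
    using subring_set_0[OF sub] subring_set_1[OF sub] by force+
  obtain D where D: "D \<in> I" "lead_coeff D = 1" "\<And>P. P \<in> I \<Longrightarrow> D dvd P"
      "\<And>P. P \<in> I \<Longrightarrow> degree P < degree D \<Longrightarrow> P = 0"
  proof (rule poly_over_principal[OF F, of I, OF _ _ _ PI(2) Q0])
    show "I \<subseteq> poly_over F" unfolding I_def using PQ by (auto intro!: subring_set_add[OF sub] subring_set_mult[OF sub])
  next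
    fix A B assume "A \<in> I" "B \<in> I"
    then obtain U V U' V' where *: "U \<in> poly_over F" "V \<in> poly_over F" "U' \<in> poly_over F" "V' \<in> poly_over F"
      "A = U * P + V * Q" "B = U' * P + V' * Q" unfolding I_def by blast
    have "A - B = (U - U') * P + (V - V') * Q" using * by (simp add: algebra_simps)
    moreover have "U - U' \<in> poly_over F" "V - V' \<in> poly_over F" using * subring_set_diff[OF sub] by auto
    ultimately show "A - B \<in> I" unfolding I_def by blast
  next
    fix C A assume C: "C \<in> poly_over F" and "A \<in> I"
    then obtain U V where *: "U \<in> poly_over F" "V \<in> poly_over F" "A = U * P + V * Q" unfolding I_def by blast
    have "C * A = (C * U) * P + (C * V) * Q" using * by (simp add: algebra_simps)
    moreover have "C * U \<in> poly_over F" "C * V \<in> poly_over F" using C * subring_set_mult[OF sub] by auto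
    ultimately show "C * A \<in> I" unfolding I_def by blast
  qed auto
  have D0: "D \<noteq> 0" using D(2) by auto
  have "poly D u = 0" using D(1) u[of u] by (auto simp: I_def)
  moreover have "z = u" if "poly D z = 0" for z
    using that D(3)[OF PI(1)] D(3)[OF PI(2)] u[of z] by (auto elim!: dvdE)
  ultimately have roots: "{z. poly D z = 0} = {u}" by blast
  have "order z D \<le> 1" for z
    using dvd_imp_order_le[OF Q0 D(3)[OF PI(2)], of z] Q by (metis le_trans less_one nat_less_le nle_le rsquarefree_def)
  then have "rsquarefree D" using D0 by (simp add: rsquarefree_def) (metis le_Suc_eq le_zero_eq One_nat_def)
  then have deg: "degree D = 1" using card_roots_rsquarefree[of D] roots by simp
  obtain a b where "D = [:b, a:]" by (rule degree1_coeffs[OF deg])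
  then have b: "D = [:b, 1:]" using D(2) deg by auto
  have DF: "D \<in> poly_over F"
    using D(1) PQ unfolding I_def by (auto intro!: subring_set_add[OF sub] subring_set_mult[OF sub])
  have "b \<in> F" using poly_overD[OF DF, of 0] b by simp
  moreover have "u = - b" using \<open>poly D u = 0\<close> b by (simp add: eq_neg_iff_add_eq_0 add.commute)
  ultimately show ?thesis using subring_set_uminus[OF Fr] by simp
qed

text \<open>The generators are absorbed one at a time: \<open>\<gamma>\<close> and \<open>u\<close>
  are replaced by \<open>\<delta> = \<gamma> + c u\<close>, with \<open>c\<close> in the infinite
  base field outside a finite set.\<close>

theorem primitive_element:
  fixes L :: "'k::field alg_closure set"
  assumes inf: "infinite (UNIV :: 'k set)" and L: "subfield_set L" "range to_ac \<subseteq> L"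
    and sep: "separable_extension L" and "set us \<subseteq> L"
  shows "\<exists>\<gamma>\<in>L. set us \<subseteq> adjoin (range to_ac) \<gamma>"
  using \<open>set us \<subseteq> L\<close>
proof (induction us)
  case Nil
  then show ?case using subring_set_0[OF subfield_set_imp_subring_set[OF L(1)]] by auto
next
  case (Cons u us)
  then obtain \<gamma> where \<gamma>: "\<gamma> \<in> L" "set us \<subseteq> adjoin (range to_ac) \<gamma>" and u: "u \<in> L" by auto
  obtain f :: "'k poly" where f: "irreducible f" "poly (map_poly to_ac f) \<gamma> = 0"
    by (rule minimal_poly_exists[of \<gamma>]) simp
  obtain g :: "'k poly" where g: "irreducible g" "poly (map_poly to_ac g) u = 0"
    by (rule minimal_poly_exists[of u]) simp
  define F where "F = map_poly to_ac f"
  define H where "H = map_poly to_ac g"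
  have F: "F \<noteq> 0" using f(1) by (auto simp: F_def)
  have H: "rsquarefree H" using sep g u by (auto simp: separable_extension_def H_def)
  then have H0: "H \<noteq> 0" by (simp add: rsquarefree_def)
  \<comment> \<open>These are the \<open>c\<close> with
    \<open>\<gamma> + c u = \<alpha> + c \<beta>\<close> for a root \<open>\<alpha>\<close> of
    \<open>F\<close> and a root \<open>\<beta> \<noteq> u\<close> of \<open>H\<close>; for
    \<open>\<beta> = u\<close> the quotient is 0 by convention and merely excludes one more
    value.\<close>
  have "finite ((\<lambda>(\<alpha>, \<beta>). (\<alpha> - \<gamma>) / (u - \<beta>)) ` ({z. poly F z = 0} \<times> {z. poly H z = 0}))"
    using poly_roots_finite[OF F] poly_roots_finite[OF H0] by auto
  moreover have "infinite (range (to_ac :: 'k \<Rightarrow> _))" using inf inj_to_ac finite_imageD by blast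
  ultimately obtain c' where c': "c' \<in> range (to_ac :: 'k \<Rightarrow> _)"
    "c' \<notin> (\<lambda>(\<alpha>, \<beta>). (\<alpha> - \<gamma>) / (u - \<beta>)) ` ({z. poly F z = 0} \<times> {z. poly H z = 0})"
    by (meson finite_subset subsetI)
  then obtain c where c: "c' = to_ac c" by blast
  have c'_ne: "c' \<noteq> (\<alpha> - \<gamma>) / (u - \<beta>)" if "poly F \<alpha> = 0" "poly H \<beta> = 0" for \<alpha> \<beta>
    using c'(2) that by auto
  define \<delta> where "\<delta> = \<gamma> + c' * u"
  note Lr = subfield_set_imp_subring_set[OF L(1)]
  have \<delta>: "\<delta> \<in> L" unfolding \<delta>_def using \<gamma>(1) u c'(1) L(2) by (auto intro!: subring_set_add[OF Lr] subring_set_mult[OF Lr])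
  define A where "A = adjoin (range to_ac) \<delta>"
  have A: "subfield_set A" unfolding A_def by (rule subfield_adjoin_base)
  note Ar = subfield_set_imp_subring_set[OF A]
  have KA: "range to_ac \<subseteq> A" unfolding A_def by (rule adjoin_superset[OF subring_range_to_ac])
  have \<delta>A: "\<delta> \<in> A" unfolding A_def by (rule adjoin_gen[OF subring_range_to_ac])
  have c'A: "c' \<in> A" using c'(1) KA by blast
  \<comment> \<open>\<open>P\<close> vanishes at \<open>z\<close> exactly if
    \<open>\<delta> - c' z\<close> is a root of \<open>F\<close>. So \<open>u\<close> is a common
    root of \<open>P\<close> and \<open>H\<close>, and by the choice of \<open>c'\<close> the only
    one.\<close>
  define P where "P = pcompose F [:\<delta>, - c':]"
  have uA: "u \<in> A"
  proof (rule linear_in_subfield_of_unique_root[OF A, of P H])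
    show "P \<in> poly_over A" unfolding P_def F_def
      by (intro pcompose_poly_over[OF Ar] poly_over_mono[OF KA map_to_ac_poly_over]
        pCons_poly_over[OF Ar \<delta>A] const_poly_over[OF Ar] subring_set_uminus[OF Ar c'A])
    show "H \<in> poly_over A" unfolding H_def by (rule poly_over_mono[OF KA map_to_ac_poly_over])
    show "rsquarefree H" by (rule H)
    fix z
    show "poly P z = 0 \<and> poly H z = 0 \<longleftrightarrow> z = u"
    proof
      assume z: "poly P z = 0 \<and> poly H z = 0"
      show "z = u"
      proof (rule ccontr)
        assume "z \<noteq> u"
        have "poly F (\<delta> - c' * z) = 0" using z by (simp add: P_def poly_pcompose algebra_simps)
        then have "c' \<noteq> (\<delta> - c' * z - \<gamma>) / (u - z)" using c'_ne z by blast
        then show False using \<open>z \<noteq> u\<close> by (simp add: \<delta>_def field_simps)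
      qed
    next
      assume "z = u"
      then show "poly P z = 0 \<and> poly H z = 0"
        using f(2) g(2) by (simp add: P_def poly_pcompose \<delta>_def F_def H_def algebra_simps)
    qed
  qed
  have "\<gamma> = \<delta> - c' * u" by (simp add: \<delta>_def)
  then have "\<gamma> \<in> A" using \<delta>A c'A uA by (auto intro!: subring_set_diff[OF Ar] subring_set_mult[OF Ar])
  then have "adjoin (range to_ac) \<gamma> \<subseteq> A" by (rule adjoin_least[OF Ar KA])
  then show ?case using \<gamma>(2) uA \<delta> unfolding A_def by (intro bexI[of _ \<delta>]) auto
qed

text \<open>Extracts from finite dimension what the primitive element needs: a finite list generates
  \<open>L\<close> as a ring over the base field.\<close>

lemma finite_extension_span:
  fixes L :: "'k::field alg_closure set"
  assumes "finite_extension L"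
  obtains us where "set us \<subseteq> L" "\<And>S. subring_set S \<Longrightarrow> range to_ac \<subseteq> S \<Longrightarrow> set us \<subseteq> S \<Longrightarrow> L \<subseteq> S"
proof -
  interpret R: field "ring_of_type_algebra :: 'k alg_closure ring" by rule
  let ?K = "range (to_ac :: 'k \<Rightarrow> _)"
  have K: "subfield ?K (ring_of_type_algebra :: 'k alg_closure ring)"
    using subfield_range_to_ac subfield_set_iff_subfield by blast
  obtain n where "R.dimension n ?K L"
    using assms unfolding finite_extension_def R.finite_dimension_def by blast
  then obtain us where us: "set us \<subseteq> carrier ring_of_type_algebra" "R.Span ?K us = L"
    using R.exists_base[OF K] by blast
  have "L \<subseteq> S" if S: "subring_set S" "?K \<subseteq> S" "set us \<subseteq> S" for S
  proof -
    have "subring S ring_of_type_algebra" using S(1) subring_set_iff_subring by blast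
    then have "subgroup S (add_monoid (ring_of_type_algebra :: 'k alg_closure ring))"
      by (rule subring.axioms(1))
    moreover have "?K <#>\<^bsub>ring_of_type_algebra\<^esub> set us \<subseteq> S"
      using subring_set_mult[OF S(1) subsetD[OF S(2)] subsetD[OF S(3)]]
      by (auto simp: set_mult_def ring_of_type_algebra_def)
    ultimately show ?thesis
      using R.Span_min[OF K us(1)] us(2) by blast
  qed
  moreover have "set us \<subseteq> L" using R.Span_base_incl[OF K us(1)] us(2) by blast
  ultimately show ?thesis using that by blast
qed

lemma galois_group_mult_closed:
  assumes L: "subring_set L" "range to_ac \<subseteq> L"
    and \<sigma>: "\<sigma> \<in> carrier (galois_group L)" and \<tau>: "\<tau> \<in> carrier (galois_group L)"
  shows "compose L \<sigma> \<tau> \<in> carrier (galois_group L)"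
proof -
  note iff = galois_group_carrier_iff[OF L(1)]
  have \<sigma>': "bij_betw \<sigma> L L" "hom_on L \<sigma>" "\<And>c. \<sigma> (to_ac c) = to_ac c" using \<sigma> by (auto simp: iff)
  have \<tau>': "bij_betw \<tau> L L" "hom_on L \<tau>" "\<And>c. \<tau> (to_ac c) = to_ac c" using \<tau> by (auto simp: iff)
  interpret \<sigma>: hom_on L \<sigma> by fact
  interpret \<tau>: hom_on L \<tau> by fact
  have cl: "\<tau> x \<in> L" if "x \<in> L" for x using \<tau>'(1) that by (rule bij_betw_apply)
  have "hom_on L (compose L \<sigma> \<tau>)"
    unfolding hom_on_def compose_def
    by (auto simp: L subring_set_closed[OF L(1)] \<tau>.hom_1 \<tau>.hom_add \<tau>.hom_mult \<sigma>.hom_1 \<sigma>.hom_add \<sigma>.hom_mult cl)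
  moreover have "compose L \<sigma> \<tau> (to_ac c) = to_ac c" for c
    using L(2) by (auto simp: compose_def \<sigma>' \<tau>')
  moreover have "bij_betw (compose L \<sigma> \<tau>) L L"
    by (rule bij_betw_compose) (rule \<tau>'(1) \<sigma>'(1))+
  ultimately show ?thesis by (auto simp: iff)
qed

text \<open>Evaluation at \<open>\<gamma>\<close> and at \<open>\<gamma>'\<close> have the same
  kernel, the multiples of \<open>f\<close>, so \<open>q(\<gamma>) \<mapsto> q(\<gamma>')\<close> is
  well defined; normality puts \<open>\<gamma>'\<close> into \<open>L\<close>.\<close>

lemma conjugate_automorphism:
  fixes L :: "'k::field alg_closure set"
  assumes L: "L = adjoin (range to_ac) \<gamma>" and normal: "normal_extension L"
    and f: "irreducible f" "poly (map_poly to_ac f) \<gamma> = 0" "poly (map_poly to_ac f) \<gamma>' = 0"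
  obtains \<sigma> where "\<sigma> \<in> carrier (galois_group L)"
    "\<And>q. \<sigma> (poly (map_poly to_ac q) \<gamma>) = poly (map_poly to_ac q) \<gamma>'"
proof -
  have Lf: "subfield_set L" unfolding L by (rule subfield_adjoin_base)
  note Lr = subfield_set_imp_subring_set[OF Lf]
  have KL: "range to_ac \<subseteq> L" unfolding L by (rule adjoin_superset[OF subring_range_to_ac])
  have iffL: "x \<in> L \<longleftrightarrow> (\<exists>q. x = poly (map_poly to_ac q) \<gamma>)" for x
    unfolding L by (rule adjoin_base_iff)
  have \<gamma>L: "\<gamma> \<in> L" unfolding L by (rule adjoin_gen[OF subring_range_to_ac])
  have roots: "z \<in> L" if "poly (map_poly to_ac f) z = 0" for z
    using normal f \<gamma>L that unfolding normal_extension_def by blast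
  have well: "poly (map_poly to_ac q) \<gamma>' = poly (map_poly to_ac r) \<gamma>'"
    if "poly (map_poly to_ac q) \<gamma> = poly (map_poly to_ac r) \<gamma>" for q r
  proof -
    have "poly (map_poly to_ac (q - r)) \<gamma> = 0" using that by (simp add: to_acp.hom_minus)
    then have "f dvd q - r" using irreducible_root_dvd f by blast
    then obtain s where "q - r = f * s" by (elim dvdE)
    then have "poly (map_poly to_ac (q - r)) \<gamma>' = 0" using f(3) by (simp add: to_acp.hom_mult)
    then show ?thesis by (simp add: to_acp.hom_minus)
  qed
  define rep where "rep x = (SOME q. x = poly (map_poly to_ac q) \<gamma>)" for x
  define \<sigma> where "\<sigma> = (\<lambda>x\<in>L. poly (map_poly to_ac (rep x)) \<gamma>')"
  have \<sigma>: "\<sigma> (poly (map_poly to_ac q) \<gamma>) = poly (map_poly to_ac q) \<gamma>'" for q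
  proof -
    have "poly (map_poly to_ac q) \<gamma> = poly (map_poly to_ac (rep (poly (map_poly to_ac q) \<gamma>))) \<gamma>"
      unfolding rep_def by (rule someI[of _ q]) simp
    then have "poly (map_poly to_ac q) \<gamma>' = poly (map_poly to_ac (rep (poly (map_poly to_ac q) \<gamma>))) \<gamma>'"
      by (rule well)
    then show ?thesis using iffL by (auto simp: \<sigma>_def)
  qed
  have fixK: "\<sigma> (to_ac c) = to_ac c" for c using \<sigma>[of "[:c:]"] by (simp add: map_poly_pCons)
  have hom: "hom_on L \<sigma>"
  proof
    show "subring_set L" by (rule Lr)
    show "\<sigma> 1 = 1" using fixK[of 1] by simp
    fix x y assume "x \<in> L" "y \<in> L"
    then obtain q r where qr: "x = poly (map_poly to_ac q) \<gamma>" "y = poly (map_poly to_ac r) \<gamma>"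
      using iffL by blast
    show "\<sigma> (x + y) = \<sigma> x + \<sigma> y" using \<sigma>[of "q + r"] \<sigma>[of q] \<sigma>[of r] by (simp add: qr to_acp.hom_add)
    show "\<sigma> (x * y) = \<sigma> x * \<sigma> y" using \<sigma>[of "q * r"] \<sigma>[of q] \<sigma>[of r] by (simp add: qr to_acp.hom_mult)
  qed
  interpret \<sigma>: hom_on L \<sigma> by fact
  have closed: "\<sigma> x \<in> L" if xL: "x \<in> L" for x
  proof -
    obtain q where q: "x = poly (map_poly to_ac q) \<gamma>" using iffL[of x] xL by auto
    have "poly (map_poly to_ac q) \<gamma>' \<in> L"
      by (rule poly_poly_over[OF Lr poly_over_mono[OF KL map_to_ac_poly_over] roots[OF f(3)]])
    then show ?thesis using \<sigma> q by simp
  qed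
  have inj: "inj_on \<sigma> L" by (rule \<sigma>.hom_inj_on[OF Lf])
  define Z where "Z = {z. poly (map_poly to_ac f) z = 0}"
  have "f \<noteq> 0" using f(1) by auto
  then have finZ: "finite Z" unfolding Z_def by (intro poly_roots_finite) simp
  have ZL: "Z \<subseteq> L" using roots by (auto simp: Z_def)
  have "\<sigma> ` Z \<subseteq> Z"
  proof
    fix w assume "w \<in> \<sigma> ` Z"
    then obtain z where z: "z \<in> L" "poly (map_poly to_ac f) z = 0" "w = \<sigma> z" using ZL by (auto simp: Z_def)
    have "map_poly \<sigma> (map_poly to_ac f) = map_poly to_ac f"
      by (rule poly_eqI) (simp add: coeff_map_poly \<sigma>.hom_0 fixK)
    then have "poly (map_poly to_ac f) (\<sigma> z) = \<sigma> 0"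
      using \<sigma>.hom_poly[OF poly_over_mono[OF KL map_to_ac_poly_over] z(1), of f] z(2) by simp
    then show "w \<in> Z" by (simp add: Z_def \<sigma>.hom_0 z)
  qed
  \<comment> \<open>Surjectivity without counting dimensions: \<open>\<sigma>\<close> permutes the
    finitely many roots of \<open>f\<close>, so \<open>\<gamma>\<close> is the image of some root
    \<open>z\<close>, and \<open>q(\<gamma>)\<close> is the image of \<open>q(z)\<close>.\<close>
  then have "\<sigma> ` Z = Z" using finZ inj_on_subset[OF inj ZL] by (simp add: card_image card_subset_eq)
  moreover have "\<gamma> \<in> Z" using f by (simp add: Z_def)
  ultimately obtain z where z: "z \<in> L" "\<gamma> = \<sigma> z" using ZL by blast
  have "x \<in> \<sigma> ` L" if xL: "x \<in> L" for x
  proof -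
    obtain q where q: "x = poly (map_poly to_ac q) \<gamma>" using iffL[of x] xL by auto
    have "map_poly \<sigma> (map_poly to_ac q) = map_poly to_ac q"
      by (rule poly_eqI) (simp add: coeff_map_poly \<sigma>.hom_0 fixK)
    then have "x = \<sigma> (poly (map_poly to_ac q) z)"
      using \<sigma>.hom_poly[OF poly_over_mono[OF KL map_to_ac_poly_over] z(1), of q] z(2) q by simp
    moreover have "poly (map_poly to_ac q) z \<in> L"
      by (rule poly_poly_over[OF Lr poly_over_mono[OF KL map_to_ac_poly_over] z(1)])
    ultimately show ?thesis by blast
  qed
  then have "bij_betw \<sigma> L L" using inj closed by (auto simp: bij_betw_def)
  then have "\<sigma> \<in> carrier (galois_group L)"
    using hom fixK by (auto simp: galois_group_carrier_iff[OF Lr] \<sigma>_def)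
  then show ?thesis using that \<sigma> by simp
qed

text \<open>Write \<open>x = r(\<gamma>)\<close> with \<open>degree r < degree f\<close>. Since
  \<open>x\<close> is fixed by the automorphisms sending \<open>\<gamma>\<close> to its conjugates,
  \<open>r - x\<close> vanishes at all of them, and by separability there are
  \<open>degree f\<close> many. So \<open>r\<close> is the constant \<open>x\<close>, a coefficient
  in the base field.\<close>

theorem galois_extension_fixed_field:
  fixes L :: "'k::field alg_closure set"
  assumes inf: "infinite (UNIV :: 'k set)" and gal: "galois_extension L"
    and x: "x \<in> L" "\<And>\<sigma>. \<sigma> \<in> carrier (galois_group L) \<Longrightarrow> \<sigma> x = x"
  shows "x \<in> range to_ac"
proof -
  have fin: "finite_extension L" and normal: "normal_extension L" and sep: "separable_extension L"
    using gal by (auto simp: galois_extension_def)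
  have Lf: "subfield_set L" and KL: "range to_ac \<subseteq> L"
    using fin by (auto simp: finite_extension_def subfield_set_iff_subfield)
  note Lr = subfield_set_imp_subring_set[OF Lf]
  obtain us where us: "set us \<subseteq> L" "\<And>S. subring_set S \<Longrightarrow> range to_ac \<subseteq> S \<Longrightarrow> set us \<subseteq> S \<Longrightarrow> L \<subseteq> S"
    by (rule finite_extension_span[OF fin]) simp
  obtain \<gamma> where \<gamma>: "\<gamma> \<in> L" "set us \<subseteq> adjoin (range to_ac) \<gamma>"
    using primitive_element[OF inf Lf KL sep us(1)] by blast
  have L: "L = adjoin (range to_ac) \<gamma>"
  proof
    show "L \<subseteq> adjoin (range to_ac) \<gamma>"
      by (rule us(2)[OF subring_adjoin adjoin_superset \<gamma>(2)]) (rule subring_range_to_ac)+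
    show "adjoin (range to_ac) \<gamma> \<subseteq> L"
      by (rule adjoin_least[OF Lr KL \<gamma>(1)])
  qed
  obtain f :: "'k poly" where f: "irreducible f" "poly (map_poly to_ac f) \<gamma> = 0"
    by (rule minimal_poly_exists[of \<gamma>]) simp
  have f0: "f \<noteq> 0" using f(1) by auto
  obtain q where q: "x = poly (map_poly to_ac q) \<gamma>" using x(1) unfolding L adjoin_base_iff by blast
  define r where "r = q mod f"
  have "q = q div f * f + r" by (simp add: r_def)
  then have "map_poly to_ac q = map_poly to_ac (q div f) * map_poly to_ac f + map_poly to_ac r"
    by (metis to_acp.hom_add to_acp.hom_mult)
  then have xr: "x = poly (map_poly to_ac r) \<gamma>" using q f(2) by simp
  define H where "H = map_poly to_ac r - [:x:]"
  have "poly H z = 0" if z: "poly (map_poly to_ac f) z = 0" for z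
  proof -
    obtain \<sigma> where \<sigma>: "\<sigma> \<in> carrier (galois_group L)"
      "\<And>q. \<sigma> (poly (map_poly to_ac q) \<gamma>) = poly (map_poly to_ac q) z"
      by (rule conjugate_automorphism[OF L normal f z]) simp
    show ?thesis using \<sigma>(2)[of r] x(2)[OF \<sigma>(1)] by (simp add: H_def flip: xr)
  qed
  then have sub: "{z. poly (map_poly to_ac f) z = 0} \<subseteq> {z. poly H z = 0}" by blast
  have sqf: "rsquarefree (map_poly to_ac f)"
    using sep \<gamma>(1) f by (auto simp: separable_extension_def)
  have degf: "degree f > 0"
  proof (rule ccontr)
    assume "\<not> ?thesis"
    then have "f dvd 1" using f0 by (simp add: is_unit_iff_degree)
    then show False using f(1) by auto
  qed
  have "degree r < degree f" using degree_mod_less'[OF f0, of q] degf by (cases "r = 0") (auto simp: r_def)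
  then have "degree H < degree f"
    unfolding H_def using degf by (intro degree_diff_less) auto
  moreover have "degree f \<le> degree H" if "H \<noteq> 0"
  proof -
    have "degree f = card {z. poly (map_poly to_ac f) z = 0}"
      using card_roots_rsquarefree[OF sqf] by simp
    also have "\<dots> \<le> card {z. poly H z = 0}"
      by (rule card_mono[OF poly_roots_finite[OF that] sub])
    also have "\<dots> \<le> degree H" by (rule card_poly_roots_bound[OF that])
    finally show ?thesis .
  qed
  ultimately have "H = 0" by linarith
  then have "coeff (map_poly to_ac r) 0 = x" by (simp add: H_def)
  then show ?thesis by (metis rangeI to_acp.base.coeff_map_poly_hom)
qed

lemma galois_extension_data:
  fixes L :: "'k::field alg_closure set"
  assumes inf: "infinite (UNIV :: 'k set)" and gal: "galois_extension L"
    and iso: "galois_group L \<cong> G" and G: "group G" "finite (carrier G)"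
  obtains \<rho> where "galois_data_ac G \<rho> L"
proof -
  interpret G: group G by (rule G)
  have Lf: "subfield_set L" and KL: "range to_ac \<subseteq> L"
    using gal by (auto simp: galois_extension_def finite_extension_def subfield_set_iff_subfield)
  note Lr = subfield_set_imp_subring_set[OF Lf]
  obtain \<phi> where \<phi>: "\<phi> \<in> iso (galois_group L) G" using iso by (auto simp: is_iso_def)
  define \<psi> where "\<psi> = inv_into (carrier (galois_group L)) \<phi>"
  have bij: "bij_betw \<phi> (carrier (galois_group L)) (carrier G)" using \<phi> by (simp add: iso_def)
  have \<psi>: "\<psi> g \<in> carrier (galois_group L)" "\<phi> (\<psi> g) = g" if "g \<in> carrier G" for g
    using that bij by (auto simp: \<psi>_def bij_betw_inv_into_right bij_betw_imp_surj_on inv_into_into)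
  have \<psi>_mult: "\<psi> (g \<otimes>\<^bsub>G\<^esub> h) = compose L (\<psi> g) (\<psi> h)" if "g \<in> carrier G" "h \<in> carrier G" for g h
  proof -
    have c: "\<psi> g \<otimes>\<^bsub>galois_group L\<^esub> \<psi> h \<in> carrier (galois_group L)"
      using galois_group_mult_closed[OF Lr KL] mult_galois_group \<psi> that by metis
    have "\<phi> (\<psi> g \<otimes>\<^bsub>galois_group L\<^esub> \<psi> h) = g \<otimes>\<^bsub>G\<^esub> h"
      using \<phi> \<psi> that by (auto simp: iso_def hom_def)
    then have "\<psi> (g \<otimes>\<^bsub>G\<^esub> h) = \<psi> g \<otimes>\<^bsub>galois_group L\<^esub> \<psi> h"
      using c bij by (metis \<psi>_def bij_betw_inv_into_left)
    then show ?thesis using mult_galois_group \<psi> that by metis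
  qed
  have \<psi>': "bij_betw (\<psi> g) L L" "hom_on L (\<psi> g)" "\<psi> g (to_ac c) = to_ac c" if "g \<in> carrier G" for g c
    using \<psi>(1)[OF that] by (auto simp: galois_group_carrier_iff[OF Lr])
  have "galois_data_ac G \<psi> L"
  proof (rule galois_data_ac.intro, rule galois_data.intro)
    show "group G" by (rule G)
    show "finite (carrier G)" by (rule G)
    show "subfield_set L" by (rule Lf)
    show "subfield_set (range (to_ac :: 'k \<Rightarrow> _))" by (rule subfield_range_to_ac)
    show "range to_ac \<subseteq> L" by (rule KL)
    show "hom_on L (\<psi> g)" if "g \<in> carrier G" for g by (rule \<psi>'[OF that])
    show "\<psi> g x \<in> L" if "g \<in> carrier G" "x \<in> L" for g x
      using \<psi>'(1)[OF that(1)] that(2) by (rule bij_betw_apply)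
    show "\<psi> (g \<otimes>\<^bsub>G\<^esub> h) x = \<psi> g (\<psi> h x)" if "g \<in> carrier G" "h \<in> carrier G" "x \<in> L" for g h x
      using \<psi>_mult that by (simp add: compose_def)
    show "x \<in> range to_ac" if x: "x \<in> L" "\<And>g. g \<in> carrier G \<Longrightarrow> \<psi> g x = x" for x
    proof (rule galois_extension_fixed_field[OF inf gal x(1)])
      fix \<sigma> assume \<sigma>: "\<sigma> \<in> carrier (galois_group L)"
      then have "\<psi> (\<phi> \<sigma>) = \<sigma>" "\<phi> \<sigma> \<in> carrier G"
        using bij by (auto simp: \<psi>_def bij_betw_inv_into_left bij_betw_apply)
      then show "\<sigma> x = x" using x(2) by metis
    qed
    show "\<psi> g x = x" if "g \<in> carrier G" "x \<in> range (to_ac :: 'k \<Rightarrow> _)" for g x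
      using \<psi>'(3) that by auto
  qed
  then show ?thesis by (rule that)
qed

section \<open>Extension of places\<close>

lemma exists_maximal_subring_avoiding:
  assumes "subring_set B0" "B0 \<subseteq> L" "s \<notin> B0"
  obtains A where "subring_set A" "B0 \<subseteq> A" "A \<subseteq> L" "s \<notin> A"
    "\<And>B. subring_set B \<Longrightarrow> A \<subseteq> B \<Longrightarrow> B \<subseteq> L \<Longrightarrow> s \<notin> B \<Longrightarrow> B = A"
proof -
  define Fam where "Fam = {A. subring_set A \<and> B0 \<subseteq> A \<and> A \<subseteq> L \<and> s \<notin> A}"
  have "\<exists>M\<in>Fam. \<forall>W\<in>Fam. M \<subseteq> W \<longrightarrow> W = M"
  proof (rule subset_Zorn_nonempty)
    show "Fam \<noteq> {}" using assms by (auto simp: Fam_def)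
    fix C assume C: "C \<noteq> {}" "subset.chain Fam C"
    have CA: "A \<in> Fam" if "A \<in> C" for A using C(2) that by (auto simp: subset.chain_def)
    have "subring_set (\<Union>C)"
    proof (rule subring_setI)
      show "1 \<in> \<Union>C" using C(1) CA subring_set_1 by (force simp: Fam_def)
      fix x y assume "x \<in> \<Union>C" "y \<in> \<Union>C"
      then obtain W Y where "W \<in> C" "x \<in> W" "Y \<in> C" "y \<in> Y" by blast
      moreover from this have "W \<subseteq> Y \<or> Y \<subseteq> W" using C(2) by (auto simp: subset.chain_def)
      ultimately obtain Z where Z: "Z \<in> C" "x \<in> Z" "y \<in> Z" by blast
      then have "subring_set Z" using CA by (auto simp: Fam_def)
      then show "x - y \<in> \<Union>C" "x * y \<in> \<Union>C"
        using Z subring_set_diff subring_set_mult by blast+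
    qed
    then show "\<Union>C \<in> Fam" using C(1) CA by (fastforce simp: Fam_def)
  qed
  then obtain A where "A \<in> Fam" "\<And>W. W \<in> Fam \<Longrightarrow> A \<subseteq> W \<Longrightarrow> W = A" by blast
  then show ?thesis using that[of A] by (auto simp: Fam_def)
qed

lemma one_plus_multiple_power:
  assumes "subring_set A" "p \<in> A" "b \<in> A"
  shows "\<exists>c\<in>A. (1 + p * b) ^ k = 1 + p * c"
proof (induction k)
  case (Suc k)
  then obtain c where c: "c \<in> A" "(1 + p * b) ^ k = 1 + p * c" by blast
  have "(1 + p * b) ^ Suc k = 1 + p * (b + c + p * b * c)" using c by (simp add: algebra_simps)
  moreover have "b + c + p * b * c \<in> A"
    using assms c by (intro subring_set_add[OF assms(1)] subring_set_mult[OF assms(1)])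
  ultimately show ?case by blast
qed (use subring_set_0[OF assms(1)] in \<open>auto intro!: bexI[of _ 0]\<close>)

text \<open>Chevalley's extension theorem without prime ideals: the usual requirement that the
  maximal ideal below generate a proper ideal becomes \<open>inverse p \<notin> A\<close>, with
  \<open>p\<close> a uniformizer.\<close>

locale maximal_avoiding =
  fixes A L :: "'a::field set" and p :: 'a
  assumes A: "subring_set A" and L: "subfield_set L" and A_L: "A \<subseteq> L"
    and p: "p \<in> A" and p0: "p \<noteq> 0" and inv_p: "inverse p \<notin> A"
    and maximal: "subring_set B \<Longrightarrow> A \<subseteq> B \<Longrightarrow> B \<subseteq> L \<Longrightarrow> inverse p \<notin> B \<Longrightarrow> B = A"
begin

lemma not_unit: "a \<in> A \<Longrightarrow> p * a \<noteq> 1"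
  using inv_p inverse_unique[of p a] by auto

text \<open>Inverting \<open>u = 1 + p b\<close> gives a ring \<open>B\<close> that still avoids
  \<open>inverse p\<close>, because all powers of \<open>u\<close> are 1 modulo \<open>p\<close>.
  Maximality forces \<open>B = A\<close>: \<open>p\<close> lies in the Jacobson radical.\<close>

lemma inverse_one_plus:
  assumes b: "b \<in> A"
  shows "1 + p * b \<noteq> 0" and "inverse (1 + p * b) \<in> A"
proof -
  note Lr = subfield_set_imp_subring_set[OF L]
  define u where "u = 1 + p * b"
  have u: "u \<in> A" unfolding u_def
    by (intro subring_set_add[OF A] subring_set_1[OF A] subring_set_mult[OF A] p b)
  show u0: "1 + p * b \<noteq> 0"
  proof
    assume "1 + p * b = 0"
    then have "p * (- b) = 1" by (simp add: add_eq_0_iff)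
    then show False using not_unit[OF subring_set_uminus[OF A b]] by simp
  qed
  then have u0': "u \<noteq> 0" by (simp add: u_def)
  define B where "B = {a / u ^ k | a k. a \<in> A}"
  have "subring_set B"
  proof (rule subring_setI)
    show "1 \<in> B" unfolding B_def using subring_set_1[OF A] by (intro CollectI exI[of _ 1] exI[of _ 0]) auto
    fix x y assume "x \<in> B" "y \<in> B"
    then obtain a k b l where *: "a \<in> A" "b \<in> A" "x = a / u ^ k" "y = b / u ^ l" unfolding B_def by blast
    have "x - y = (a * u ^ l - b * u ^ k) / u ^ (k + l)" using u0' by (simp add: * field_simps power_add)
    moreover have "x * y = (a * b) / u ^ (k + l)" using u0' by (simp add: * field_simps power_add)
    moreover have "a * u ^ l - b * u ^ k \<in> A" "a * b \<in> A"
      using * u by (auto intro!: subring_set_diff[OF A] subring_set_mult[OF A] subring_set_power[OF A])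
    ultimately show "x - y \<in> B" "x * y \<in> B" unfolding B_def by blast+
  qed
  moreover have "A \<subseteq> B"
  proof
    fix a assume "a \<in> A"
    moreover have "a = a / u ^ 0" by simp
    ultimately show "a \<in> B" unfolding B_def by blast
  qed
  moreover have "B \<subseteq> L" unfolding B_def using A_L u
    by (auto intro!: subfield_set_divide[OF L] subring_set_power[OF Lr])
  moreover have "inverse p \<notin> B"
  proof
    assume "inverse p \<in> B"
    then obtain a k where a: "a \<in> A" "inverse p = a / u ^ k" unfolding B_def by blast
    obtain c where c: "c \<in> A" "u ^ k = 1 + p * c"
      using one_plus_multiple_power[OF A p b, of k] unfolding u_def by blast
    have "u ^ k = p * a" using a(2) p0 u0' by (simp add: field_simps)
    then have "p * (a - c) = 1" using c by (simp add: algebra_simps)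
    then show False using not_unit[OF subring_set_diff[OF A a(1) c(1)]] by simp
  qed
  ultimately have "B = A" by (rule maximal)
  moreover have "inverse u \<in> B" unfolding B_def
    using subring_set_1[OF A] by (intro CollectI exI[of _ 1] exI[of _ "1::nat"]) (auto simp: divide_inverse)
  ultimately show "inverse (1 + p * b) \<in> A" by (simp add: u_def)
qed

text \<open>The relation for \<open>inverse x\<close>, divided by the unit \<open>1 - p q\<close>,
  expresses 1 as a multiple of \<open>inverse x\<close> times a polynomial in
  \<open>inverse x\<close> of smaller degree. Multiplication by \<open>x ^ n\<close> then rewrites
  the leading power in \<open>P\<close> by lower ones.\<close>

lemma chevalley_step:
  assumes x: "x \<noteq> 0" and P: "P \<in> poly_over A" "p * poly P x = 1"
    and Q: "Q \<in> poly_over A" "p * poly Q (inverse x) = 1" and deg: "degree Q \<le> degree P"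
  shows "\<exists>P'\<in>poly_over A. degree P' < degree P \<and> p * poly P' x = 1"
proof -
  note sub = subring_poly_over[OF A]
  define n where "n = degree P"
  obtain q Q1 where Q1: "Q = pCons q Q1" by (cases Q)
  have q: "q \<in> A" using poly_overD[OF Q(1), of 0] by (simp add: Q1)
  have Q1A: "Q1 \<in> poly_over A"
    using poly_overD[OF Q(1), of "Suc i" for i] by (auto simp: Q1 intro!: poly_overI)
  \<comment> \<open>If \<open>n = 0\<close>, then \<open>Q\<close> would be a constant
    \<open>q \<in> A\<close> with \<open>p q = 1\<close>.\<close>
  have n: "n > 0"
  proof (rule ccontr)
    assume "\<not> n > 0"
    then have "degree Q = 0" using deg by (simp add: n_def)
    then have "Q1 = 0" by (auto simp: Q1 split: if_splits)
    then show False using Q(2) not_unit[OF q] by (simp add: Q1)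
  qed
  have degQ1: "degree Q1 \<le> n - 1" using deg by (auto simp: Q1 n_def split: if_splits)
  define d where "d = inverse (1 + p * (- q))"
  have d: "d \<in> A" unfolding d_def by (rule inverse_one_plus(2)[OF subring_set_uminus[OF A q]])
  have unit0: "1 + p * (- q) \<noteq> 0" by (rule inverse_one_plus(1)[OF subring_set_uminus[OF A q]])
  have "1 + p * (- q) = p * inverse x * poly Q1 (inverse x)"
    using Q(2) by (simp add: Q1 algebra_simps)
  then have one: "1 = d * p * inverse x * poly Q1 (inverse x)"
    using unit0 unfolding d_def by (metis left_inverse mult.assoc)
  \<comment> \<open>The reversal of \<open>Q1\<close>:
    \<open>R(x) = x ^ (n - 1) Q1(1 / x)\<close>.\<close>
  define R where "R = (\<Sum>j\<le>n - 1. monom (coeff Q1 j) (n - 1 - j))"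
  have RA: "R \<in> poly_over A" unfolding R_def
    by (intro subring_set_sum[OF sub] monom_poly_over[OF A] poly_overD[OF Q1A])
  have degR: "degree R \<le> n - 1" unfolding R_def
    by (intro degree_sum_le) (auto intro: order.trans[OF degree_monom_le])
  have "poly R x = (\<Sum>j\<le>n - 1. coeff Q1 j * x ^ (n - 1 - j))"
    by (simp add: R_def poly_sum poly_monom)
  also have "\<dots> = (\<Sum>j\<le>n - 1. x ^ (n - 1) * (coeff Q1 j * inverse x ^ j))"
  proof (intro sum.cong refl)
    fix j assume "j \<in> {..n - 1}"
    then have "x ^ (n - 1) = x ^ (n - 1 - j) * x ^ j"
      using power_add[of x "n - 1 - j" j] n by simp
    then show "coeff Q1 j * x ^ (n - 1 - j) = x ^ (n - 1) * (coeff Q1 j * inverse x ^ j)"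
      using x by (simp add: field_simps)
  qed
  also have "\<dots> = x ^ (n - 1) * poly Q1 (inverse x)"
  proof -
    have "poly Q1 (inverse x) = (\<Sum>j\<le>n - 1. coeff Q1 j * inverse x ^ j)"
      unfolding poly_altdef using degQ1
      by (intro sum.mono_neutral_left) (auto simp: coeff_eq_0)
    then show ?thesis by (simp only: sum_distrib_left)
  qed
  finally have R: "poly R x = x ^ (n - 1) * poly Q1 (inverse x)" .
  define c where "c = coeff P n"
  have c: "c \<in> A" unfolding c_def by (rule poly_overD[OF P(1)])
  define P0 where "P0 = P - monom c n"
  have P0A: "P0 \<in> poly_over A" unfolding P0_def by (intro subring_set_diff[OF sub] P(1) monom_poly_over[OF A c])
  have "degree P0 \<le> n" unfolding P0_def n_def by (intro degree_diff_le) (auto simp: degree_monom_le)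
  moreover have "coeff P0 n = 0" by (simp add: P0_def c_def)
  ultimately have degP0: "degree P0 < n"
    using n by (metis le_neq_implies_less leading_coeff_0_iff degree_0)
  define P' where "P' = P0 + smult (c * d * p) R"
  have "P' \<in> poly_over A" unfolding P'_def
    by (intro subring_set_add[OF sub] P0A smult_poly_over[OF A] subring_set_mult[OF A] c d p RA)
  moreover have "degree P' < n"
    unfolding P'_def using degP0 degR n by (intro degree_add_less) (auto intro: le_less_trans[OF degree_smult_le])
  moreover have "poly P' x = poly P x"
  proof -
    have "x ^ n = x ^ n * (d * p * inverse x * poly Q1 (inverse x))" using one by simp
    also have "\<dots> = d * p * (x ^ (n - 1) * poly Q1 (inverse x))"
      using x n by (simp add: power_eq_if[of x n] field_simps)
    finally have "x ^ n = d * p * poly R x" using R by simp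
    then show ?thesis by (simp add: P'_def P0_def poly_monom mult_ac)
  qed
  ultimately show ?thesis using P(2) unfolding n_def by (intro bexI[of _ P']) auto
qed

lemma chevalley_descent:
  assumes x: "x \<noteq> 0" and P: "P \<in> poly_over A" "p * poly P x = 1"
    and Q: "Q \<in> poly_over A" "p * poly Q (inverse x) = 1"
  shows False
  using assms
proof (induction "degree P + degree Q" arbitrary: P Q rule: less_induct)
  case less
  show False
  proof (cases "degree Q \<le> degree P")
    case True
    from chevalley_step[OF less.prems(1-5) True] obtain P' where
      "P' \<in> poly_over A" "degree P' < degree P" "p * poly P' x = 1" by blast
    then show False using less.hyps[of P' Q] less.prems by auto
  next
    case False
    then have deg: "degree P \<le> degree Q" by simp
    have "inverse x \<noteq> 0" "p * poly P (inverse (inverse x)) = 1" using less.prems by auto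
    from chevalley_step[OF this(1) less.prems(4,5,2) this(2) deg] obtain Q' where
      "Q' \<in> poly_over A" "degree Q' < degree Q" "p * poly Q' (inverse x) = 1" by blast
    then show False using less.hyps[of P Q'] less.prems by auto
  qed
qed

text \<open>If neither lies in \<open>A\<close>, maximality puts \<open>inverse p\<close> into both
  \<open>A[x]\<close> and \<open>A[1 / x]\<close>, and the two resulting relations could be lowered
  in turn forever.\<close>

theorem valuation_ring:
  assumes x: "x \<in> L"
  shows "x \<in> A \<or> inverse x \<in> A"
proof (rule ccontr)
  assume *: "\<not> ?thesis"
  note Lr = subfield_set_imp_subring_set[OF L]
  have x0: "x \<noteq> 0" using * subring_set_0[OF A] by auto
  have ex: "\<exists>P\<in>poly_over A. p * poly P y = 1" if y: "y \<in> L" "y \<notin> A" for y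
  proof -
    have "inverse p \<in> adjoin A y"
    proof (rule ccontr)
      assume "inverse p \<notin> adjoin A y"
      then have "adjoin A y = A"
        by (intro maximal subring_adjoin A adjoin_superset adjoin_least[OF Lr A_L y(1)])
      then show False using adjoin_gen[OF A, of y] y(2) by simp
    qed
    then obtain P where "P \<in> poly_over A" "inverse p = poly P y" unfolding adjoin_def by blast
    then show ?thesis using p0 by (metis right_inverse)
  qed
  show False
    using ex[OF x] ex[OF subfield_set_inverse[OF L x]] * chevalley_descent[OF x0] by blast
qed

end

locale valuation_subring =
  fixes A L :: "'a::field set"
  assumes A: "subring_set A" and L: "subfield_set L" and A_L: "A \<subseteq> L"
    and total: "x \<in> L \<Longrightarrow> x \<in> A \<or> inverse x \<in> A"
begin

definition unit :: "'a \<Rightarrow> bool" where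
  "unit x \<longleftrightarrow> x \<noteq> 0 \<and> x \<in> A \<and> inverse x \<in> A"

lemma unit_1: "unit 1"
  using subring_set_1[OF A] by (simp add: unit_def)

lemma unit_mult: "unit x \<Longrightarrow> unit y \<Longrightarrow> unit (x * y)"
  using subring_set_mult[OF A] by (auto simp: unit_def)

lemma unit_inverse: "unit x \<Longrightarrow> unit (inverse x)"
  by (auto simp: unit_def)

lemma unit_power: "unit x \<Longrightarrow> unit (x ^ n)"
  by (induction n) (auto simp: unit_1 unit_mult)

text \<open>Of two nonzero elements of a valuation ring one divides the other, so the nonunits form
  an ideal.\<close>

lemma nonunit_add:
  assumes "x \<in> A" "y \<in> A" "\<not> unit x" "\<not> unit y"
  shows "\<not> unit (x + y)"
proof
  have aux: "\<not> unit (x + y)" if xy: "x \<in> A" "y \<in> A" "\<not> unit y" "y \<noteq> 0" "x / y \<in> A" for x y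
  proof
    assume u: "unit (x + y)"
    have "inverse y = (1 + x / y) * inverse (x + y)"
      using u xy(4) by (auto simp: unit_def field_simps)
    then have "inverse y \<in> A"
      using u xy by (auto simp: unit_def intro!: subring_set_mult[OF A] subring_set_add[OF A] subring_set_1[OF A])
    then show False using xy by (simp add: unit_def)
  qed
  assume u: "unit (x + y)"
  show False
  proof (cases "x = 0 \<or> y = 0")
    case False
    have "x / y \<in> L" using assms A_L by (auto intro: subfield_set_divide[OF L])
    then have "x / y \<in> A \<or> y / x \<in> A" using total[of "x / y"] by simp
    then show False using aux[of x y] aux[of y x] u assms False by (auto simp: add.commute)
  qed (use u assms in auto)
qed

lemma nonunit_sum:
  assumes "\<And>i. i \<in> I \<Longrightarrow> z i \<in> A \<and> \<not> unit (z i)"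
  shows "\<not> unit (sum z I)"
  using assms
proof (induction I rule: infinite_finite_induct)
  case (insert i I)
  then show ?case using nonunit_add[of "z i" "sum z I"] subring_set_sum[OF A, of I z] by simp
qed (auto simp: unit_def)

text \<open>\<open>z i\<close> has the least value, expressed by divisibility since no value group
  is available yet.\<close>

lemma exists_dominant:
  assumes "finite I" "I \<noteq> {}" "\<And>i. i \<in> I \<Longrightarrow> z i \<in> L \<and> z i \<noteq> 0"
  shows "\<exists>i\<in>I. \<forall>j\<in>I. z j / z i \<in> A"
  using assms
proof (induction I rule: finite_ne_induct)
  case (singleton x)
  then show ?case using subring_set_1[OF A] by auto
next
  case (insert k I)
  then obtain i where i: "i \<in> I" "\<And>j. j \<in> I \<Longrightarrow> z j / z i \<in> A" by auto
  have nz: "z i \<noteq> 0" "z k \<noteq> 0" "z i \<in> L" "z k \<in> L" using insert i by auto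
  have "z k / z i \<in> A \<or> z i / z k \<in> A"
    using total[of "z k / z i"] nz by (auto intro: subfield_set_divide[OF L])
  then show ?case
  proof
    assume "z k / z i \<in> A"
    then show ?thesis using i by auto
  next
    assume ik: "z i / z k \<in> A"
    have "z j / z k \<in> A" if "j \<in> I" for j
      using subring_set_mult[OF A i(2)[OF that] ik] nz by simp
    then show ?thesis using nz subring_set_1[OF A] by auto
  qed
qed

text \<open>In a vanishing sum the least value occurs twice: otherwise division by the dominant term
  gives \<open>- 1\<close> as a sum of nonunits.\<close>

lemma sum_eq_0_imp_unit_quotient:
  assumes "finite I" "I \<noteq> {}" "\<And>i. i \<in> I \<Longrightarrow> z i \<in> L \<and> z i \<noteq> 0" "sum z I = 0"
  shows "\<exists>i\<in>I. \<exists>j\<in>I. i \<noteq> j \<and> unit (z j / z i)"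
proof (rule ccontr)
  assume no: "\<not> ?thesis"
  have "\<exists>i\<in>I. \<forall>j\<in>I. z j / z i \<in> A" by (rule exists_dominant) (use assms in auto)
  then obtain i where "i \<in> I" "\<forall>j\<in>I. z j / z i \<in> A" by (elim bexE)
  then have i: "i \<in> I" "\<And>j. j \<in> I \<Longrightarrow> z j / z i \<in> A" by simp_all
  have "\<not> unit (\<Sum>j\<in>I - {i}. z j / z i)"
  proof (rule nonunit_sum)
    fix j assume "j \<in> I - {i}"
    then have "j \<in> I" "i \<noteq> j" by auto
    moreover from this have "z j / z i \<in> A" by (intro i(2))
    ultimately show "z j / z i \<in> A \<and> \<not> unit (z j / z i)" using no i(1) by meson
  qed
  moreover have "(\<Sum>j\<in>I - {i}. z j / z i) = - 1"
  proof -
    have "(\<Sum>j\<in>I. z j / z i) = 0" using assms(4) by (simp flip: sum_divide_distrib)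
    then show ?thesis using assms(1,3) i(1) by (simp add: sum_diff1)
  qed
  ultimately show False using subring_set_uminus[OF A subring_set_1[OF A]] by (simp add: unit_def)
qed

end

section \<open>Integer valuations and their normalization\<close>

lemma int_subgroup_generator:
  fixes S :: "int set"
  assumes S: "\<And>x y. x \<in> S \<Longrightarrow> y \<in> S \<Longrightarrow> x - y \<in> S" and "N \<in> S" "N > 0"
  obtains d where "d > 0" "d \<in> S" "\<And>x. x \<in> S \<Longrightarrow> d dvd x"
proof -
  define n where "n = (LEAST n. int n \<in> S \<and> n > 0)"
  have "int (nat N) \<in> S \<and> nat N > 0" using assms by simp
  then have n: "int n \<in> S \<and> n > 0" unfolding n_def by (rule LeastI)
  have S0: "0 \<in> S" using S[OF \<open>N \<in> S\<close> \<open>N \<in> S\<close>] by simp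
  have neg: "- x \<in> S" if "x \<in> S" for x using S[OF S0 that] by simp
  have add: "x + y \<in> S" if "x \<in> S" "y \<in> S" for x y using S[OF that(1) neg[OF that(2)]] by simp
  have natmul: "int k * int n \<in> S" for k
    by (induction k) (use S0 n add in \<open>auto simp: algebra_simps\<close>)
  have mul: "k * int n \<in> S" for k :: int
  proof (cases "k \<ge> 0")
    case True
    then show ?thesis using natmul[of "nat k"] by simp
  next
    case False
    then have "k * int n = - (int (nat (- k)) * int n)" by simp
    then show ?thesis using neg[OF natmul[of "nat (- k)"]] by simp
  qed
  have "int n dvd x" if x: "x \<in> S" for x
  proof -
    have "x - x div int n * int n \<in> S" by (rule S[OF x mul])
    then have r: "x mod int n \<in> S" by (simp add: minus_div_mult_eq_mod)
    define m where "m = x mod int n"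
    have m: "m \<in> S" "m \<ge> 0" "m < int n" using r n by (auto simp: m_def)
    have "m = 0"
    proof (rule ccontr)
      assume "m \<noteq> 0"
      then have "int (nat m) \<in> S \<and> nat m > 0" using m by simp
      then have "n \<le> nat m" unfolding n_def by (rule Least_le)
      then show False using m by linarith
    qed
    then have "x mod int n = 0" by (simp add: m_def)
    then show ?thesis by (rule dvd_eq_mod_eq_0[THEN iffD2])
  qed
  then show ?thesis using that[of "int n"] n by auto
qed

text \<open>\<open>place_on\<close> without normalization. This form restricts to subfields and
  allows the multiple \<open>\<phi>\<close> of a place in \<open>place_extension\<close>.\<close>

definition valuation_on :: "'a::field set \<Rightarrow> ('a \<Rightarrow> int) \<Rightarrow> bool" where
  "valuation_on F v \<longleftrightarrow>
     (\<forall>x\<in>F - {0}. \<forall>y\<in>F - {0}. v (x * y) = v x + v y) \<and>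
     (\<forall>x\<in>F - {0}. \<forall>y\<in>F - {0}. x + y \<noteq> 0 \<longrightarrow> min (v x) (v y) \<le> v (x + y))"

lemma place_imp_valuation: "place_on F v \<Longrightarrow> valuation_on F v"
  by (simp add: place_on_def valuation_on_def)

lemma valuation_on_subset: "valuation_on F v \<Longrightarrow> E \<subseteq> F \<Longrightarrow> valuation_on E v"
  unfolding valuation_on_def by blast

context
  fixes F :: "'a::field set" and v :: "'a \<Rightarrow> int"
  assumes F: "subfield_set F" and v: "valuation_on F v"
begin

lemma val_mult: "x \<in> F \<Longrightarrow> x \<noteq> 0 \<Longrightarrow> y \<in> F \<Longrightarrow> y \<noteq> 0 \<Longrightarrow> v (x * y) = v x + v y"
  using v by (simp add: valuation_on_def)

lemma val_add: "x \<in> F \<Longrightarrow> x \<noteq> 0 \<Longrightarrow> y \<in> F \<Longrightarrow> y \<noteq> 0 \<Longrightarrow> x + y \<noteq> 0 \<Longrightarrow> min (v x) (v y) \<le> v (x + y)"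
  using v by (simp add: valuation_on_def)

lemma val_1: "v 1 = 0"
  using val_mult[of 1 1] subring_set_1[OF subfield_set_imp_subring_set[OF F]] by simp

lemma val_minus: "x \<in> F \<Longrightarrow> x \<noteq> 0 \<Longrightarrow> v (- x) = v x"
proof -
  assume x: "x \<in> F" "x \<noteq> 0"
  have m: "- 1 \<in> F" by (rule subring_set_uminus[OF subfield_set_imp_subring_set[OF F] subring_set_1[OF subfield_set_imp_subring_set[OF F]]])
  have "v (- 1) + v (- 1) = 0" using val_mult[OF m _ m] val_1 by simp
  then show ?thesis using val_mult[OF m _ x] by simp
qed

lemma val_power: "x \<in> F \<Longrightarrow> x \<noteq> 0 \<Longrightarrow> v (x ^ n) = int n * v x"
  by (induction n)
    (auto simp: val_1 val_mult subring_set_power[OF subfield_set_imp_subring_set[OF F]] algebra_simps)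

lemma val_inverse: "x \<in> F \<Longrightarrow> x \<noteq> 0 \<Longrightarrow> v (inverse x) = - v x"
  using val_mult[of x "inverse x"] subfield_set_inverse[OF F, of x] val_1 by simp

lemma val_add_eq:
  assumes "x \<in> F" "x \<noteq> 0" "y \<in> F" "y \<noteq> 0" "v x < v y"
  shows "x + y \<noteq> 0" "v (x + y) = v x"
proof -
  note Fr = subfield_set_imp_subring_set[OF F]
  show nz: "x + y \<noteq> 0"
  proof
    assume "x + y = 0"
    then have "y = - x" by (simp add: eq_neg_iff_add_eq_0 add.commute)
    then show False using val_minus[of x] assms by simp
  qed
  have "min (v x) (v y) \<le> v (x + y)" by (rule val_add[OF assms(1-4) nz])
  moreover have "min (v (x + y)) (v (- y)) \<le> v x"
    using val_add[of "x + y" "- y"] nz assms subring_set_add[OF Fr] subring_set_uminus[OF Fr] by simp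
  ultimately show "v (x + y) = v x" using assms val_minus[of y] by (simp add: min_def split: if_splits)
qed

lemma subring_val_ring: "subring_set {x \<in> F. x = 0 \<or> v x \<ge> 0}"
proof (rule subring_setI')
  note Fr = subfield_set_imp_subring_set[OF F]
  fix x y assume *: "x \<in> {x \<in> F. x = 0 \<or> v x \<ge> 0}" "y \<in> {x \<in> F. x = 0 \<or> v x \<ge> 0}"
  show "x + y \<in> {x \<in> F. x = 0 \<or> v x \<ge> 0}" using * val_add[of x y] subring_set_add[OF Fr, of x y] by fastforce
  show "x * y \<in> {x \<in> F. x = 0 \<or> v x \<ge> 0}" using * val_mult[of x y] subring_set_mult[OF Fr, of x y] by fastforce
next
  note Fr = subfield_set_imp_subring_set[OF F]
  fix x assume "x \<in> {x \<in> F. x = 0 \<or> v x \<ge> 0}"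
  then show "- x \<in> {x \<in> F. x = 0 \<or> v x \<ge> 0}"
    using val_minus[of x] subring_set_uminus[OF Fr, of x] by (cases "x = 0") auto
qed (use val_1 subring_set_1[OF subfield_set_imp_subring_set[OF F]] in auto)

lemma val_powi:
  assumes "x \<in> F" "x \<noteq> 0"
  shows "x powi k \<in> F" "v (x powi k) = k * v x"
proof -
  note Fr = subfield_set_imp_subring_set[OF F]
  have i: "inverse x \<in> F" "inverse x \<noteq> 0" using assms subfield_set_inverse[OF F] by auto
  show "x powi k \<in> F" using assms i by (simp add: power_int_def subring_set_power[OF Fr])
  show "v (x powi k) = k * v x"
    using val_power[OF assms] val_power[OF i] val_inverse[OF assms] by (simp add: power_int_def)
qed

text \<open>The value group is generated by some \<open>d > 0\<close>; dividing by \<open>d\<close>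
  makes the valuation surjective.\<close>

lemma exists_normalized:
  assumes x: "x \<in> F" "x \<noteq> 0" "v x \<noteq> 0"
  obtains d w where "d > 0" "place_on F w" "\<And>x. x \<in> F \<Longrightarrow> x \<noteq> 0 \<Longrightarrow> v x = d * w x"
proof -
  note Fr = subfield_set_imp_subring_set[OF F]
  define S where "S = v ` (F - {0})"
  have Sdiff: "s - t \<in> S" if st: "s \<in> S" "t \<in> S" for s t
  proof -
    obtain x y where xy: "x \<in> F" "x \<noteq> 0" "y \<in> F" "y \<noteq> 0" "s = v x" "t = v y" using st by (auto simp: S_def)
    have i: "inverse y \<in> F" "inverse y \<noteq> 0" using xy subfield_set_inverse[OF F] by auto
    have "x * inverse y \<in> F - {0}" using xy i subring_set_mult[OF Fr] by simp
    moreover have "v (x * inverse y) = s - t" using val_mult[OF xy(1,2) i] val_inverse[OF xy(3,4)] xy(5,6) by simp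
    ultimately show ?thesis unfolding S_def by (metis imageI)
  qed
  have vx: "v x \<in> S" using x by (simp add: S_def)
  then have "- v x \<in> S" using Sdiff[OF Sdiff[OF vx vx] vx] by simp
  then have "\<bar>v x\<bar> \<in> S" using vx by (simp add: abs_if)
  then obtain d where d: "d > 0" "d \<in> S" "\<And>x. x \<in> S \<Longrightarrow> d dvd x"
    by (rule int_subgroup_generator[of S, rotated]) (use Sdiff x(3) in auto)
  define w where "w = (\<lambda>x\<in>F - {0}. v x div d)"
  have w: "v x = d * w x" if "x \<in> F" "x \<noteq> 0" for x
    using that d(3)[of "v x"] by (auto simp: w_def S_def)
  obtain x0 where x0: "x0 \<in> F" "x0 \<noteq> 0" "v x0 = d" using d(2) by (auto simp: S_def)
  have "place_on F w"
    unfolding place_on_def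
  proof (intro conjI ballI impI)
    show "w \<in> extensional (F - {0})" by (simp add: w_def)
    have "k \<in> w ` (F - {0})" for k
    proof -
      have "d * w (x0 powi k) = d * k" using val_powi[OF x0(1,2), of k] w[of "x0 powi k"] x0(2,3) by simp
      then have "w (x0 powi k) = k" using d(1) by simp
      then show ?thesis using val_powi(1)[OF x0(1,2), of k] x0(2) by (intro image_eqI[of _ _ "x0 powi k"]) auto
    qed
    then show "w ` (F - {0}) = UNIV" by blast
    fix x y assume xy: "x \<in> F - {0}" "y \<in> F - {0}"
    have closed: "x * y \<in> F" "x * y \<noteq> 0" "x + y \<in> F" using xy subring_set_mult[OF Fr] subring_set_add[OF Fr] by auto
    have "d * w (x * y) = d * (w x + w y)"
      using val_mult[of x y] w[of x] w[of y] w[of "x * y"] xy closed by (simp add: algebra_simps)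
    then show "w (x * y) = w x + w y" using d(1) by simp
    assume nz: "x + y \<noteq> 0"
    have "min (d * w x) (d * w y) \<le> d * w (x + y)"
      using val_add[of x y] w[of x] w[of y] w[of "x + y"] xy closed nz by simp
    then show "min (w x) (w y) \<le> w (x + y)" using d(1) by (auto simp: min_def split: if_splits)
  qed
  from that[OF d(1) this w] show thesis .
qed

end

lemma subfield_set_UNIV: "subfield_set UNIV"
  by (simp add: subfield_set_def subring_set_def)

lemma place_onD:
  assumes "place_on F v" "x \<in> F" "y \<in> F" "x \<noteq> 0" "y \<noteq> 0"
  shows "v (x * y) = v x + v y" "x + y \<noteq> 0 \<Longrightarrow> min (v x) (v y) \<le> v (x + y)"
  using assms by (auto simp: place_on_def)

lemma place_uniformizer:
  assumes "place_on F v"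
  obtains x where "x \<in> F" "x \<noteq> 0" "v x = 1"
proof -
  have "1 \<in> v ` (F - {0})" using assms unfolding place_on_def by blast
  then show ?thesis by (elim imageE DiffE) (rule that, auto)
qed

context
  fixes v :: "'a::field \<Rightarrow> int"
  assumes v: "place_on UNIV v"
begin

lemmas place_UNIV = subfield_set_UNIV place_imp_valuation[OF v]

lemma place_UNIV_1: "v 1 = 0"
  by (rule val_1[OF place_UNIV])

lemma place_UNIV_minus: "x \<noteq> 0 \<Longrightarrow> v (- x) = v x"
  by (rule val_minus[OF place_UNIV]) simp_all

lemma place_UNIV_inverse: "x \<noteq> 0 \<Longrightarrow> v (inverse x) = - v x"
  by (rule val_inverse[OF place_UNIV]) simp_all

lemma place_UNIV_power: "x \<noteq> 0 \<Longrightarrow> v (x ^ n) = int n * v x"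
  by (rule val_power[OF place_UNIV]) simp_all

lemma place_UNIV_powi: "x \<noteq> 0 \<Longrightarrow> v (x powi k) = k * v x"
  by (rule val_powi[OF place_UNIV]) simp_all

lemma place_UNIV_divide: "x \<noteq> 0 \<Longrightarrow> y \<noteq> 0 \<Longrightarrow> v (x / y) = v x - v y"
  using place_onD(1)[OF v, of x "inverse y"] by (simp add: place_UNIV_inverse divide_inverse)

lemma subring_place_ring: "subring_set {x. x = 0 \<or> v x \<ge> 0}"
  using subring_val_ring[OF place_UNIV] by simp

lemma place_add_eq:
  assumes "x \<noteq> 0" "y \<noteq> 0" "v x < v y"
  shows "x + y \<noteq> 0" "v (x + y) = v x"
  using val_add_eq[OF place_UNIV _ assms(1) _ assms(2,3)] by simp_all

end

text \<open>In the valuation ring, two terms of a polynomial relation of \<open>x\<close> must agree up to a unit. So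
  \<open>x ^ d\<close> is a unit times a power of the uniformizer \<open>p\<close> for some \<open>d \<le> n\<close>, and \<open>x ^ fact n\<close> too.\<close>

theorem place_extension:
  fixes L :: "'k::field alg_closure set" and v :: "'k \<Rightarrow> int"
  assumes v: "place_on UNIV v" and L: "subfield_set L" and KL: "range to_ac \<subseteq> L"
    and bounded: "\<And>x. x \<in> L \<Longrightarrow> \<exists>P\<in>poly_over (range to_ac). P \<noteq> 0 \<and> degree P \<le> n \<and> poly P x = 0"
  shows "\<exists>w e. place_on L w \<and> lies_over_with_index w v e"
proof -
  note Lr = subfield_set_imp_subring_set[OF L]
  define R where "R = {x. x = 0 \<or> v x \<ge> 0}"
  have R: "subring_set R" unfolding R_def by (rule subring_place_ring[OF v])
  obtain \<pi> where \<pi>: "\<pi> \<noteq> 0" "v \<pi> = 1" by (rule place_uniformizer[OF v])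
  define p where "p = to_ac \<pi>"
  have p0: "p \<noteq> 0" using \<pi> by (simp add: p_def)
  have pL: "p \<in> L" using KL by (auto simp: p_def)
  have "subring_set (to_ac ` R)"
  proof (rule subring_setI)
    show "1 \<in> to_ac ` R" using subring_set_1[OF R] to_ac_1 by (metis imageI)
    fix x y assume "x \<in> to_ac ` R" "y \<in> to_ac ` R"
    then show "x - y \<in> to_ac ` R" "x * y \<in> to_ac ` R"
      using subring_set_diff[OF R] subring_set_mult[OF R] by (auto simp flip: to_ac_diff to_ac_mult)
  qed
  moreover have "to_ac ` R \<subseteq> L" using KL by auto
  moreover have "inverse p \<notin> to_ac ` R"
  proof
    assume "inverse p \<in> to_ac ` R"
    then have "inverse \<pi> \<in> R" by (auto simp: p_def simp flip: to_ac_inverse)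
    then show False using \<pi> place_UNIV_inverse[OF v, of \<pi>] by (simp add: R_def)
  qed
  ultimately obtain A where rA: "subring_set A" "to_ac ` R \<subseteq> A" "A \<subseteq> L" "inverse p \<notin> A"
    "\<And>B. subring_set B \<Longrightarrow> A \<subseteq> B \<Longrightarrow> B \<subseteq> L \<Longrightarrow> inverse p \<notin> B \<Longrightarrow> B = A"
    by (rule exists_maximal_subring_avoiding) simp
  have pA: "p \<in> A" using rA(2) \<pi> by (auto simp: p_def R_def)
  interpret maximal_avoiding A L p
    by unfold_locales (use rA L pA p0 in auto)
  interpret valuation_subring A L
    by unfold_locales (use rA L valuation_ring in auto)
  \<comment> \<open>Elements of the base field are units times powers of \<open>p\<close>, since
    \<open>A\<close> contains the image of the whole valuation ring \<open>R\<close> of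
    \<open>v\<close>.\<close>
  have unit_K: "unit (to_ac c / p powi v c)" if c: "c \<noteq> 0" for c
  proof -
    define d where "d = c / \<pi> powi v c"
    have d0: "d \<noteq> 0" using c \<pi> by (simp add: d_def)
    have "v d = 0" using c \<pi> by (simp add: d_def place_UNIV_divide[OF v] place_UNIV_powi[OF v])
    then have "d \<in> R" "inverse d \<in> R" using place_UNIV_inverse[OF v d0] by (auto simp: R_def)
    then have "to_ac d \<in> A" "inverse (to_ac d) \<in> A" using rA(2) by (auto simp flip: to_ac_inverse)
    moreover have "to_ac d = to_ac c / p powi v c"
      by (cases "v c \<ge> 0") (auto simp: d_def p_def power_int_def)
    ultimately show ?thesis using d0 by (metis to_ac_eq_0_iff unit_def)
  qed
  have p_pos: "k \<ge> 0" if "p powi k \<in> A" for k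
  proof (rule ccontr)
    assume k: "\<not> k \<ge> 0"
    have "p ^ (nat (- k) - 1) * p powi k \<in> A"
      by (rule subring_set_mult[OF \<open>subring_set A\<close> subring_set_power[OF \<open>subring_set A\<close> pA] that])
    moreover have "p ^ (nat (- k) - 1) * p powi k = inverse p"
    proof -
      obtain m where m: "nat (- k) = Suc m" using k by (cases "nat (- k)") auto
      have "p powi k = inverse p ^ Suc m" using k m by (simp add: power_int_def)
      then show ?thesis using p0 m by (simp add: field_simps)
    qed
    ultimately show False using rA(4) by simp
  qed
  have p_powi_unit: "k = 0" if "unit (p powi k)" for k
  proof -
    have "p powi k \<in> A" "p powi (- k) \<in> A" using that by (auto simp: unit_def power_int_minus)
    then show ?thesis using p_pos[of k] p_pos[of "- k"] by simp
  qed
  \<comment> \<open>A common multiple of all exponents \<open>d \<le> n\<close> that can arise from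
    a relation of degree at most \<open>n\<close>.\<close>
  define N where "N = (fact n :: nat)"
  have N: "N > 0" by (simp add: N_def)
  have ex: "\<exists>k. unit (x ^ N / p powi k)" if x: "x \<in> L" "x \<noteq> 0" for x
  proof -
    obtain P where P: "P \<in> poly_over (range to_ac)" "P \<noteq> 0" "degree P \<le> n" "poly P x = 0"
      using bounded[OF x(1)] by blast
    define I where "I = {i. i \<le> degree P \<and> coeff P i \<noteq> 0}"
    define z where "z i = coeff P i * x ^ i" for i
    have "\<exists>i\<in>I. \<exists>j\<in>I. i \<noteq> j \<and> unit (z j / z i)"
    proof (rule sum_eq_0_imp_unit_quotient)
      show "finite I" by (simp add: I_def)
      show "I \<noteq> {}" using P(2) by (auto simp: I_def)
      show "z i \<in> L \<and> z i \<noteq> 0" if "i \<in> I" for i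
        using that x poly_overD[OF P(1), of i] KL
        by (auto simp: I_def z_def intro!: subring_set_mult[OF Lr] subring_set_power[OF Lr])
      have "sum z I = (\<Sum>i\<le>degree P. z i)"
        by (rule sum.mono_neutral_left) (auto simp: I_def z_def)
      then show "sum z I = 0" using P(4) by (simp add: z_def poly_altdef)
    qed
    then obtain i j where ij: "i \<in> I" "j \<in> I" "i < j" "unit (z j / z i)"
      by (metis inverse_divide nat_neq_iff unit_inverse)
    define d where "d = j - i"
    have d: "d > 0" "d \<le> n" "j = i + d" using ij P(3) by (auto simp: d_def I_def)
    obtain a b where ab: "coeff P i = to_ac a" "coeff P j = to_ac b"
      using poly_overD[OF P(1)] by (metis imageE)
    have ab0: "a \<noteq> 0" "b \<noteq> 0" using ij(1,2) ab by (auto simp: I_def)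
    have zz: "z j / z i = to_ac (b / a) * x ^ d"
      using x ab ab0 d(3) by (simp add: z_def power_add)
    define c where "c = b / a"
    have c0: "c \<noteq> 0" using ab0 by (simp add: c_def)
    have u1: "unit (inverse (to_ac c / p powi v c))" by (rule unit_inverse[OF unit_K[OF c0]])
    have u2: "unit (to_ac c * x ^ d)" using ij(4) zz by (simp add: c_def)
    have "x ^ d * p powi v c = inverse (to_ac c / p powi v c) * (to_ac c * x ^ d)"
      using c0 p0 by (simp add: field_simps)
    then have u3: "unit (x ^ d * p powi v c)" using unit_mult[OF u1 u2] by simp
    have "d dvd N" unfolding N_def using d by (intro dvd_fact) auto
    then obtain m where m: "N = d * m" by (elim dvdE)
    have "(x ^ d * p powi v c) ^ m = x ^ N * p powi (v c * int m)"
      by (simp add: m power_mult_distrib power_mult power_int_mult)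
    then have "unit (x ^ N * p powi (v c * int m))" using unit_power[OF u3, of m] by simp
    then have "unit (x ^ N / p powi (- (v c * int m)))"
      by (simp add: power_int_minus divide_inverse)
    then show ?thesis by blast
  qed
  \<comment> \<open>\<open>\<phi>\<close> is \<open>N\<close> times the rational valuation that is 1
    at \<open>p\<close>; the factor clears all denominators.\<close>
  define \<phi> where "\<phi> x = (SOME k. unit (x ^ N / p powi k))" for x
  have \<phi>: "unit (x ^ N / p powi \<phi> x)" if "x \<in> L" "x \<noteq> 0" for x
    unfolding \<phi>_def by (rule someI_ex[OF ex[OF that]])
  have \<phi>_eq: "\<phi> x = k" if "x \<in> L" "x \<noteq> 0" "unit (x ^ N / p powi k)" for x k
  proof -
    have "unit (inverse (x ^ N / p powi \<phi> x) * (x ^ N / p powi k))"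
      by (intro unit_mult unit_inverse \<phi> that)
    moreover have "inverse (x ^ N / p powi \<phi> x) * (x ^ N / p powi k) = p powi (\<phi> x - k)"
      using that(2) p0 by (simp add: power_int_diff field_simps)
    ultimately show ?thesis using p_powi_unit[of "\<phi> x - k"] by simp
  qed
  have \<phi>_mult: "\<phi> (x * y) = \<phi> x + \<phi> y" if "x \<in> L" "x \<noteq> 0" "y \<in> L" "y \<noteq> 0" for x y
  proof (rule \<phi>_eq)
    show "x * y \<in> L" by (rule subring_set_mult[OF Lr that(1,3)])
    show "x * y \<noteq> 0" using that by simp
    have "unit (x ^ N / p powi \<phi> x * (y ^ N / p powi \<phi> y))" by (intro unit_mult \<phi> that)
    moreover have "x ^ N / p powi \<phi> x * (y ^ N / p powi \<phi> y) = (x * y) ^ N / p powi (\<phi> x + \<phi> y)"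
      using p0 by (simp add: power_mult_distrib power_int_add)
    ultimately show "unit ((x * y) ^ N / p powi (\<phi> x + \<phi> y))" by simp
  qed
  have \<phi>_nonneg: "\<phi> a \<ge> 0" if "a \<in> A" "a \<noteq> 0" for a
  proof -
    have aL: "a \<in> L" using that rA(3) by blast
    have "inverse (a ^ N / p powi \<phi> a) \<in> A" using \<phi>[OF aL that(2)] unfolding unit_def by blast
    then have "inverse (a ^ N / p powi \<phi> a) * a ^ N \<in> A"
      by (intro subring_set_mult[OF rA(1)] subring_set_power[OF rA(1)] that)
    moreover have "inverse (a ^ N / p powi \<phi> a) * a ^ N = p powi \<phi> a" using that p0 by simp
    ultimately show ?thesis using p_pos by simp
  qed
  have \<phi>_div: "\<phi> (x / y) = \<phi> x - \<phi> y" if "x \<in> L" "x \<noteq> 0" "y \<in> L" "y \<noteq> 0" for x y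
    using \<phi>_mult[of "x / y" y] that subfield_set_divide[OF L that(1,3)] by simp
  \<comment> \<open>If \<open>x / y\<close> is not in \<open>A\<close>, then \<open>y / x\<close> is
    a nonunit of \<open>A\<close> with value 0; but then its \<open>N\<close>-th power is a unit,
    and so is \<open>y / x\<close> itself.\<close>
  have quot: "x / y \<in> A" if xy: "x \<in> L" "x \<noteq> 0" "y \<in> L" "y \<noteq> 0" "\<phi> x \<ge> \<phi> y" for x y
  proof (rule ccontr)
    assume no: "x / y \<notin> A"
    have yxL: "y / x \<in> L" by (rule subfield_set_divide[OF L xy(3,1)])
    have "y / x \<in> A" using no total[OF subfield_set_divide[OF L xy(1,3)]] by simp
    moreover have "y / x \<noteq> 0" using xy by simp
    ultimately have "\<phi> (y / x) \<ge> 0" by (rule \<phi>_nonneg)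
    then have "\<phi> (y / x) = 0" using \<phi>_div[of y x] xy by simp
    then have "unit ((y / x) ^ N)" using \<phi>[OF yxL \<open>y / x \<noteq> 0\<close>] by simp
    then have "inverse ((y / x) ^ N) \<in> A" unfolding unit_def by blast
    then have "(y / x) ^ (N - 1) * inverse ((y / x) ^ N) \<in> A"
      by (intro subring_set_mult[OF rA(1)] subring_set_power[OF rA(1)] \<open>y / x \<in> A\<close>)
    moreover have "(y / x) ^ (N - 1) * inverse ((y / x) ^ N) = x / y"
      using N xy by (cases N) (auto simp: field_simps)
    ultimately show False using no by simp
  qed
  have \<phi>_add: "min (\<phi> x) (\<phi> y) \<le> \<phi> (x + y)"
    if xy: "x \<in> L" "x \<noteq> 0" "y \<in> L" "y \<noteq> 0" "x + y \<noteq> 0" for x y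
  proof -
    have aux: "\<phi> y \<le> \<phi> (x + y)" if "x \<in> L" "x \<noteq> 0" "y \<in> L" "y \<noteq> 0" "x + y \<noteq> 0" "\<phi> y \<le> \<phi> x" for x y
    proof -
      have q: "x / y \<in> A" by (rule quot) (use that in auto)
      then have "1 + x / y \<in> A" by (intro subring_set_add[OF rA(1)] subring_set_1[OF rA(1)])
      moreover have nz: "1 + x / y \<noteq> 0" using that by (simp add: add_divide_eq_if_simps add.commute)
      ultimately have "\<phi> (1 + x / y) \<ge> 0" by (rule \<phi>_nonneg)
      moreover have "\<phi> (y * (1 + x / y)) = \<phi> y + \<phi> (1 + x / y)"
        using that q rA(3) nz by (intro \<phi>_mult) (auto intro!: subring_set_add[OF Lr] subring_set_1[OF Lr])
      moreover have "y * (1 + x / y) = x + y" using that by (simp add: field_simps)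
      ultimately show ?thesis by simp
    qed
    show ?thesis using aux[of x y] aux[of y x] xy by (auto simp: add.commute min_def)
  qed
  have \<phi>_K: "\<phi> (to_ac c) = int N * v c" if c: "c \<noteq> 0" for c
  proof (rule \<phi>_eq)
    show "to_ac c \<in> L" using KL by blast
    have "(to_ac c / p powi v c) ^ N = to_ac c ^ N / p powi (int N * v c)"
      by (simp add: power_divide power_int_mult mult.commute[of "int N"])
    then show "unit (to_ac c ^ N / p powi (int N * v c))" using unit_power[OF unit_K[OF c], of N] by simp
  qed (use c in auto)
  have "valuation_on L \<phi>" unfolding valuation_on_def using \<phi>_mult \<phi>_add by simp
  moreover have \<phi>_p: "\<phi> p = int N" using \<phi>_K[OF \<pi>(1)] \<pi>(2) by (simp add: p_def)
  ultimately obtain d w where d: "d > 0" and w: "place_on L w" "\<And>x. x \<in> L \<Longrightarrow> x \<noteq> 0 \<Longrightarrow> \<phi> x = d * w x"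
    using exists_normalized[OF L _ pL p0] N by (metis of_nat_0_eq_iff less_numeral_extra(3))
  \<comment> \<open>\<open>\<phi> = d w\<close> and \<open>\<phi> p = N\<close> identify
    \<open>e = N / d\<close> as the ramification index.\<close>
  define e where "e = w p"
  have e: "int N = d * e" using w(2)[OF pL p0] \<phi>_p by (simp add: e_def)
  have e_pos: "e > 0" using e N d by (metis of_nat_0_less_iff zero_less_mult_pos)
  have "lies_over_with_index w v (nat e)"
    unfolding lies_over_with_index_def
  proof (intro conjI allI impI)
    show "nat e > 0" using e_pos by simp
    fix c :: 'k assume c: "c \<noteq> 0"
    have "d * w (to_ac c) = \<phi> (to_ac c)" using w(2)[OF range_subsetD[OF KL, of c]] c by simp
    also have "\<dots> = d * (e * v c)" using \<phi>_K[OF c] e by simp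
    finally show "w (to_ac c) = int (nat e) * v c" using d e_pos by simp
  qed
  then show ?thesis using w(1) by blast
qed

section \<open>Places of the rational function field\<close>

lemma to_fract_power: "to_fract (a ^ n) = to_fract a ^ n"
  by (induction n) auto

lemma multiplicity_irreducible_mult:
  fixes \<pi> :: "'p::prime_card mod_ring poly"
  assumes "irreducible \<pi>" "a \<noteq> 0" "b \<noteq> 0"
  shows "multiplicity \<pi> (a * b) = multiplicity \<pi> a + multiplicity \<pi> b"
  using assms irreducible_imp_prime_elem prime_elem_multiplicity_mult_distrib by blast

lemma ratfun_cases:
  fixes x :: "'p::prime_card ratfun"
  obtains a b where "x = to_fract a / to_fract b" "b \<noteq> 0" "coprime a b"
  using Fract_quot_of_fract[of x] Fract_conv_to_fract[of "fst (quot_of_fract x)" "snd (quot_of_fract x)"]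
    snd_quot_of_fract_nonzero[of x] coprime_quot_of_fract[of x] by metis

lemma CHAR_ratfun: "CHAR('p::prime_card ratfun) = CARD('p)"
proof (rule CHAR_eqI)
  have of_nat: "of_nat n = (to_fract (of_nat n) :: 'p ratfun)" for n
    by (induction n) auto
  show "of_nat CARD('p) = (0 :: 'p ratfun)"
    unfolding of_nat using of_nat_CHAR[where 'a = "'p mod_ring poly"] by simp
  fix n assume "of_nat n = (0 :: 'p ratfun)"
  then have "of_nat n = (0 :: 'p mod_ring poly)" unfolding of_nat by simp
  then show "CARD('p) dvd n" by (simp add: of_nat_eq_0_iff_char_dvd)
qed

text \<open>Extension of an additive function on polynomials to fractions, through the normalized
  representative; \<open>fract_val_eq\<close> shows that any representative gives the same value.
  Restriction to nonzero arguments is the convention of \<open>place_on\<close>.\<close>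

definition fract_val :: "('p::prime_card mod_ring poly \<Rightarrow> int) \<Rightarrow> 'p ratfun \<Rightarrow> int" where
  "fract_val \<mu> = (\<lambda>x\<in>UNIV - {0}. \<mu> (fst (quot_of_fract x)) - \<mu> (snd (quot_of_fract x)))"

lemma fract_val_eq:
  assumes \<mu>: "\<And>a b. a \<noteq> 0 \<Longrightarrow> b \<noteq> 0 \<Longrightarrow> \<mu> (a * b) = \<mu> a + \<mu> b" and ab: "a \<noteq> 0" "b \<noteq> 0"
  shows "fract_val \<mu> (to_fract a / to_fract b) = \<mu> a - \<mu> b"
proof -
  define x where "x = to_fract a / to_fract b"
  define c d where "c = fst (quot_of_fract x)" and "d = snd (quot_of_fract x)"
  have x: "x \<noteq> 0" using ab by (simp add: x_def)
  have cd: "c \<noteq> 0" "d \<noteq> 0" using x by (auto simp: c_def d_def)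
  have "x = to_fract c / to_fract d" by (simp add: c_def d_def flip: Fract_conv_to_fract)
  then have "to_fract (a * d) = to_fract (c * b)" using ab cd by (simp add: x_def field_simps)
  then have "a * d = c * b" by (simp only: to_fract_eq_iff)
  then have "\<mu> a + \<mu> d = \<mu> c + \<mu> b" using \<mu> ab cd by metis
  then show ?thesis using x by (simp add: fract_val_def c_def d_def flip: x_def)
qed

text \<open>The absolute value admits both signs: a multiplicity is positive at its irreducible
  polynomial, while \<open>- degree\<close> is negative at \<open>t\<close>.\<close>

lemma place_fract_val:
  fixes \<mu> :: "'p::prime_card mod_ring poly \<Rightarrow> int"
  assumes \<mu>: "\<And>a b. a \<noteq> 0 \<Longrightarrow> b \<noteq> 0 \<Longrightarrow> \<mu> (a * b) = \<mu> a + \<mu> b"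
    and \<mu>_add: "\<And>a b. a \<noteq> 0 \<Longrightarrow> b \<noteq> 0 \<Longrightarrow> a + b \<noteq> 0 \<Longrightarrow> min (\<mu> a) (\<mu> b) \<le> \<mu> (a + b)"
    and q: "q \<noteq> 0" "\<bar>\<mu> q\<bar> = 1"
  shows "place_on UNIV (fract_val \<mu>)"
  unfolding place_on_def
proof (intro conjI ballI impI)
  note val = fract_val_eq[OF \<mu>]
  have \<mu>1: "\<mu> 1 = 0" using \<mu>[of 1 1] by simp
  have \<mu>_pow: "\<mu> (a ^ n) = int n * \<mu> a" if "a \<noteq> 0" for a n
    by (induction n) (use that in \<open>auto simp: \<mu>1 \<mu> algebra_simps\<close>)
  show "fract_val \<mu> \<in> extensional (UNIV - {0})" by (simp add: fract_val_def)
  have "k \<in> fract_val \<mu> ` (UNIV - {0})" for k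
  proof -
    define m where "m = nat \<bar>k\<bar>"
    have qm: "q ^ m \<noteq> 0" using q by simp
    have 1: "fract_val \<mu> (to_fract (q ^ m) / to_fract 1) = int m * \<mu> q"
      using val[OF _ _ qm, of 1] by (simp add: \<mu>_pow q \<mu>1)
    have 2: "fract_val \<mu> (to_fract 1 / to_fract (q ^ m)) = - (int m * \<mu> q)"
      using val[OF _ _ _ qm, of 1] by (simp add: \<mu>_pow q \<mu>1)
    have "k = int m * \<mu> q \<or> k = - (int m * \<mu> q)"
      using q(2) by (auto simp: m_def abs_if split: if_splits)
    moreover have "to_fract (q ^ m) / to_fract 1 \<noteq> 0" "to_fract 1 / to_fract (q ^ m) \<noteq> 0" using qm by auto
    ultimately show ?thesis using 1 2 by (metis DiffI UNIV_I image_eqI singletonD)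
  qed
  then show "fract_val \<mu> ` (UNIV - {0}) = UNIV" by blast
  fix x y :: "'p ratfun" assume "x \<in> UNIV - {0}" "y \<in> UNIV - {0}"
  then have xy: "x \<noteq> 0" "y \<noteq> 0" by auto
  obtain a b where ab: "x = to_fract a / to_fract b" "b \<noteq> 0" by (rule ratfun_cases[of x])
  obtain c d where cd: "y = to_fract c / to_fract d" "d \<noteq> 0" by (rule ratfun_cases[of y])
  have ac: "a \<noteq> 0" "c \<noteq> 0" using xy ab cd by auto
  have vx: "fract_val \<mu> x = \<mu> a - \<mu> b" and vy: "fract_val \<mu> y = \<mu> c - \<mu> d"
    using val ab cd ac by auto
  have "x * y = to_fract (a * c) / to_fract (b * d)" using ab cd by simp
  then have "fract_val \<mu> (x * y) = \<mu> (a * c) - \<mu> (b * d)"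
    using val[of "a * c" "b * d"] ab cd ac by simp
  then show "fract_val \<mu> (x * y) = fract_val \<mu> x + fract_val \<mu> y"
    unfolding vx vy using \<mu> ab cd ac by simp
  assume xy0: "x + y \<noteq> 0"
  have s: "x + y = to_fract (a * d + c * b) / to_fract (b * d)" using ab cd by (simp add: field_simps)
  then have nz: "a * d + c * b \<noteq> 0" using xy0 by (metis div_0 to_fract_0)
  have "fract_val \<mu> (x + y) = \<mu> (a * d + c * b) - \<mu> (b * d)"
    unfolding s by (rule val) (use nz ab cd in auto)
  moreover have "min (\<mu> (a * d)) (\<mu> (c * b)) \<le> \<mu> (a * d + c * b)"
    by (rule \<mu>_add) (use nz ab cd ac in auto)
  ultimately show "min (fract_val \<mu> x) (fract_val \<mu> y) \<le> fract_val \<mu> (x + y)"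
    unfolding vx vy using \<mu> ab cd ac by (simp add: min_def split: if_splits)
qed

definition inf_place :: "'p::prime_card ratfun \<Rightarrow> int" where
  "inf_place = fract_val (\<lambda>a. - int (degree a))"

definition fin_place :: "'p::prime_card mod_ring poly \<Rightarrow> 'p ratfun \<Rightarrow> int" where
  "fin_place \<pi> = fract_val (\<lambda>a. int (multiplicity \<pi> a))"

lemma inf_place_eq:
  "a \<noteq> 0 \<Longrightarrow> b \<noteq> 0 \<Longrightarrow> inf_place (to_fract a / to_fract b) = int (degree b) - int (degree a)"
  unfolding inf_place_def by (subst fract_val_eq) (auto simp: degree_mult_eq)

lemma inf_place_poly: "a \<noteq> 0 \<Longrightarrow> inf_place (to_fract a) = - int (degree a)"
  using inf_place_eq[of a 1] by simp

lemma place_inf_place: "place_on UNIV (inf_place :: 'p::prime_card ratfun \<Rightarrow> int)"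
  unfolding inf_place_def
proof (rule place_fract_val)
  fix a b :: "'p mod_ring poly"
  have "degree (a + b) \<le> max (degree a) (degree b)" by (rule degree_add_le_max)
  then show "min (- int (degree a)) (- int (degree b)) \<le> - int (degree (a + b))"
    by (auto simp: min_def max_def split: if_splits)
  show "\<bar>- int (degree [:0, 1 :: 'p mod_ring:])\<bar> = 1" by simp
qed (auto simp: degree_mult_eq)

lemma fin_place_eq:
  assumes "irreducible \<pi>" "a \<noteq> 0" "b \<noteq> 0"
  shows "fin_place \<pi> (to_fract a / to_fract b) = int (multiplicity \<pi> a) - int (multiplicity \<pi> b)"
  unfolding fin_place_def using assms
  by (subst fract_val_eq) (auto simp: multiplicity_irreducible_mult)

lemma place_fin_place:
  fixes \<pi> :: "'p::prime_card mod_ring poly"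
  assumes \<pi>: "irreducible \<pi>"
  shows "place_on UNIV (fin_place \<pi>)"
  unfolding fin_place_def
proof (rule place_fract_val)
  have nu: "\<not> is_unit \<pi>" "\<pi> \<noteq> 0" using \<pi> by auto
  fix a b :: "'p mod_ring poly" assume ab: "a \<noteq> 0" "b \<noteq> 0"
  show "int (multiplicity \<pi> (a * b)) = int (multiplicity \<pi> a) + int (multiplicity \<pi> b)"
    using \<pi> ab by (simp add: multiplicity_irreducible_mult)
  assume nz: "a + b \<noteq> 0"
  define k where "k = min (multiplicity \<pi> a) (multiplicity \<pi> b)"
  have "\<pi> ^ k dvd a" "\<pi> ^ k dvd b" by (auto simp: k_def intro: multiplicity_dvd')
  then have "\<pi> ^ k dvd a + b" by simp
  then have "k \<le> multiplicity \<pi> (a + b)" using nz nu by (intro multiplicity_geI) auto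
  then show "min (int (multiplicity \<pi> a)) (int (multiplicity \<pi> b)) \<le> int (multiplicity \<pi> (a + b))"
    by (auto simp: k_def min_def split: if_splits)
next
  have "\<not> is_unit \<pi>" "\<pi> \<noteq> 0" using \<pi> by auto
  then show "\<bar>int (multiplicity \<pi> \<pi>)\<bar> = 1" by (simp add: multiplicity_self)
qed (use \<pi> in auto)

text \<open>\<open>c ^ p = c\<close> gives \<open>p * v c = v c\<close>.\<close>

lemma place_const:
  fixes v :: "'p::prime_card ratfun \<Rightarrow> int"
  assumes v: "place_on UNIV v" and c: "c \<noteq> 0"
  shows "v (ratfun_const c) = 0"
proof -
  have "c ^ CARD('p) = c" using finite_field_power_card_eq_same[of c] by simp
  then have "ratfun_const c ^ CARD('p) = ratfun_const c"
    by (simp add: ratfun_const_def poly_const_pow flip: to_fract_power)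
  moreover have nz: "ratfun_const c \<noteq> 0" using c by (simp add: ratfun_const_def)
  ultimately have "int CARD('p) * v (ratfun_const c) = v (ratfun_const c)"
    using place_UNIV_power[OF v nz, of "CARD('p)"] by simp
  moreover have "CARD('p) > 1" by (rule nontriv)
  ultimately show ?thesis by simp
qed

lemma to_fract_pCons: "to_fract (pCons c q) = ratfun_const c + to_fract [:0, 1:] * to_fract q"
proof -
  have "pCons c q = [:c:] + [:0, 1:] * q" by simp
  then show ?thesis unfolding ratfun_const_def by (metis to_fract_add to_fract_mult)
qed

text \<open>If \<open>t\<close> has a pole, the leading term of a polynomial alone has the least
  value, so \<open>v\<close> is a positive multiple of the place at infinity, and both are
  normalized.\<close>

lemma place_pole_at_t:
  fixes v :: "'p::prime_card ratfun \<Rightarrow> int"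
  assumes v: "place_on UNIV v" and neg: "v (to_fract [:0, 1:]) < 0"
  shows "v = inf_place"
proof -
  define t :: "'p ratfun" where "t = to_fract [:0, 1:]"
  have t0: "t \<noteq> 0" by (simp add: t_def)
  have poly: "v (to_fract a) = int (degree a) * v t" if "a \<noteq> 0" for a
    using that
  proof (induction a)
    case (pCons c q)
    show ?case
    proof (cases "q = 0")
      case True
      then show ?thesis using pCons place_const[OF v, of c] by (simp add: ratfun_const_def)
    next
      case False
      then have vq: "v (t * to_fract q) = int (degree (pCons c q)) * v t"
        using pCons.IH place_onD(1)[OF v, of t "to_fract q"] t0 by (simp add: algebra_simps)
      have tq: "t * to_fract q \<noteq> 0" using False t0 by simp
      have eq: "to_fract (pCons c q) = t * to_fract q + ratfun_const c"
        using to_fract_pCons[of c q] by (simp add: t_def)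
      show ?thesis
      proof (cases "c = 0")
        case True
        then show ?thesis using vq eq by (simp add: ratfun_const_def)
      next
        case False
        have "v (t * to_fract q) < v (ratfun_const c)"
          using vq place_const[OF v False] neg \<open>q \<noteq> 0\<close> by (simp add: t_def mult_less_0_iff add_pos_nonneg)
        moreover have "ratfun_const c \<noteq> 0" using False by (simp add: ratfun_const_def)
        ultimately show ?thesis using place_add_eq(2)[OF v tq] vq eq by metis
      qed
    qed
  qed simp
  have vx: "v (to_fract a / to_fract b) = v t * (int (degree a) - int (degree b))" if "a \<noteq> 0" "b \<noteq> 0" for a b
    using that poly by (simp add: place_UNIV_divide[OF v] algebra_simps)
  obtain x where x: "x \<noteq> 0" "v x = 1" by (rule place_uniformizer[OF v])
  obtain a b where ab: "x = to_fract a / to_fract b" "b \<noteq> 0" by (rule ratfun_cases[of x])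
  have "v t * (int (degree a) - int (degree b)) = 1" using vx[of a b] ab x by auto
  then have "v t dvd 1" by (metis dvd_triv_left)
  then have "v t = - 1" using neg by (auto simp: t_def)
  then have "v x = inf_place x" if "x \<noteq> 0" for x
  proof -
    obtain a b where ab: "x = to_fract a / to_fract b" "b \<noteq> 0" by (rule ratfun_cases[of x])
    then show ?thesis using vx[of a b] inf_place_eq[of a b] \<open>v t = - 1\<close> \<open>x \<noteq> 0\<close> by auto
  qed
  moreover have "v \<in> extensional (UNIV - {0})" using v by (simp add: place_on_def)
  moreover have "inf_place \<in> extensional (UNIV - {0 :: 'p ratfun})" by (simp add: inf_place_def fract_val_def)
  ultimately show ?thesis by (intro extensionalityI[of v "UNIV - {0}"]) auto
qed

lemma place_integral_on_polys:
  fixes v :: "'p::prime_card ratfun \<Rightarrow> int"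
  assumes v: "place_on UNIV v" and nonneg: "v (to_fract [:0, 1:]) \<ge> 0" and a: "a \<noteq> 0"
  shows "v (to_fract a) \<ge> 0"
proof -
  define R where "R = {x. x = 0 \<or> v x \<ge> 0}"
  have R: "subring_set R" unfolding R_def by (rule subring_place_ring[OF v])
  have "to_fract a \<in> R"
  proof (induction a)
    case (pCons c q)
    have "ratfun_const c \<in> R" using place_const[OF v, of c] by (cases "c = 0") (auto simp: R_def ratfun_const_def)
    moreover have "to_fract [:0, 1:] \<in> R" using nonneg by (simp add: R_def)
    ultimately show ?case unfolding to_fract_pCons[of c q]
      using pCons.IH subring_set_add[OF R] subring_set_mult[OF R] by blast
  qed (simp add: R_def)
  then show ?thesis using a by (simp add: R_def)
qed

text \<open>A polynomial of least degree with positive value is irreducible. A polynomial prime to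
  it has value 0 by Bezout, so all values are multiples of \<open>v \<pi>\<close>, which
  normalization forces to be 1.\<close>

lemma place_finite:
  fixes v :: "'p::prime_card ratfun \<Rightarrow> int"
  assumes v: "place_on UNIV v" and nonneg: "v (to_fract [:0, 1:]) \<ge> 0"
  obtains \<pi> where "irreducible \<pi>" "v (to_fract \<pi>) = 1"
proof -
  note vpos = place_integral_on_polys[OF v nonneg]
  have vmult: "v (to_fract (a * b)) = v (to_fract a) + v (to_fract b)" if "a \<noteq> 0" "b \<noteq> 0" for a b
    using that place_onD(1)[OF v, of "to_fract a" "to_fract b"] by simp
  have vunit: "v (to_fract a) = 0" if "is_unit a" for a
  proof -
    obtain b where b: "1 = a * b" using \<open>is_unit a\<close> by (elim dvdE)
    have "a \<noteq> 0" "b \<noteq> 0" using b by auto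
    then have "v (to_fract a) + v (to_fract b) = 0"
      using vmult[of a b] place_UNIV_1[OF v] by (simp flip: b)
    then show ?thesis using vpos[of a] vpos[of b] \<open>a \<noteq> 0\<close> \<open>b \<noteq> 0\<close> by simp
  qed
  obtain x where x: "x \<noteq> 0" "v x = 1" by (rule place_uniformizer[OF v])
  obtain a b where ab: "x = to_fract a / to_fract b" "b \<noteq> 0" by (rule ratfun_cases[of x])
  have a0: "a \<noteq> 0" using ab x by auto
  have v1: "v (to_fract a) - v (to_fract b) = 1"
    using x(2) a0 ab(2) by (simp add: ab(1) place_UNIV_divide[OF v])
  then have "v (to_fract a) > 0" using vpos[OF ab(2)] by simp
  then have ex: "\<exists>q. q \<noteq> 0 \<and> v (to_fract q) > 0" using a0 by blast
  define \<pi> where "\<pi> = (ARG_MIN degree q. q \<noteq> 0 \<and> v (to_fract q) > 0)"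
  have \<pi>: "\<pi> \<noteq> 0" "v (to_fract \<pi>) > 0"
    using arg_min_natI[of "\<lambda>q. q \<noteq> 0 \<and> v (to_fract q) > 0" _ degree] ex unfolding \<pi>_def by blast+
  have least: "degree \<pi> \<le> degree q" if "q \<noteq> 0" "v (to_fract q) > 0" for q
    using arg_min_nat_le[of "\<lambda>q. q \<noteq> 0 \<and> v (to_fract q) > 0" q degree] that unfolding \<pi>_def by blast
  have irr: "irreducible \<pi>"
  proof (rule irreducibleI[OF \<pi>(1)])
    show "\<not> is_unit \<pi>" using vunit[of \<pi>] \<pi>(2) by linarith
    fix c d assume cd: "\<pi> = c * d"
    then have cd0: "c \<noteq> 0" "d \<noteq> 0" using \<pi>(1) by auto
    have deg: "degree \<pi> = degree c + degree d" using cd0 by (simp add: cd degree_mult_eq)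
    have "v (to_fract c) > 0 \<or> v (to_fract d) > 0"
      using vmult[OF cd0] \<pi>(2)[unfolded cd] vpos[OF cd0(1)] vpos[OF cd0(2)] by linarith
    then have "degree d = 0 \<or> degree c = 0" using least[OF cd0(1)] least[OF cd0(2)] deg by linarith
    then show "is_unit c \<or> is_unit d" using cd0 by (auto simp: is_unit_iff_degree)
  qed
  have "v (to_fract \<pi>) dvd v (to_fract q)" if "q \<noteq> 0" for q
  proof -
    have "\<not> is_unit \<pi>" using irr by auto
    obtain c where c: "q = \<pi> ^ multiplicity \<pi> q * c" "\<not> \<pi> dvd c"
      by (rule multiplicity_decompose'[OF \<open>q \<noteq> 0\<close> \<open>\<not> is_unit \<pi>\<close>]) simp
    have c0: "c \<noteq> 0" using c(2) by auto
    have "v (to_fract c) = 0"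
    proof (rule ccontr)
      assume "v (to_fract c) \<noteq> 0"
      then have vc: "v (to_fract c) > 0" using vpos[OF c0] by simp
      have "coprime \<pi> c" using irr c(2) by (simp add: irreducible_imp_prime_elem prime_elem_imp_coprime)
      then obtain r s where rs: "r * \<pi> + s * c = 1"
        using bezout_coefficients_fst_snd[of \<pi> c] by (metis coprime_iff_gcd_eq_1)
      define R where "R = {x. x = 0 \<or> v x > 0}"
      have mem: "to_fract (q * r) \<in> R" if "q \<noteq> 0" "v (to_fract q) > 0" for q r
        using that vmult[of q r] vpos[of r] by (cases "r = 0") (auto simp: R_def)
      have "to_fract (\<pi> * r) + to_fract (c * s) \<in> R"
        using mem[OF \<pi>, of r] mem[OF c0 vc, of s] place_onD(2)[OF v, of "to_fract (\<pi> * r)" "to_fract (c * s)"]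
        unfolding R_def by fastforce
      moreover have "to_fract (\<pi> * r) + to_fract (c * s) = 1"
        using rs by (metis to_fract_add to_fract_1 mult.commute)
      ultimately show False using place_UNIV_1[OF v] by (simp add: R_def)
    qed
    moreover have "v (to_fract (\<pi> ^ multiplicity \<pi> q * c)) = v (to_fract \<pi> ^ multiplicity \<pi> q) + v (to_fract c)"
      using vmult[of "\<pi> ^ multiplicity \<pi> q" c] \<pi>(1) c0 by (simp add: to_fract_power)
    ultimately have "v (to_fract q) = int (multiplicity \<pi> q) * v (to_fract \<pi>)"
      using c(1) \<pi>(1) place_UNIV_power[OF v, of "to_fract \<pi>"] by simp
    then show ?thesis by simp
  qed
  then have "v (to_fract \<pi>) dvd 1" using v1 a0 ab(2) by (metis dvd_diff)
  then show ?thesis using that irr \<pi>(2) by (metis abs_of_pos zdvd1_eq)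
qed

section \<open>Frobenius modulo an irreducible polynomial\<close>

lemma power_char_add:
  fixes x y :: "'a::comm_ring_1"
  assumes "prime CHAR('a)"
  shows "(x + y) ^ (CHAR('a) ^ n) = x ^ (CHAR('a) ^ n) + y ^ (CHAR('a) ^ n)"
  by (rule freshmans_dream'[OF assms]) simp

lemma power_char_diff:
  fixes x y :: "'a::comm_ring_1"
  assumes "prime CHAR('a)"
  shows "(x - y) ^ (CHAR('a) ^ n) = x ^ (CHAR('a) ^ n) - y ^ (CHAR('a) ^ n)"
  using power_char_add[OF assms, of "x - y" y n] by simp

lemma power_char_uminus:
  fixes x :: "'a::comm_ring_1"
  assumes "prime CHAR('a)"
  shows "(- x) ^ (CHAR('a) ^ n) = - (x ^ (CHAR('a) ^ n))"
  using power_char_diff[OF assms, of 0 x n] assms by (simp add: prime_gt_0_nat power_0_left)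

lemma prime_CHAR_poly: "prime CHAR('p::prime_card mod_ring poly)"
  by (simp add: prime_card)

lemma prime_CHAR_ratfun: "prime CHAR('p::prime_card ratfun)"
  by (simp add: CHAR_ratfun prime_card)

text \<open>In lowest terms \<open>a / b\<close>, the powers \<open>a ^ (N - 1)\<close> and
  \<open>b ^ (N - 1)\<close> agree and are coprime, hence units.\<close>

lemma ratfun_power_eq_imp_const:
  fixes x :: "'p::prime_card ratfun"
  assumes "x ^ N = x" "N \<ge> 2"
  obtains c where "x = ratfun_const c"
proof (cases "x = 0")
  case True
  then show ?thesis using that[of 0] by (simp add: ratfun_const_def)
next
  case False
  obtain a b where ab: "x = to_fract a / to_fract b" "b \<noteq> 0" "coprime a b" by (rule ratfun_cases[of x])
  have a0: "a \<noteq> 0" using False ab by auto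
  have "x ^ (N - 1) * x = 1 * x" using assms by (simp flip: power_Suc2)
  then have "x ^ (N - 1) = 1" using False by simp
  then have "to_fract (a ^ (N - 1)) = to_fract (b ^ (N - 1))"
    using ab by (simp add: to_fract_power power_divide)
  then have eq: "a ^ (N - 1) = b ^ (N - 1)" by (simp only: to_fract_eq_iff)
  have "coprime (a ^ (N - 1)) (b ^ (N - 1))" using ab(3) by (simp add: coprime_power_left_iff coprime_power_right_iff)
  then have "is_unit (a ^ (N - 1))" "is_unit (b ^ (N - 1))" using eq by (metis coprime_self)+
  moreover have "N - 1 \<noteq> 0" using assms(2) by simp
  ultimately have "is_unit a" "is_unit b" by (meson is_unit_power_iff)+
  then obtain c d where cd: "a = [:c:]" "b = [:d:]" "d \<noteq> 0"
    by (metis is_unit_polyE ab(2) degree_0_id is_unit_iff_degree a0 pCons_0_0)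
  have "x * to_fract [:d:] = to_fract [:c:]" using ab cd by simp
  moreover have "to_fract [:c / d:] * to_fract [:d:] = to_fract [:c:]"
    using cd(3) by (simp flip: to_fract_mult)
  ultimately have "x = to_fract [:c / d:]" using cd by (metis ab(2) mult_right_cancel to_fract_eq_0_iff)
  then show ?thesis using that by (simp add: ratfun_const_def)
qed

lemma mod_eq_self_iff_degree: "irreducible \<pi> \<Longrightarrow> degree (a mod \<pi>) < degree (\<pi> :: 'p::prime_card mod_ring poly)"
  using degree_mod_less'[of \<pi> a]
  by (cases "a mod \<pi> = 0") (auto intro!: Nat.gr0I simp: irreducible_def is_unit_iff_degree)

lemma finite_polys_degree_less: "finite {a. degree a < n \<and> a \<noteq> (0 :: 'p::prime_card mod_ring poly)}"
proof (rule finite_subset)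
  show "{a. degree a < n \<and> a \<noteq> 0} \<subseteq> Poly ` {xs :: 'p mod_ring list. set xs \<subseteq> UNIV \<and> length xs \<le> n}"
  proof
    fix a :: "'p mod_ring poly" assume "a \<in> {a. degree a < n \<and> a \<noteq> 0}"
    then have "length (coeffs a) \<le> n" by (simp add: length_coeffs)
    moreover have "a = Poly (coeffs a)" by simp
    ultimately show "a \<in> Poly ` {xs. set xs \<subseteq> UNIV \<and> length xs \<le> n}" by blast
  qed
  show "finite (Poly ` {xs :: 'p mod_ring list. set xs \<subseteq> UNIV \<and> length xs \<le> n})"
    by (intro finite_imageI finite_lists_length_le) simp
qed

lemma finite_range_mod:
  fixes \<pi> :: "'p::prime_card mod_ring poly"
  assumes "irreducible \<pi>"
  shows "finite (range (\<lambda>a. a mod \<pi>))"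
proof (rule finite_subset)
  show "range (\<lambda>a. a mod \<pi>) \<subseteq> insert 0 {a. degree a < degree \<pi> \<and> a \<noteq> 0}"
    using mod_eq_self_iff_degree[OF assms] by auto
  show "finite (insert 0 {a. degree a < degree \<pi> \<and> a \<noteq> (0 :: 'p mod_ring poly)})"
    using finite_polys_degree_less by simp
qed

lemma irreducible_dvd_power_char_diff:
  fixes \<pi> :: "'p::prime_card mod_ring poly"
  assumes \<pi>: "irreducible \<pi>" and dvd: "\<pi> dvd r ^ (CARD('p) ^ n) - s ^ (CARD('p) ^ n)"
  shows "\<pi> dvd r - s"
proof -
  have "\<pi> dvd (r - s) ^ (CARD('p) ^ n)" using dvd power_char_diff[OF prime_CHAR_poly, of r s n] by simp
  then show ?thesis
    using irreducible_imp_prime_elem[OF \<pi>] prime_elem_dvd_power by blast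
qed

text \<open>The residue field modulo \<open>\<pi>\<close> is finite, hence perfect.\<close>

lemma exists_frobenius_root_mod:
  fixes \<pi> :: "'p::prime_card mod_ring poly"
  assumes \<pi>: "irreducible \<pi>" and b: "\<not> \<pi> dvd b"
  obtains r where "\<pi> dvd a - r ^ CARD('p) * b"
proof -
  define S where "S = range (\<lambda>a. a mod \<pi>)"
  \<comment> \<open>\<open>F\<close> is injective on residues, as \<open>b\<close> is invertible
    modulo \<open>\<pi>\<close> and Frobenius is injective. Being a self-map of a finite set, it is
    onto.\<close>
  define F where "F r = (r ^ CARD('p) * b) mod \<pi>" for r
  have S: "finite S" unfolding S_def by (rule finite_range_mod[OF \<pi>])
  have "inj_on F S"
  proof (rule inj_onI)
    fix x y assume xy: "x \<in> S" "y \<in> S" "F x = F y"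
    then have "\<pi> dvd x ^ CARD('p) * b - y ^ CARD('p) * b"
      by (simp add: F_def mod_eq_dvd_iff)
    then have "\<pi> dvd (x ^ CARD('p) - y ^ CARD('p)) * b" by (simp add: algebra_simps)
    then have "\<pi> dvd x ^ CARD('p) - y ^ CARD('p)"
      using b irreducible_imp_prime_elem[OF \<pi>] by (simp add: prime_elem_dvd_mult_iff)
    then have "\<pi> dvd x - y" using irreducible_dvd_power_char_diff[OF \<pi>, of x 1 y] by simp
    then show "x = y" using xy(1,2) by (auto simp: S_def mod_eq_dvd_iff[symmetric])
  qed
  moreover have "F ` S \<subseteq> S" by (auto simp: F_def S_def)
  ultimately have "F ` S = S" using S by (simp add: card_image card_subset_eq)
  moreover have "a mod \<pi> \<in> S" by (simp add: S_def)
  ultimately obtain r where "a mod \<pi> = F r" by blast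
  then have "\<pi> dvd a - r ^ CARD('p) * b" by (simp add: F_def mod_eq_dvd_iff)
  then show ?thesis by (rule that)
qed

lemma power_iterate_dvd:
  fixes p d b :: "'a::comm_ring_1"
  assumes "d dvd b ^ q - b"
  shows "d dvd b ^ (q ^ k) - b"
proof (induction k)
  case (Suc k)
  have "b ^ (q ^ k) - b dvd (b ^ (q ^ k)) ^ q - b ^ q"
    by (metis power_diff_sumr2 dvd_triv_left)
  then have "d dvd (b ^ (q ^ k)) ^ q - b ^ q" using Suc dvd_trans by blast
  then have "d dvd ((b ^ (q ^ k)) ^ q - b ^ q) + (b ^ q - b)" using assms by (rule dvd_add)
  then show ?case by (simp flip: power_mult add: mult.commute)
qed simp

text \<open>Each residue class is periodic under Frobenius, by pigeonhole and injectivity; the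
  product of the periods over the finitely many classes serves all of them.\<close>

lemma exists_frobenius_period:
  fixes \<pi> :: "'p::prime_card mod_ring poly"
  assumes \<pi>: "irreducible \<pi>"
  obtains M where "M > 0" "\<And>b. \<pi> dvd b ^ (CARD('p) ^ M) - b"
proof -
  define S where "S = range (\<lambda>a. a mod \<pi>)"
  have S: "finite S" unfolding S_def by (rule finite_range_mod[OF \<pi>])
  have "\<exists>m>0. \<pi> dvd b ^ (CARD('p) ^ m) - b" for b
  proof -
    have "\<not> inj (\<lambda>i :: nat. b ^ (CARD('p) ^ i) mod \<pi>)"
    proof
      assume "inj (\<lambda>i :: nat. b ^ (CARD('p) ^ i) mod \<pi>)"
      moreover have "range (\<lambda>i :: nat. b ^ (CARD('p) ^ i) mod \<pi>) \<subseteq> S" by (auto simp: S_def)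
      ultimately show False using S by (meson finite_subset infinite_UNIV_nat finite_imageD)
    qed
    then obtain i j :: nat where ij: "i < j" "b ^ (CARD('p) ^ i) mod \<pi> = b ^ (CARD('p) ^ j) mod \<pi>"
      unfolding inj_def by (metis linorder_neqE_nat)
    then have "\<pi> dvd b ^ (CARD('p) ^ j) - b ^ (CARD('p) ^ i)" by (metis mod_eq_dvd_iff)
    moreover have "b ^ (CARD('p) ^ j) = (b ^ (CARD('p) ^ (j - i))) ^ (CARD('p) ^ i)"
      using ij(1) by (simp flip: power_mult power_add)
    ultimately have "\<pi> dvd b ^ (CARD('p) ^ (j - i)) - b"
      using irreducible_dvd_power_char_diff[OF \<pi>] by metis
    then show ?thesis using ij(1) by (intro exI[of _ "j - i"]) auto
  qed
  then obtain m where m: "\<And>b. m b > 0" "\<And>b. \<pi> dvd b ^ (CARD('p) ^ m b) - b" by metis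
  define M where "M = (\<Prod>s\<in>S. m s)"
  have "M > 0" unfolding M_def using m(1) by (intro prod_pos) auto
  moreover have "\<pi> dvd b ^ (CARD('p) ^ M) - b" for b
  proof -
    define s where "s = b mod \<pi>"
    have "m s dvd M" unfolding M_def using S by (intro dvd_prodI) (auto simp: s_def S_def)
    then obtain k where k: "M = m s * k" by (elim dvdE)
    have "\<pi> dvd s ^ (CARD('p) ^ M) - s"
      using power_iterate_dvd[OF m(2)[of s], of k] by (simp add: k power_mult)
    moreover have "(s ^ (CARD('p) ^ M)) mod \<pi> = (b ^ (CARD('p) ^ M)) mod \<pi>" by (simp add: s_def power_mod)
    ultimately have "b ^ (CARD('p) ^ M) mod \<pi> = s mod \<pi>" by (metis mod_eq_dvd_iff)
    then show ?thesis by (simp add: s_def flip: mod_eq_dvd_iff)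
  qed
  ultimately show ?thesis by (rule that)
qed

section \<open>Reduction of Artin-Schreier generators\<close>

definition artin_schreier :: "'a::comm_ring_1 \<Rightarrow> 'a" where
  "artin_schreier x = x ^ CHAR('a) - x"

lemma artin_schreier_add:
  assumes "prime CHAR('a::comm_ring_1)"
  shows "artin_schreier (x + y :: 'a) = artin_schreier x + artin_schreier y"
  using power_char_add[OF assms, of x y 1] by (simp add: artin_schreier_def)

lemma artin_schreier_uminus:
  assumes "prime CHAR('a::comm_ring_1)"
  shows "artin_schreier (- x :: 'a) = - artin_schreier x"
  using power_char_uminus[OF assms, of x 1] by (simp add: artin_schreier_def)

lemma artin_schreier_diff:
  assumes "prime CHAR('a::comm_ring_1)"
  shows "artin_schreier (x - y :: 'a) = artin_schreier x - artin_schreier y"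
  using artin_schreier_add[OF assms, of x "- y"] artin_schreier_uminus[OF assms, of y] by simp

text \<open>The poles that force ramification: no subtraction of \<open>artin_schreier h\<close>
  lowers a pole of order prime to \<open>p\<close>.\<close>

definition reduced_pole :: "'p::prime_card ratfun \<Rightarrow> bool" where
  "reduced_pole g \<longleftrightarrow>
     (\<exists>v. place_on UNIV v \<and> g \<noteq> 0 \<and> v g < 0 \<and> \<not> int CARD('p) dvd v g)"

text \<open>Coefficients satisfy \<open>k ^ p = k\<close>, so modulo \<open>artin_schreier\<close>
  the leading term \<open>k t ^ (p l)\<close> may be replaced by \<open>k t ^ l\<close>.\<close>

lemma artin_schreier_reduce_poly:
  fixes a :: "'p::prime_card mod_ring poly"
  shows "\<exists>h. reduced_pole (to_fract a - artin_schreier h) \<or>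
    (\<exists>c. to_fract a - artin_schreier h = ratfun_const c)"
proof (induction "degree a" arbitrary: a rule: less_induct)
  case less
  let ?p = "CARD('p)"
  have p: "?p > 1" by (rule nontriv)
  have as0: "artin_schreier (0 :: 'p ratfun) = 0" using p by (simp add: artin_schreier_def CHAR_ratfun)
  show ?case
  proof (cases "degree a = 0")
    case True
    then obtain c where "a = [:c:]" by (rule degree_eq_zeroE)
    then show ?thesis using as0 by (intro exI[of _ 0]) (auto simp: ratfun_const_def)
  next
    case deg: False
    then have a0: "a \<noteq> 0" by auto
    show ?thesis
    proof (cases "?p dvd degree a")
      case False
      have "reduced_pole (to_fract a)"
        unfolding reduced_pole_def
        using place_inf_place a0 deg False by (intro exI[of _ inf_place]) (simp add: inf_place_poly)
      then show ?thesis using as0 by (intro exI[of _ 0]) simp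
    next
      case True
      then obtain l where l: "degree a = ?p * l" by (elim dvdE)
      have l0: "l > 0" "l < degree a" using l deg p by (auto intro!: Nat.gr0I)
      define k where "k = lead_coeff a"
      define b where "b = a - monom k (degree a) + monom k l"
      have "degree (a - monom k (degree a)) \<le> degree a"
        by (intro degree_diff_le) (auto simp: degree_monom_le)
      moreover have "coeff (a - monom k (degree a)) (degree a) = 0" by (simp add: k_def)
      ultimately have "degree (a - monom k (degree a)) < degree a"
        using deg by (metis le_neq_implies_less leading_coeff_0_iff degree_0)
      moreover have "degree (monom k l) < degree a" using l0 degree_monom_le le_less_trans by blast
      ultimately have "degree b < degree a" unfolding b_def by (rule degree_add_less)
      from less.hyps[OF this] obtain h where h: "reduced_pole (to_fract b - artin_schreier h) \<or>
        (\<exists>c. to_fract b - artin_schreier h = ratfun_const c)" by blast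
      have "monom k l ^ ?p = monom k (degree a)"
        using finite_field_power_card_eq_same[of k] by (simp add: monom_power l mult.commute)
      then have "artin_schreier (to_fract (monom k l)) = to_fract (monom k (degree a) - monom k l)"
        by (simp add: artin_schreier_def CHAR_ratfun flip: to_fract_power)
      then have "to_fract b = to_fract a - artin_schreier (to_fract (monom k l))"
        by (simp add: b_def)
      then have "to_fract a - artin_schreier (to_fract (monom k l) + h) = to_fract b - artin_schreier h"
        by (simp add: artin_schreier_add[OF prime_CHAR_ratfun])
      then show ?thesis using h by metis
    qed
  qed
qed

text \<open>A pole of order divisible by \<open>p\<close> is improved by subtracting the \<open>p\<close>-th root of
  the leading term of the polar part.\<close>

theorem artin_schreier_reduce:
  fixes f :: "'p::prime_card ratfun"
  shows "\<exists>h. reduced_pole (f - artin_schreier h) \<or> (\<exists>c. f - artin_schreier h = ratfun_const c)"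
proof -
  let ?p = "CARD('p)"
  have p: "?p > 1" by (rule nontriv)
  have as0: "artin_schreier (0 :: 'p ratfun) = 0" using p by (simp add: artin_schreier_def CHAR_ratfun)
  have "\<exists>h. reduced_pole (f - artin_schreier h) \<or> (\<exists>c. f - artin_schreier h = ratfun_const c)"
    if "f = to_fract a / to_fract b" "b \<noteq> 0" "coprime a b" for a b
    using that
  proof (induction "degree b" arbitrary: a b f rule: less_induct)
    case less
    show ?case
    proof (cases "degree b = 0")
      case True
      then obtain c where c: "b = [:c:]" by (rule degree_eq_zeroE)
      then have "a = smult (inverse c) a * b" using less.prems(2) by simp
      then have "f = to_fract (smult (inverse c) a)"
        using less.prems by (metis nonzero_eq_divide_eq to_fract_eq_0_iff to_fract_mult)
      then show ?thesis using artin_schreier_reduce_poly by metis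
    next
      case False
      then obtain \<pi> where \<pi>: "irreducible \<pi>" "\<pi> dvd b"
        using less.prems(2) prime_divisor_exists[of b] prime_elem_imp_irreducible prime_imp_prime_elem
        by (metis is_unit_iff_degree)
      have nu: "\<not> is_unit \<pi>" "\<pi> \<noteq> 0" using \<pi>(1) by auto
      define m where "m = multiplicity \<pi> b"
      obtain b' where b': "b = \<pi> ^ m * b'" "\<not> \<pi> dvd b'"
        unfolding m_def by (rule multiplicity_decompose'[OF less.prems(2) nu(1)])
      have m: "m > 0" unfolding m_def using \<pi>(2) less.prems(2) nu by (simp add: multiplicity_gt_zero_iff)
      have na: "\<not> \<pi> dvd a" using less.prems(3) \<pi>(2) nu(1) coprime_common_divisor by blast
      then have a0: "a \<noteq> 0" by auto
      have b'0: "b' \<noteq> 0" using b'(2) by auto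
      show ?thesis
      proof (cases "?p dvd m")
        case False
        have "fin_place \<pi> f = - int m"
          using fin_place_eq[OF \<pi>(1) a0 less.prems(2)] na less.prems(1)
          by (simp add: m_def not_dvd_imp_multiplicity_0)
        then have "reduced_pole f" unfolding reduced_pole_def
          using place_fin_place[OF \<pi>(1)] m False a0 less.prems by (intro exI[of _ "fin_place \<pi>"]) auto
        then show ?thesis using as0 by (intro exI[of _ 0]) simp
      next
        case True
        then obtain l where l: "m = ?p * l" by (elim dvdE)
        have l0: "l < m" using l m p by auto
        obtain r where "\<pi> dvd a - r ^ ?p * b'"
          by (rule exists_frobenius_root_mod[OF \<pi>(1) b'(2)])
        then obtain s where s: "a - r ^ ?p * b' = \<pi> * s" by (elim dvdE)
        \<comment> \<open>The denominator of \<open>f - h ^ p\<close> loses a factor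
          \<open>\<pi>\<close>, and \<open>h\<close> itself fits over
          \<open>d = \<pi> ^ (m - 1) * b'\<close> because \<open>l \<le> m - 1\<close>.\<close>
        define h where "h = to_fract r / to_fract (\<pi> ^ l)"
        define d where "d = \<pi> ^ (m - 1) * b'"
        define c where "c = s + r * \<pi> ^ (m - 1 - l) * b'"
        have d0: "d \<noteq> 0" using nu b'0 by (simp add: d_def)
        have F: "to_fract \<pi> \<noteq> 0" "to_fract b' \<noteq> 0" using nu b'0 by auto
        have 1: "f - h ^ ?p = to_fract s / to_fract d"
        proof -
          have hp: "h ^ ?p = to_fract (r ^ ?p) / to_fract \<pi> ^ m"
            by (simp add: h_def power_divide to_fract_power l mult.commute flip: power_mult)
          have "f - h ^ ?p = to_fract (a - r ^ ?p * b') / (to_fract \<pi> ^ m * to_fract b')"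
            using F by (simp add: hp less.prems(1) b'(1) to_fract_power field_simps)
          also have "\<dots> = to_fract s / (to_fract \<pi> ^ (m - 1) * to_fract b')"
            using F m unfolding s by (cases m) auto
          finally show ?thesis by (simp add: d_def to_fract_power)
        qed
        have 2: "h = to_fract (r * \<pi> ^ (m - 1 - l) * b') / to_fract d"
        proof -
          have "\<pi> ^ (m - 1) = \<pi> ^ (m - 1 - l) * \<pi> ^ l" using l0 by (simp flip: power_add)
          then show ?thesis using F by (simp add: h_def d_def to_fract_power)
        qed
        have fh: "f - artin_schreier h = to_fract c / to_fract d"
          using 1 2 by (simp add: artin_schreier_def CHAR_ratfun c_def add_divide_distrib algebra_simps)
        \<comment> \<open>The fraction \<open>c / d\<close> may be reducible; its reduced
          denominator divides \<open>d\<close>, so the degree still drops.\<close>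
        obtain a2 b2 where ab2: "f - artin_schreier h = to_fract a2 / to_fract b2" "b2 \<noteq> 0" "coprime a2 b2"
          by (rule ratfun_cases[of "f - artin_schreier h"])
        have "to_fract (c * b2) = to_fract (a2 * d)"
          using fh ab2 d0 by (simp add: field_simps)
        then have "c * b2 = a2 * d" by (simp only: to_fract_eq_iff)
        then have "b2 dvd a2 * d" by (metis dvd_triv_right)
        then have "b2 dvd d" using ab2(3) by (metis coprime_commute coprime_dvd_mult_right_iff)
        then have "degree b2 \<le> degree d" using d0 by (rule dvd_imp_degree_le)
        also have "degree d < degree b"
        proof -
          have "b = \<pi> * d" using m by (cases m) (auto simp: b'(1) d_def)
          then have "degree b = degree \<pi> + degree d" using nu d0 by (simp add: degree_mult_eq)
          moreover have "degree \<pi> > 0" using nu by (auto intro!: Nat.gr0I simp: is_unit_iff_degree)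
          ultimately show ?thesis by simp
        qed
        finally obtain h' where h': "reduced_pole (f - artin_schreier h - artin_schreier h') \<or>
            (\<exists>c. f - artin_schreier h - artin_schreier h' = ratfun_const c)"
          using less.hyps[OF _ ab2] by blast
        have "f - artin_schreier (h + h') = f - artin_schreier h - artin_schreier h'"
          by (simp add: artin_schreier_add[OF prime_CHAR_ratfun])
        then show ?thesis using h' by metis
      qed
    qed
  qed
  then show ?thesis by (metis ratfun_cases)
qed

text \<open>A pole of \<open>f\<close> must be a pole of \<open>h\<close>, where
  \<open>h ^ p\<close> dominates both \<open>h\<close> and \<open>j\<close>, so
  \<open>v f = p * v h\<close>.\<close>

lemma artin_schreier_pole_dvd:
  fixes v :: "'p::prime_card ratfun \<Rightarrow> int"
  assumes v: "place_on UNIV v" and f: "f = artin_schreier h + j" and j: "j = 0 \<or> v j = 0"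
    and neg: "f \<noteq> 0" "v f < 0"
  shows "int CARD('p) dvd v f"
proof -
  have p: "CARD('p) > 1" by (rule nontriv)
  define R where "R = {x. x = 0 \<or> v x \<ge> 0}"
  have R: "subring_set R" unfolding R_def by (rule subring_place_ring[OF v])
  have jR: "j \<in> R" using j by (auto simp: R_def)
  have "h \<notin> R"
  proof
    assume "h \<in> R"
    then have "f \<in> R" unfolding f artin_schreier_def
      by (intro subring_set_add[OF R] subring_set_diff[OF R] subring_set_power[OF R] jR)
    then show False using neg by (simp add: R_def)
  qed
  then have h: "h \<noteq> 0" "v h < 0" by (auto simp: R_def)
  have vp: "v (h ^ CARD('p)) = int CARD('p) * v h" by (rule place_UNIV_power[OF v h(1)])
  have lt: "int CARD('p) * v h < v h" using p h(2) by (simp add: mult_less_cancel_right1)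
  have f': "f = h ^ CARD('p) + (j - h)" by (simp add: f artin_schreier_def CHAR_ratfun)
  have "v f = int CARD('p) * v h"
  proof (cases "j = h")
    case True
    then show ?thesis using f' vp by simp
  next
    case False
    have "v (j - h) = v h"
    proof (cases "j = 0")
      case True
      then show ?thesis using place_UNIV_minus[OF v h(1)] by simp
    next
      case False
      then have "v (- h) < v j" using j h place_UNIV_minus[OF v h(1)] by simp
      then have "v (- h + j) = v (- h)" by (intro place_add_eq(2)[OF v]) (use h(1) \<open>j \<noteq> 0\<close> in auto)
      moreover have "- h + j = j - h" by simp
      ultimately show ?thesis using place_UNIV_minus[OF v h(1)] by metis
    qed
    then show ?thesis
      using place_add_eq(2)[OF v, of "h ^ CARD('p)" "j - h"] False h(1) vp lt f' by simp
  qed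
  then show ?thesis by simp
qed

lemma val_artin_schreier:
  fixes F :: "'a::field set"
  assumes F: "subfield_set F" and v: "valuation_on F v"
    and y: "y \<in> F" and neg: "artin_schreier y \<noteq> 0" "v (artin_schreier y) < 0" and p: "CHAR('a) > 1"
  shows "y \<noteq> 0" "v y < 0" "v (artin_schreier y) = int CHAR('a) * v y"
proof -
  note Fr = subfield_set_imp_subring_set[OF F]
  note R = subring_val_ring[OF F v]
  have yR: "y \<notin> {x \<in> F. x = 0 \<or> v x \<ge> 0}"
  proof
    assume y: "y \<in> {x \<in> F. x = 0 \<or> v x \<ge> 0}"
    have "artin_schreier y \<in> {x \<in> F. x = 0 \<or> v x \<ge> 0}"
      unfolding artin_schreier_def by (intro subring_set_diff[OF R] subring_set_power[OF R] y)
    then show False using neg by simp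
  qed
  then show y0: "y \<noteq> 0" "v y < 0" using y by auto
  have vp: "v (y ^ CHAR('a)) = int CHAR('a) * v y" by (rule val_power[OF F v y y0(1)])
  have "int CHAR('a) * v y < v y" using p y0(2) by (simp add: mult_less_cancel_right1)
  then have "v (y ^ CHAR('a) + - y) = v (y ^ CHAR('a))"
    by (intro val_add_eq[OF F v]) (use y y0 vp val_minus[OF F v y] in \<open>auto intro!: subring_set_closed[OF Fr]\<close>)
  then show "v (artin_schreier y) = int CHAR('a) * v y" using vp by (simp add: artin_schreier_def)
qed

section \<open>Ramification of geometric extensions\<close>

text \<open>The linear functional sending \<open>T ^ i\<close> to \<open>s i\<close>. With
  \<open>s i\<close> the iterates of \<open>\<sigma>\<close> at a point it evaluates a polynomial in
  the operator \<open>\<sigma>\<close>, so identities between polynomials become identities between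
  operators.\<close>

definition seq_eval :: "'a::comm_ring_1 poly \<Rightarrow> (nat \<Rightarrow> 'a) \<Rightarrow> 'a" where
  "seq_eval P s = (\<Sum>i\<le>degree P. coeff P i * s i)"

lemma seq_eval_bound: "degree P \<le> N \<Longrightarrow> seq_eval P s = (\<Sum>i\<le>N. coeff P i * s i)"
  unfolding seq_eval_def by (intro sum.mono_neutral_left) (auto simp: coeff_eq_0)

lemma seq_eval_diff: "seq_eval (P - Q) s = seq_eval P s - seq_eval Q s"
proof -
  define N where "N = max (degree P) (degree Q)"
  have N: "degree P \<le> N" "degree Q \<le> N" "degree (P - Q) \<le> N"
    using degree_diff_le_max[of P Q] by (auto simp: N_def)
  show ?thesis by (simp add: N[THEN seq_eval_bound] sum_subtractf algebra_simps)
qed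

lemma seq_eval_pCons_0: "seq_eval (pCons 0 P) s = seq_eval P (\<lambda>i. s (Suc i))"
proof -
  have "degree (pCons 0 P) \<le> Suc (degree P)" by (simp add: degree_pCons_le)
  then have "seq_eval (pCons 0 P) s = (\<Sum>i\<le>Suc (degree P). coeff (pCons 0 P) i * s i)" by (rule seq_eval_bound)
  also have "\<dots> = seq_eval P (\<lambda>i. s (Suc i))"
    unfolding seq_eval_def by (subst sum.atMost_Suc_shift) simp
  finally show ?thesis .
qed

text \<open>In characteristic \<open>p\<close>, \<open>(\<sigma> - 1) ^ q = \<sigma> ^ q - 1\<close> for a power \<open>q\<close> of \<open>p\<close>,
  read off from the polynomial identity \<open>(T - 1) ^ q = T ^ q - 1\<close>.\<close>

lemma difference_operator_nilpotent:
  fixes \<sigma> :: "'a::comm_ring_1 \<Rightarrow> 'a"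
  assumes diff: "\<And>x y. x \<in> V \<Longrightarrow> y \<in> V \<Longrightarrow> \<sigma> (x - y) = \<sigma> x - \<sigma> y"
    and closed: "\<And>x y. x \<in> V \<Longrightarrow> y \<in> V \<Longrightarrow> x - y \<in> V" "\<And>x. x \<in> V \<Longrightarrow> \<sigma> x \<in> V"
    and p: "prime CHAR('a)" and period: "\<And>x. x \<in> V \<Longrightarrow> (\<sigma> ^^ (CHAR('a) ^ k)) x = x"
    and x: "x \<in> V"
  shows "((\<lambda>x. \<sigma> x - x) ^^ (CHAR('a) ^ k)) x = 0"
proof -
  define \<delta> where "\<delta> x = \<sigma> x - x" for x
  have pow_closed: "(\<sigma> ^^ i) x \<in> V" if "x \<in> V" for i x
    by (induction i) (use that closed in auto)
  have pow_diff: "(\<sigma> ^^ i) (x - y) = (\<sigma> ^^ i) x - (\<sigma> ^^ i) y" if "x \<in> V" "y \<in> V" for i x y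
    by (induction i) (use that diff pow_closed in auto)
  have formula: "(\<delta> ^^ n) x = seq_eval ([:- 1, 1:] ^ n) (\<lambda>i. (\<sigma> ^^ i) x)" if "x \<in> V" for n x
    using that
  proof (induction n arbitrary: x)
    case 0
    then show ?case by (simp add: seq_eval_def)
  next
    case (Suc n)
    have \<delta>x: "\<delta> x \<in> V" using Suc.prems closed by (auto simp: \<delta>_def)
    have "(\<delta> ^^ Suc n) x = (\<delta> ^^ n) (\<delta> x)" by (simp add: funpow_swap1)
    also have "\<dots> = seq_eval ([:- 1, 1:] ^ n) (\<lambda>i. (\<sigma> ^^ i) (\<delta> x))" by (rule Suc.IH[OF \<delta>x])
    also have "(\<lambda>i. (\<sigma> ^^ i) (\<delta> x)) = (\<lambda>i. (\<sigma> ^^ Suc i) x - (\<sigma> ^^ i) x)"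
      using Suc.prems closed by (auto simp: \<delta>_def pow_diff funpow_swap1)
    also have "seq_eval ([:- 1, 1:] ^ n) \<dots> = seq_eval (pCons 0 ([:- 1, 1:] ^ n) - [:- 1, 1:] ^ n) (\<lambda>i. (\<sigma> ^^ i) x)"
      by (simp add: seq_eval_diff seq_eval_pCons_0) (simp add: seq_eval_def sum_subtractf algebra_simps)
    also have "pCons 0 ([:- 1, 1:] ^ n) - [:- 1, 1:] ^ n = [:- 1, 1 :: 'a:] ^ Suc n" by simp
    finally show ?case .
  qed
  define q where "q = CHAR('a) ^ k"
  have T: "[:- 1, 1 :: 'a:] = monom 1 1 - 1" by (simp add: monom_altdef one_pCons)
  have "[:- 1, 1 :: 'a:] ^ q = monom 1 q - monom 1 0"
    using power_char_diff[of "monom 1 1 :: 'a poly" 1 k] p unfolding T q_def by (simp add: monom_power)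
  then have "(\<delta> ^^ q) x = seq_eval (monom 1 q) (\<lambda>i. (\<sigma> ^^ i) x) - seq_eval (monom 1 0) (\<lambda>i. (\<sigma> ^^ i) x)"
    by (simp add: formula[OF x] seq_eval_diff)
  also have "\<dots> = (\<sigma> ^^ q) x - x"
  proof -
    have "seq_eval (monom 1 n) (\<lambda>i. (\<sigma> ^^ i) x) = (\<sigma> ^^ n) x" for n
    proof -
      have "seq_eval (monom 1 n) (\<lambda>i. (\<sigma> ^^ i) x) = (\<Sum>i\<le>n. if i = n then (\<sigma> ^^ i) x else 0)"
        unfolding seq_eval_bound[OF degree_monom_le] by (intro sum.cong) auto
      then show ?thesis by simp
    qed
    from this[of q] this[of 0] show ?thesis by simp
  qed
  finally show ?thesis using period[OF x] by (simp add: q_def \<delta>_def[abs_def])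
qed

lemma (in galois_data) act_funpow:
  assumes "g \<in> carrier G" "x \<in> L"
  shows "(\<rho> g ^^ i) x = \<rho> (g [^]\<^bsub>G\<^esub> i) x"
proof (induction i)
  case 0
  then show ?case using act_one assms by simp
next
  case (Suc i)
  interpret G: group G by (rule G)
  have "g [^]\<^bsub>G\<^esub> Suc i = g \<otimes>\<^bsub>G\<^esub> g [^]\<^bsub>G\<^esub> i" using assms G.nat_pow_Suc2 by blast
  then show ?case using Suc act_mult[of g "g [^]\<^bsub>G\<^esub> i" x] assms by simp
qed

text \<open>A maximal set of automorphisms with a nontrivial fixed field reduces the construction to a
  single automorphism \<open>\<tau>\<close>, on which \<open>\<tau> - 1\<close> is nilpotent.\<close>

theorem (in galois_data) exists_artin_schreier_element:
  assumes comm: "comm_group G" and p: "prime CHAR('a)"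
    and exponent: "\<And>g. g \<in> carrier G \<Longrightarrow> g [^]\<^bsub>G\<^esub> (CHAR('a) ^ n) = \<one>\<^bsub>G\<^esub>"
    and nontriv: "L \<noteq> K"
  shows "\<exists>y\<in>L. y \<notin> K \<and> artin_schreier y \<in> K"
proof -
  interpret G: comm_group G by (rule comm)
  note Lr = subfield_set_imp_subring_set[OF L]
  define Fam where "Fam = {S. S \<subseteq> carrier G \<and> (\<exists>x\<in>L - K. \<forall>g\<in>S. \<rho> g x = x)}"
  have finFam: "finite Fam" using fin_G by (simp add: Fam_def)
  have "{} \<in> Fam" using nontriv K_L by (auto simp: Fam_def)
  with finFam have "Max (card ` Fam) \<in> card ` Fam" by (intro Max_in) auto
  then obtain S where "S \<in> Fam" "card S = Max (card ` Fam)" by force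
  then have S: "S \<in> Fam" "\<And>T. T \<in> Fam \<Longrightarrow> card T \<le> card S" using finFam by auto
  have SG: "S \<subseteq> carrier G" "finite S" using S(1) fin_G finite_subset by (auto simp: Fam_def)
  define M where "M = {x \<in> L. \<forall>g\<in>S. \<rho> g x = x}"
  obtain x where x: "x \<in> M" "x \<notin> K" using S(1) by (auto simp: Fam_def M_def)
  then obtain g where g: "g \<in> carrier G" "\<rho> g x \<noteq> x" using act_fixed[of x] by (auto simp: M_def)
  have gS: "g \<notin> S" using g x by (auto simp: M_def)
  have fixK: "y \<in> K" if "y \<in> M" "\<rho> g y = y" for y
  proof (rule ccontr)
    assume "y \<notin> K"
    then have "insert g S \<in> Fam" using that g SG by (auto simp: Fam_def M_def)
    then have "card (insert g S) \<le> card S" by (rule S(2))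
    then show False using gS SG by simp
  qed
  interpret g: hom_on L "\<rho> g" by (rule act_hom[OF g(1)])
  have M_L: "M \<subseteq> L" by (auto simp: M_def)
  have M_diff: "a - b \<in> M" if "a \<in> M" "b \<in> M" for a b
    using that SG subring_set_diff[OF Lr] hom_on.hom_diff[OF act_hom] by (auto simp: M_def)
  \<comment> \<open>Commutativity of \<open>G\<close> is what keeps \<open>M\<close> stable under
    \<open>g\<close>.\<close>
  have M_act: "\<rho> g a \<in> M" if a: "a \<in> M" for a
  proof -
    have "\<rho> h (\<rho> g a) = \<rho> g a" if h: "h \<in> S" for h
    proof -
      have "\<rho> h (\<rho> g a) = \<rho> (g \<otimes>\<^bsub>G\<^esub> h) a"
        using act_mult[of h g a] h SG g(1) a M_L by (metis G.m_comm subsetD)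
      also have "\<dots> = \<rho> g (\<rho> h a)" using act_mult[of g h a] h SG g(1) a M_L by blast
      finally show ?thesis using a h by (simp add: M_def)
    qed
    then show ?thesis using a act_closed[OF g(1)] by (auto simp: M_def)
  qed
  define \<delta> where "\<delta> = (\<lambda>x. \<rho> g x - x)"
  have "(\<delta> ^^ (CHAR('a) ^ n)) x = 0"
    unfolding \<delta>_def
  proof (rule difference_operator_nilpotent[where V = M])
    show "\<rho> g (a - b) = \<rho> g a - \<rho> g b" if "a \<in> M" "b \<in> M" for a b
      using that M_L g.hom_diff by blast
    show "(\<rho> g ^^ (CHAR('a) ^ n)) a = a" if "a \<in> M" for a
      using act_funpow[OF g(1), of a] exponent[OF g(1)] act_one that M_L by (metis subsetD)
  qed (use M_diff M_act p x in auto)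
  then have ex: "\<exists>k. (\<delta> ^^ k) x \<in> K" using subring_set_0[OF subfield_set_imp_subring_set[OF K]] by metis
  \<comment> \<open>The last iterate outside \<open>K\<close> is moved by \<open>g\<close> by a
    nonzero element \<open>c\<close> of \<open>K\<close>. Rescaling by \<open>c\<close> makes the
    displacement 1, and if \<open>g y = y + 1\<close>, then \<open>g\<close> fixes
    \<open>y ^ p - y\<close>.\<close>
  define k where "k = (LEAST k. (\<delta> ^^ k) x \<in> K)"
  have k: "(\<delta> ^^ k) x \<in> K" unfolding k_def using ex by (rule LeastI_ex)
  have "k \<noteq> 0" using k x(2) by (metis funpow_0)
  then obtain j where j: "k = Suc j" by (cases k) auto
  define z where "z = (\<delta> ^^ j) x"
  have zK: "z \<notin> K" unfolding z_def using not_less_Least[of j "\<lambda>k. (\<delta> ^^ k) x \<in> K"] j by (simp add: k_def)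
  have zM: "z \<in> M" unfolding z_def
    by (induction j) (use x M_diff M_act in \<open>auto simp: \<delta>_def\<close>)
  define c where "c = \<delta> z"
  have c: "c \<in> K" using k by (simp add: c_def z_def j)
  have \<rho>z: "\<rho> g z = z + c" by (simp add: c_def \<delta>_def)
  have c0: "c \<noteq> 0" using fixK[OF zM] zK \<rho>z by auto
  define y where "y = inverse c * z"
  have icK: "inverse c \<in> K" by (rule subfield_set_inverse[OF K c])
  then have icL: "inverse c \<in> L" using K_L by blast
  have zL: "z \<in> L" using zM M_L by blast
  have yL: "y \<in> L" unfolding y_def by (rule subring_set_mult[OF Lr icL zL])
  have yM: "y \<in> M"
  proof -
    have "\<rho> h y = y" if h: "h \<in> S" for h
    proof -
      have hG: "h \<in> carrier G" using h SG by blast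
      show ?thesis unfolding y_def
        using hom_on.hom_mult[OF act_hom[OF hG] icL zL] act_K[OF hG icK] zM h by (simp add: M_def)
    qed
    then show ?thesis using yL by (simp add: M_def)
  qed
  have \<rho>y: "\<rho> g y = y + 1"
    using g.hom_mult[OF icL zL] act_K[OF g(1) icK] c0 by (simp add: y_def \<rho>z field_simps)
  have "y \<notin> K"
  proof
    assume "y \<in> K"
    then have "c * y \<in> K" using c subring_set_mult[OF subfield_set_imp_subring_set[OF K]] by blast
    then show False using zK c0 by (simp add: y_def flip: mult.assoc)
  qed
  moreover have "artin_schreier y \<in> K"
  proof (rule fixK)
    have "\<rho> h (artin_schreier y) = artin_schreier (\<rho> h y)" if "h \<in> carrier G" for h
    proof -
      interpret h: hom_on L "\<rho> h" by (rule act_hom[OF that])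
      show ?thesis unfolding artin_schreier_def
        by (simp add: h.hom_diff h.hom_power yL subring_set_power[OF Lr])
    qed
    note as = this
    have "artin_schreier y \<in> L" unfolding artin_schreier_def
      by (intro subring_set_diff[OF Lr] subring_set_power[OF Lr] yL)
    then show "artin_schreier y \<in> M" using as yM SG by (auto simp: M_def)
    show "\<rho> g (artin_schreier y) = artin_schreier y"
      using as[OF g(1)] p by (simp add: \<rho>y artin_schreier_add artin_schreier_def[of 1])
  qed
  ultimately show ?thesis using yL by blast
qed

section \<open>A ramified place in every geometric realization\<close>

lemma infinite_ratfun: "infinite (UNIV :: 'p::prime_card ratfun set)"
proof
  assume "finite (UNIV :: 'p ratfun set)"
  then have "finite (range (\<lambda>n. to_fract (monom 1 n) :: 'p ratfun))" by (rule finite_subset[OF subset_UNIV])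
  moreover have "inj (\<lambda>n. to_fract (monom 1 n) :: 'p ratfun)"
    by (auto intro!: injI simp: monom_eq_iff')
  ultimately show False using finite_imageD infinite_UNIV_nat by blast
qed

lemma CHAR_ratfun_ac: "CHAR('p::prime_card ratfun alg_closure) = CARD('p)"
  by (simp add: CHAR_ratfun)

lemma prime_CHAR_ratfun_ac: "prime CHAR('p::prime_card ratfun alg_closure)"
  by (simp only: CHAR_ratfun_ac prime_card)

lemma to_ac_artin_schreier: "to_ac (artin_schreier x) = artin_schreier (to_ac x)"
  by (simp add: artin_schreier_def)

text \<open>Shows that a realization of a nontrivial group is larger than the base field.\<close>

lemma galois_group_base_trivial:
  assumes "L = range to_ac" "\<sigma> \<in> carrier (galois_group L)" "\<tau> \<in> carrier (galois_group L)"
  shows "\<sigma> = \<tau>"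
proof -
  have "subring_set L" using subfield_range_to_ac assms(1) by blast
  then have "\<sigma> \<in> extensional L" "\<tau> \<in> extensional L" "\<And>c. \<sigma> (to_ac c) = \<tau> (to_ac c)"
    using assms(2,3) by (auto simp: galois_group_carrier_iff)
  then show ?thesis using assms(1) by (intro extensionalityI[of \<sigma> L \<tau>]) auto
qed

theorem exists_ramified_place:
  fixes L :: "'p::prime_card ratfun alg_closure set" and G :: "('g, 'm) monoid_scheme"
  assumes GG: "comm_group G" "finite (carrier G)" "carrier G \<noteq> {\<one>\<^bsub>G\<^esub>}"
    and ord: "Coset.order G = CARD('p) ^ n"
    and real: "geometric_galois_realization G L"
  shows "ramified_places L \<noteq> {}"
proof -
  let ?K = "range (to_ac :: 'p ratfun \<Rightarrow> _)"
  interpret G: comm_group G by (rule GG)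
  have gal: "galois_extension L" and geo: "geometric_extension L" and iso: "galois_group L \<cong> G"
    using real by (auto simp: geometric_galois_realization_def)
  obtain \<rho> where "galois_data_ac G \<rho> L"
    by (rule galois_extension_data[OF infinite_ratfun gal iso G.group_axioms GG(2)])
  then interpret galois_data_ac G \<rho> L .
  note Lr = subfield_set_imp_subring_set[OF L]
  have exponent: "g [^]\<^bsub>G\<^esub> (CHAR('p ratfun alg_closure) ^ n) = \<one>\<^bsub>G\<^esub>" if "g \<in> carrier G" for g
    using G.pow_order_eq_1[OF that] ord by (simp only: CHAR_ratfun_ac)
  have "L \<noteq> ?K"
  proof
    assume LK: "L = ?K"
    obtain \<phi> where \<phi>: "bij_betw \<phi> (carrier (galois_group L)) (carrier G)"
      using iso by (auto simp: is_iso_def iso_def)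
    have im: "\<phi> ` carrier (galois_group L) = carrier G" using \<phi> by (rule bij_betw_imp_surj_on)
    have "g = \<one>\<^bsub>G\<^esub>" if g: "g \<in> carrier G" for g
    proof -
      obtain \<sigma> where \<sigma>: "\<sigma> \<in> carrier (galois_group L)" "g = \<phi> \<sigma>" using g im by blast
      obtain \<tau> where \<tau>: "\<tau> \<in> carrier (galois_group L)" "\<one>\<^bsub>G\<^esub> = \<phi> \<tau>" using G.one_closed im by blast
      show ?thesis using galois_group_base_trivial[OF LK \<sigma>(1) \<tau>(1)] \<sigma> \<tau> by simp
    qed
    then show False using GG(3) G.one_closed by blast
  qed
  then obtain y0 where y0: "y0 \<in> L" "y0 \<notin> ?K" "artin_schreier y0 \<in> ?K"
    using exists_artin_schreier_element[OF GG(1) prime_CHAR_ratfun_ac exponent] by blast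
  then obtain f where f: "artin_schreier y0 = to_ac f" by auto
  obtain h where h: "reduced_pole (f - artin_schreier h) \<or> (\<exists>c. f - artin_schreier h = ratfun_const c)"
    using artin_schreier_reduce[of f] by blast
  define y where "y = y0 - to_ac h"
  define g where "g = f - artin_schreier h"
  have yL: "y \<in> L" unfolding y_def using y0 K_L by (intro subring_set_diff[OF Lr]) auto
  have yK: "y \<notin> ?K"
  proof
    assume "y \<in> ?K"
    then obtain c where "y = to_ac c" by auto
    then have "y0 = to_ac (c + h)" by (simp add: y_def diff_eq_eq)
    then have "y0 \<in> ?K" by (rule range_eqI)
    then show False using y0(2) by contradiction
  qed
  have yg: "artin_schreier y = to_ac g"
    by (simp add: y_def g_def f artin_schreier_diff[OF prime_CHAR_ratfun_ac] to_ac_artin_schreier)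
  have "reduced_pole g"
  proof (rule ccontr)
    assume "\<not> reduced_pole g"
    then obtain c where c: "g = ratfun_const c" using h by (auto simp: g_def)
    \<comment> \<open>With a constant right hand side, \<open>y\<close> would be a root of
      \<open>X ^ p - X - c\<close> over the prime field, hence a constant, since \<open>L\<close> is
      geometric.\<close>
    define P :: "'p mod_ring poly" where "P = monom 1 CARD('p) - [:c, 1:]"
    have p1: "CARD('p) > 1" by (rule nontriv)
    have "coeff P CARD('p) = 1" using p1 by (auto simp: P_def coeff_pCons split: nat.split)
    then have P0: "P \<noteq> 0" by auto
    have hom: "to_ac (ratfun_const (a + b)) = to_ac (ratfun_const a) + to_ac (ratfun_const b)"
      "to_ac (ratfun_const (a - b)) = to_ac (ratfun_const a) - to_ac (ratfun_const b)" for a b :: "'p mod_ring"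
      by (simp_all add: ratfun_const_def flip: to_fract_add to_fract_diff to_ac_add to_ac_diff)
    have hom0: "to_ac (ratfun_const (0 :: 'p mod_ring)) = 0" "to_ac (ratfun_const (1 :: 'p mod_ring)) = 1"
      by (simp_all add: ratfun_const_def flip: one_pCons)
    have "map_poly (\<lambda>c. to_ac (ratfun_const c)) P = monom 1 CARD('p) - [:to_ac g, 1:]"
      by (rule poly_eqI) (auto simp: coeff_map_poly hom0 P_def hom c coeff_pCons split: nat.split)
    then have "poly (map_poly (\<lambda>c. to_ac (ratfun_const c)) P) y = artin_schreier y - to_ac g"
      by (simp add: poly_monom artin_schreier_def CHAR_ratfun_ac[unfolded CHAR_alg_closure])
    then have "y \<in> range (\<lambda>c. to_ac (ratfun_const c))"
      using geo P0 yL yg unfolding geometric_extension_def by auto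
    then show False using yK by auto
  qed
  then obtain v where v: "place_on UNIV v" "g \<noteq> 0" "v g < 0" "\<not> int CARD('p) dvd v g"
    by (auto simp: reduced_pole_def)
  have "\<exists>P\<in>poly_over ?K. P \<noteq> 0 \<and> degree P \<le> card (carrier G) \<and> poly P x = 0" if "x \<in> L" for x
    using orbit_poly_over[OF that] orbit_poly_nz[of x] degree_orbit_poly[of x]
      poly_orbit_poly[of x x] orbit_refl[OF that] by blast
  then obtain w e where w: "place_on L w" "lies_over_with_index w v e"
    using place_extension[OF v(1) L K_L] by blast
  have e: "e > 0" "w (to_ac g) = int e * v g" using w(2) v(2) by (auto simp: lies_over_with_index_def)
  have neg: "artin_schreier y \<noteq> 0" "w (artin_schreier y) < 0"
    using v e by (simp_all add: yg mult_less_0_iff)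
  have p1: "CHAR('p ratfun alg_closure) > 1" using nontriv[where 'a = 'p] by (simp only: CHAR_ratfun_ac)
  have "w (artin_schreier y) = int CARD('p) * w y"
    using val_artin_schreier(3)[OF L place_imp_valuation[OF w(1)] yL neg p1] by (simp only: CHAR_ratfun_ac)
  then have eq: "int e * v g = int CARD('p) * w y" using e yg by simp
  have "e \<noteq> 1" using eq v(4) by auto
  then have "e > 1" using e by simp
  then show ?thesis using v(1) w unfolding ramified_places_def by blast
qed

section \<open>Artin-Schreier extensions\<close>

lemma of_nat_inj_on_CHAR: "inj_on (of_nat :: nat \<Rightarrow> 'a::comm_ring_1) {..<CHAR('a)}"
proof -
  have "\<not> i < j" if "i < CHAR('a)" "j < CHAR('a)" "of_nat i = (of_nat j :: 'a)" for i j
  proof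
    assume "i < j"
    then have "of_nat (j - i) = (0 :: 'a)" using that(3) by (simp add: of_nat_diff)
    then have "CHAR('a) dvd j - i" by (simp add: of_nat_eq_0_iff_char_dvd)
    then show False using \<open>i < j\<close> that(2) by (auto dest: dvd_imp_le)
  qed
  then show ?thesis by (intro inj_onI) (metis lessThan_iff linorder_neqE_nat)
qed

lemma of_nat_power_CHAR:
  assumes "prime CHAR('a::comm_ring_1)"
  shows "(of_nat n :: 'a) ^ CHAR('a) = of_nat n"
  by (induction n)
    (use power_char_add[OF assms, of 1 _ 1] assms in \<open>auto simp: power_0_left prime_gt_0_nat\<close>)

definition as_poly :: "'a::comm_ring_1 \<Rightarrow> 'a poly" where
  "as_poly a = monom 1 CHAR('a) - [:a, 1:]"

lemma poly_as_poly: "poly (as_poly a) z = artin_schreier z - a"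
  by (simp add: as_poly_def poly_monom artin_schreier_def)

lemma as_poly_degree:
  assumes "prime CHAR('a::comm_ring_1)"
  shows "degree (as_poly (a :: 'a)) = CHAR('a)" "lead_coeff (as_poly a) = 1"
proof -
  have p: "CHAR('a) > 1" using assms by (rule prime_gt_1_nat)
  have c: "coeff (as_poly a) CHAR('a) = 1"
    using p by (auto simp: as_poly_def coeff_pCons split: nat.split)
  have "degree (as_poly a) \<le> CHAR('a)"
    unfolding as_poly_def using p by (intro degree_diff_le) (auto simp: degree_monom_le)
  then show "degree (as_poly a) = CHAR('a)" using c le_degree[of "as_poly a" "CHAR('a)"] by simp
  with c show "lead_coeff (as_poly a) = 1" by simp
qed

text \<open>Both sides are monic of degree \<open>p\<close>, so their difference has smaller degree,
  but \<open>p\<close> roots.\<close>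

lemma as_poly_prod:
  fixes y :: "'a::field"
  assumes "prime CHAR('a)"
  shows "as_poly (artin_schreier y) = (\<Prod>z\<in>(\<lambda>i. y + of_nat i) ` {..<CHAR('a)}. [:- z, 1:])"
    (is "_ = ?Q")
proof -
  define Z where "Z = (\<lambda>i. y + of_nat i) ` {..<CHAR('a)}"
  have card: "card Z = CHAR('a)" unfolding Z_def
    using of_nat_inj_on_CHAR[where 'a = 'a] by (subst card_image) (auto simp: inj_on_def)
  have finZ: "finite Z" by (simp add: Z_def)
  have deg: "degree (\<Prod>z\<in>Z. [:- z, 1:]) = CHAR('a)"
    by (subst degree_prod_eq_sum_degree) (auto simp: card)
  have lc: "lead_coeff (\<Prod>z\<in>Z. [:- z, 1:]) = 1" by (simp add: lead_coeff_prod)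
  define D where "D = as_poly (artin_schreier y) - (\<Prod>z\<in>Z. [:- z, 1:])"
  have p: "CHAR('a) > 0" using assms by (rule prime_gt_0_nat)
  have "degree D \<le> CHAR('a)" unfolding D_def
    using deg as_poly_degree[OF assms, of "artin_schreier y"] by (intro degree_diff_le) auto
  moreover have "coeff D CHAR('a) = 0"
    using lc deg as_poly_degree[OF assms, of "artin_schreier y"] by (simp add: D_def)
  ultimately have less: "degree D < CHAR('a)"
    using p by (metis degree_0 le_neq_implies_less leading_coeff_0_iff)
  have "poly D z = 0" if zZ: "z \<in> Z" for z
  proof -
    obtain i where "z = y + of_nat i" using zZ by (auto simp: Z_def)
    then have "artin_schreier z = artin_schreier y"
      using artin_schreier_add[OF assms, of y "of_nat i"] of_nat_power_CHAR[OF assms, of i]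
      by (simp add: artin_schreier_def[of "of_nat i"])
    then show ?thesis using zZ finZ by (simp add: D_def poly_as_poly poly_prod prod_zero_iff)
  qed
  then have "Z \<subseteq> {z. poly D z = 0}" by blast
  then have "D = 0"
    using card_poly_roots_bound[of D] card_mono[OF poly_roots_finite[of D], of Z] card less by force
  then show ?thesis by (simp add: D_def Z_def)
qed

lemma artin_schreier_eq_iff:
  fixes y z :: "'a::field"
  assumes "prime CHAR('a)"
  shows "artin_schreier z = artin_schreier y \<longleftrightarrow> (\<exists>i<CHAR('a). z = y + of_nat i)"
proof -
  have "artin_schreier z = artin_schreier y \<longleftrightarrow> poly (as_poly (artin_schreier y)) z = 0"
    by (simp add: poly_as_poly)
  also have "\<dots> \<longleftrightarrow> z \<in> (\<lambda>i. y + of_nat i) ` {..<CHAR('a)}"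
    unfolding as_poly_prod[OF assms] by (simp add: poly_prod prod_zero_iff)
  finally show ?thesis by auto
qed

lemma power_CHAR_fixed_iff:
  fixes z :: "'a::field"
  assumes "prime CHAR('a)"
  shows "z ^ CHAR('a) = z \<longleftrightarrow> (\<exists>i<CHAR('a). z = of_nat i)"
  using artin_schreier_eq_iff[OF assms, of z 0] prime_gt_0_nat[OF assms]
  by (simp add: artin_schreier_def power_0_left)

lemma exists_artin_schreier_root:
  fixes a :: "'a::alg_closed_field"
  assumes "prime CHAR('a)"
  obtains y where "artin_schreier y = a"
proof -
  have "degree (as_poly a) > 0"
    using as_poly_degree(1)[OF assms, of a] prime_gt_0_nat[OF assms] by simp
  then obtain y where "poly (as_poly a) y = 0" using alg_closed_imp_poly_has_root by blast
  then show ?thesis using that by (simp add: poly_as_poly)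
qed

text \<open>Both sides are polynomials in \<open>y\<close> of degree less than \<open>p\<close> that agree on the prime field.\<close>

lemma sum_shifted_powers:
  fixes y :: "'a::field"
  assumes p: "prime CHAR('a)"
  shows "(\<Sum>i<CHAR('a). (y + of_nat i) ^ (CHAR('a) - 1)) = - 1"
proof -
  let ?p = "CHAR('a)"
  have p1: "?p > 1" using p by (rule prime_gt_1_nat)
  define P :: "'a poly" where "P = (\<Sum>i<?p. [:of_nat i, 1:] ^ (?p - 1)) + 1"
  have "degree P \<le> ?p - 1" unfolding P_def
    by (intro degree_add_le degree_sum_le) (auto simp: degree_linear_power)
  then have deg: "degree P < ?p" using p1 by linarith
  have "poly P (of_nat k) = 0" if k: "k < ?p" for k
  proof -
    have *: "(of_nat i + of_nat k :: 'a) ^ (?p - 1) = (if (?p dvd i + k) then 0 else 1)" for i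
    proof (cases "?p dvd i + k")
      case True
      then have "of_nat (i + k) = (0 :: 'a)" by (simp only: of_nat_eq_0_iff_char_dvd)
      then show ?thesis using True p1 by (simp add: power_0_left)
    next
      case False
      then have nz: "of_nat (i + k) \<noteq> (0 :: 'a)" by (simp only: of_nat_eq_0_iff_char_dvd) simp
      have "(of_nat (i + k) :: 'a) ^ (?p - 1) * of_nat (i + k) = 1 * of_nat (i + k)"
        using of_nat_power_CHAR[OF p, of "i + k"] p1 by (simp flip: power_Suc2 of_nat_add)
      then have "(of_nat (i + k) :: 'a) ^ (?p - 1) = 1" by (rule mult_right_cancel[OF nz, THEN iffD1])
      then show ?thesis using False by simp
    qed
    define i0 where "i0 = (if k = 0 then 0 else ?p - k)"
    have i0: "i0 < ?p" using k p1 by (auto simp: i0_def)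
    have iff: "?p dvd i + k \<longleftrightarrow> i = i0" if i: "i < ?p" for i
    proof
      assume "?p dvd i + k"
      then obtain m where m: "i + k = ?p * m" by (elim dvdE)
      have "?p * m < ?p * 2" using m i k by linarith
      then have "m < 2" using p1 by simp
      then have "m = 0 \<or> m = 1" by linarith
      then show "i = i0" using m i k by (auto simp: i0_def)
    qed (use k in \<open>auto simp: i0_def\<close>)
    have "(\<Sum>i<?p. (of_nat i + of_nat k :: 'a) ^ (?p - 1)) = (\<Sum>i<?p. 1 - (if i = i0 then 1 else 0))"
    proof (intro sum.cong refl)
      fix i assume "i \<in> {..<?p}"
      then show "(of_nat i + of_nat k :: 'a) ^ (?p - 1) = 1 - (if i = i0 then 1 else 0)"
        using *[of i] iff[of i] by simp
    qed
    also have "\<dots> = of_nat ?p - 1" using i0 by (simp add: sum_subtractf)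
    finally show ?thesis by (simp add: P_def poly_sum add.commute)
  qed
  then have "of_nat ` {..<?p} \<subseteq> {z. poly P z = 0}" by auto
  moreover have "card ((of_nat :: nat \<Rightarrow> 'a) ` {..<?p}) = ?p"
    using card_image[OF of_nat_inj_on_CHAR] by simp
  ultimately have "P = 0"
    using card_poly_roots_bound[of P] card_mono[OF poly_roots_finite[of P], of "of_nat ` {..<?p}"] deg by force
  then have "poly P y = 0" by simp
  then show ?thesis by (simp add: P_def poly_sum add.commute eq_neg_iff_add_eq_0)
qed

lemma (in hom_on) map_poly_pCons_hom: "map_poly \<sigma> (pCons a P) = pCons (\<sigma> a) (map_poly \<sigma> P)"
  by (rule poly_eqI) (auto simp: coeff_map_poly hom_0 coeff_pCons split: nat.split)

locale artin_schreier_step =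
  fixes L :: "'a::alg_closed_field set" and y :: 'a
  assumes p: "prime CHAR('a)" and L: "subfield_set L"
    and y_notin: "y \<notin> L" and as_y: "artin_schreier y \<in> L"
begin

lemma Lr: "subring_set L"
  using L by blast

lemma as_poly_over: "a \<in> L \<Longrightarrow> as_poly a \<in> poly_over L"
  unfolding as_poly_def
  by (intro subring_set_diff[OF subring_poly_over[OF Lr]] monom_poly_over[OF Lr] pCons_poly_over[OF Lr]
    const_poly_over[OF Lr] subring_set_1[OF Lr])

text \<open>Let \<open>D\<close> be the minimal polynomial of \<open>y\<close> over
  \<open>L\<close>, of degree less than \<open>p\<close>. If it has another root
  \<open>y + i\<close>, then \<open>D(X + i) - D\<close> vanishes at \<open>y\<close> and has
  smaller degree, so \<open>D\<close> is invariant under the shift by \<open>i\<close> and has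
  \<open>p\<close> roots. If not, \<open>D\<close> is linear, since it divides a squarefree
  polynomial, and \<open>y \<in> L\<close>.\<close>

lemma low_degree_independent:
  assumes P: "P \<in> poly_over L" "degree P < CHAR('a)" "poly P y = 0"
  shows "P = 0"
proof -
  let ?p = "CHAR('a)"
  note sub = subring_poly_over[OF Lr]
  define I where "I = {P \<in> poly_over L. poly P y = 0}"
  define A where "A = as_poly (artin_schreier y)"
  have A: "A \<in> I" unfolding I_def A_def using as_poly_over[OF as_y] by (simp add: poly_as_poly)
  have A0: "A \<noteq> 0" using as_poly_degree(2)[OF p, of "artin_schreier y"] by (auto simp: A_def)
  obtain D where D: "D \<in> I" "lead_coeff D = 1" "\<And>P. P \<in> I \<Longrightarrow> D dvd P"
      "\<And>P. P \<in> I \<Longrightarrow> degree P < degree D \<Longrightarrow> P = 0"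
    by (rule poly_over_principal[OF L _ _ _ A A0])
      (auto simp: I_def intro: subring_set_diff[OF sub] subring_set_mult[OF sub])
  have D0: "D \<noteq> 0" using D(2) by auto
  have "\<not> degree D < ?p"
  proof
    assume small: "degree D < ?p"
    have Dy: "poly D y = 0" using D(1) by (simp add: I_def)
    have only: "z = y" if z: "poly D z = 0" for z
    proof (rule ccontr)
      assume "z \<noteq> y"
      have "poly A z = 0" using D(3)[OF A] z by (auto elim!: dvdE)
      then have "artin_schreier z = artin_schreier y" by (simp add: A_def poly_as_poly)
      then obtain i where i: "i < ?p" "z = y + of_nat i" using artin_schreier_eq_iff[OF p] by blast
      have i0: "of_nat i \<noteq> (0 :: 'a)" using i(2) \<open>z \<noteq> y\<close> by auto
      define E where "E = pcompose D [:of_nat i, 1:]"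
      have "E \<in> poly_over L" unfolding E_def using D(1)
        by (intro pcompose_poly_over[OF Lr] pCons_poly_over[OF Lr] const_poly_over[OF Lr]
          subring_set_of_nat[OF Lr] subring_set_1[OF Lr]) (simp add: I_def)
      moreover have "poly E y = 0" using z i(2) by (simp add: E_def poly_pcompose add.commute)
      ultimately have E: "E - D \<in> I" using D(1) by (simp add: I_def subring_set_diff[OF sub])
      have degE: "degree E = degree D" by (simp add: E_def)
      have "lead_coeff E = lead_coeff D" unfolding E_def by (subst lead_coeff_comp) auto
      then have "coeff (E - D) (degree D) = 0" using degE by simp
      moreover have "degree (E - D) \<le> degree D" using degE by (intro degree_diff_le) auto
      ultimately have "E - D = 0"
        using D(4)[OF E] by (metis le_neq_implies_less leading_coeff_0_iff)
      then have "poly E w = poly D w" for w by simp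
      then have shift: "poly D (w + of_nat i) = poly D w" for w
        by (simp add: E_def poly_pcompose add.commute)
      have roots: "poly D (y + of_nat k * of_nat i) = 0" for k
      proof (induction k)
        case (Suc k)
        then show ?case using shift[of "y + of_nat k * of_nat i"] by (simp add: algebra_simps)
      qed (simp add: Dy)
      have "inj_on (\<lambda>k. y + of_nat k * of_nat i) {..<?p}"
        using of_nat_inj_on_CHAR[where 'a = 'a] i0 by (auto simp: inj_on_def)
      then have "?p = card ((\<lambda>k. y + of_nat k * of_nat i) ` {..<?p})" by (simp add: card_image)
      also have "\<dots> \<le> card {z. poly D z = 0}"
        by (intro card_mono poly_roots_finite D0) (use roots in auto)
      also have "\<dots> \<le> degree D" by (rule card_poly_roots_bound[OF D0])
      finally show False using small by simp
    qed
    have "order z D \<le> 1" for z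
    proof -
      have "order z D \<le> order z A" by (rule dvd_imp_order_le[OF A0 D(3)[OF A]])
      also have "\<dots> \<le> 1" unfolding A_def as_poly_prod[OF p] by (simp add: order_prod_linear)
      finally show ?thesis .
    qed
    then have "rsquarefree D" using D0 by (auto simp: rsquarefree_def le_Suc_eq)
    then have "degree D = card {z. poly D z = 0}" by (simp add: card_roots_rsquarefree)
    also have "{z. poly D z = 0} = {y}"
    proof (intro equalityI subsetI)
      fix z assume "z \<in> {z. poly D z = 0}"
      then have "z = y" by (intro only) simp
      then show "z \<in> {y}" by simp
    qed (use Dy in simp)
    finally have "degree D = 1" by simp
    then obtain a b where "D = [:b, a:]" by (rule degree1_coeffs)
    then have b: "D = [:b, 1:]" using D(2) \<open>degree D = 1\<close> by auto
    then have "b \<in> L" using D(1) poly_overD[of D L 0] by (simp add: I_def)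
    moreover have "y = - b" using Dy b by (simp add: eq_neg_iff_add_eq_0 add.commute)
    ultimately show False using y_notin subring_set_uminus[OF Lr] by simp
  qed
  then show ?thesis using D(4)[of P] P by (simp add: I_def)
qed

lemma low_degree_rep:
  assumes "P \<in> poly_over L"
  obtains Q R where "Q \<in> poly_over L" "R \<in> poly_over L" "degree R < CHAR('a)"
    "P = Q * as_poly (artin_schreier y) + R" "poly R y = poly P y"
proof -
  let ?A = "as_poly (artin_schreier y)"
  have deg: "degree ?A = CHAR('a)" using as_poly_degree[OF p] by simp
  have A0: "?A \<noteq> 0" using as_poly_degree(2)[OF p, of "artin_schreier y"] by auto
  obtain Q R where QR: "Q \<in> poly_over L" "R \<in> poly_over L" "P = Q * ?A + R" "R = 0 \<or> degree R < degree ?A"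
    using poly_over_division[OF L as_poly_over[OF as_y] A0 assms] by blast
  have "degree R < CHAR('a)" using QR(4) deg prime_gt_0_nat[OF p] by auto
  moreover have "poly R y = poly P y" using QR(3) by (simp add: poly_as_poly)
  ultimately show ?thesis using that QR by blast
qed

lemma adjoin_low_degree:
  assumes "x \<in> adjoin L y"
  obtains P where "P \<in> poly_over L" "degree P < CHAR('a)" "x = poly P y"
  using assms low_degree_rep unfolding adjoin_def by (metis imageE)

lemma vanishing_multiple:
  assumes "P \<in> poly_over L" "poly P y = 0"
  obtains Q where "Q \<in> poly_over L" "P = Q * as_poly (artin_schreier y)"
proof -
  obtain Q R where QR: "Q \<in> poly_over L" "R \<in> poly_over L" "degree R < CHAR('a)"
    "P = Q * as_poly (artin_schreier y) + R" "poly R y = poly P y"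
    by (rule low_degree_rep[OF assms(1)])
  have "R = 0" by (rule low_degree_independent) (use QR assms in auto)
  then show ?thesis using that QR by simp
qed

lemma map_as_poly:
  assumes "hom_on L \<sigma>" "a \<in> L"
  shows "map_poly \<sigma> (as_poly a) = as_poly (\<sigma> a)"
proof -
  interpret \<sigma>: hom_on L \<sigma> by fact
  note [simp] = subring_set_1[OF Lr] subring_set_0[OF Lr] assms(2)
  show ?thesis
    by (rule poly_eqI)
      (auto simp: coeff_map_poly \<sigma>.hom_0 as_poly_def coeff_pCons \<sigma>.hom_1 \<sigma>.hom_diff \<sigma>.hom_uminus
        subring_set_diff[OF Lr] split: nat.split)
qed

lemma map_poly_diff_on:
  assumes "hom_on L \<sigma>" "P \<in> poly_over L" "Q \<in> poly_over L"
  shows "map_poly \<sigma> (P - Q) = map_poly \<sigma> P - map_poly \<sigma> Q"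
    "map_poly \<sigma> (P + Q) = map_poly \<sigma> P + map_poly \<sigma> Q"
proof -
  interpret \<sigma>: hom_on L \<sigma> by fact
  show "map_poly \<sigma> (P - Q) = map_poly \<sigma> P - map_poly \<sigma> Q"
    "map_poly \<sigma> (P + Q) = map_poly \<sigma> P + map_poly \<sigma> Q"
    by (rule poly_eqI; use assms in \<open>simp add: coeff_map_poly \<sigma>.hom_0 \<sigma>.hom_diff \<sigma>.hom_add poly_overD\<close>)+
qed

text \<open>The extension of \<open>\<sigma>\<close> to \<open>L(y)\<close> with
  \<open>y \<mapsto> y + b\<close>. Any representative of \<open>x\<close> may be chosen: two of
  them differ by a multiple of \<open>as_poly\<close>, which the compatibility of
  \<open>\<sigma>\<close> and \<open>b\<close> assumed below sends to a polynomial vanishing at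
  \<open>y + b\<close>.\<close>

definition lift :: "('a \<Rightarrow> 'a) \<Rightarrow> 'a \<Rightarrow> 'a \<Rightarrow> 'a" where
  "lift \<sigma> b x = poly (map_poly \<sigma> (SOME P. P \<in> poly_over L \<and> x = poly P y)) (y + b)"

context
  fixes \<sigma> :: "'a \<Rightarrow> 'a" and b :: 'a
  assumes \<sigma>: "hom_on L \<sigma>" and b: "\<sigma> (artin_schreier y) = artin_schreier y + artin_schreier b"
begin

interpretation \<sigma>: hom_on L \<sigma> by (rule \<sigma>)

lemma lift_poly:
  assumes P: "P \<in> poly_over L"
  shows "lift \<sigma> b (poly P y) = poly (map_poly \<sigma> P) (y + b)"
proof -
  define Q where "Q = (SOME Q. Q \<in> poly_over L \<and> poly P y = poly Q y)"
  have Q: "Q \<in> poly_over L \<and> poly P y = poly Q y" unfolding Q_def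
    by (rule someI[of _ P]) (use P in simp)
  have PQ: "P - Q \<in> poly_over L" using P Q subring_set_diff[OF subring_poly_over[OF Lr]] by blast
  have "poly (P - Q) y = 0" using Q by simp
  with PQ obtain U where U: "U \<in> poly_over L" "P - Q = U * as_poly (artin_schreier y)"
    by (rule vanishing_multiple)
  have "map_poly \<sigma> (P - Q) = map_poly \<sigma> U * as_poly (\<sigma> (artin_schreier y))"
    unfolding U(2) \<sigma>.map_poly_mult_on[OF U(1) as_poly_over[OF as_y]] map_as_poly[OF \<sigma> as_y] by simp
  then have "poly (map_poly \<sigma> (P - Q)) (y + b) = 0"
    by (simp add: poly_as_poly b artin_schreier_add[OF p])
  then have "poly (map_poly \<sigma> P) (y + b) = poly (map_poly \<sigma> Q) (y + b)"
    using map_poly_diff_on(1)[OF \<sigma> P] Q by simp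
  then show ?thesis unfolding lift_def Q_def[symmetric] by simp
qed

lemma lift_base: "x \<in> L \<Longrightarrow> lift \<sigma> b x = \<sigma> x"
  using lift_poly[OF const_poly_over[OF Lr], of x] by (simp add: \<sigma>.map_poly_pCons_hom)

lemma lift_gen: "lift \<sigma> b y = y + b"
proof -
  have "[:0, 1:] \<in> poly_over L"
    by (intro pCons_poly_over[OF Lr] const_poly_over[OF Lr] subring_set_0[OF Lr] subring_set_1[OF Lr])
  from lift_poly[OF this] show ?thesis by (simp add: \<sigma>.map_poly_pCons_hom \<sigma>.hom_0 \<sigma>.hom_1)
qed

lemma lift_hom: "hom_on (adjoin L y) (lift \<sigma> b)"
proof
  show "subring_set (adjoin L y)" by (rule subring_adjoin[OF Lr])
  show "lift \<sigma> b 1 = 1" using lift_base[OF subring_set_1[OF Lr]] \<sigma>.hom_1 by simp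
  fix u w assume "u \<in> adjoin L y" "w \<in> adjoin L y"
  then obtain P Q where PQ: "P \<in> poly_over L" "Q \<in> poly_over L" "u = poly P y" "w = poly Q y"
    unfolding adjoin_def by blast
  have "P + Q \<in> poly_over L" "P * Q \<in> poly_over L"
    using PQ subring_set_add subring_set_mult subring_poly_over[OF Lr] by blast+
  from this[THEN lift_poly] PQ show
    "lift \<sigma> b (u + w) = lift \<sigma> b u + lift \<sigma> b w" "lift \<sigma> b (u * w) = lift \<sigma> b u * lift \<sigma> b w"
    using lift_poly[OF PQ(1)] lift_poly[OF PQ(2)] map_poly_diff_on(2)[OF \<sigma> PQ(1,2)]
      \<sigma>.map_poly_mult_on[OF PQ(1,2)] by simp_all
qed

end

text \<open>A generator of the Galois group of \<open>L(y)\<close> over \<open>L\<close>.\<close>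

definition shift :: "'a \<Rightarrow> 'a" where "shift = lift (\<lambda>x. x) 1"

lemma shift_hyps: "hom_on L (\<lambda>x. x)" "artin_schreier y = artin_schreier y + artin_schreier 1"
  by (auto simp: hom_on_def Lr artin_schreier_def)

lemmas shift_hom = lift_hom[OF shift_hyps, folded shift_def]
lemmas shift_base = lift_base[OF shift_hyps, folded shift_def]
lemmas shift_gen = lift_gen[OF shift_hyps, folded shift_def]

lemma shift_poly: "P \<in> poly_over L \<Longrightarrow> shift (poly P y) = poly P (y + 1)"
  unfolding shift_def using lift_poly[OF shift_hyps, of P] by (simp add: map_poly_idI)

text \<open>With \<open>x = P(y)\<close> and \<open>degree P < p\<close>, invariance gives
  \<open>P(X + 1) = P\<close> by independence of the low powers of \<open>y\<close>. Then
  \<open>P - P(0)\<close> vanishes on the prime field and is 0.\<close>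

lemma shift_fixed:
  assumes x: "x \<in> adjoin L y" "shift x = x"
  shows "x \<in> L"
proof -
  let ?p = "CHAR('a)"
  obtain P where P: "P \<in> poly_over L" "degree P < ?p" "x = poly P y" by (rule adjoin_low_degree[OF x(1)])
  define E where "E = pcompose P [:1, 1:] - P"
  have "E \<in> poly_over L" unfolding E_def
    by (intro subring_set_diff[OF subring_poly_over[OF Lr]] pcompose_poly_over[OF Lr] pCons_poly_over[OF Lr]
      const_poly_over[OF Lr] subring_set_1[OF Lr] P(1))
  moreover have "degree E < ?p" unfolding E_def using P(2)
    by (intro degree_diff_less) auto
  moreover have "poly E y = 0" using x(2) shift_poly[OF P(1)] P(3) by (simp add: E_def poly_pcompose add.commute)
  ultimately have "E = 0" by (rule low_degree_independent)
  then have eq: "pcompose P [:1, 1:] = P" by (simp add: E_def)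
  have step: "poly P (w + 1) = poly P w" for w
  proof -
    have "poly (pcompose P [:1, 1:]) w = poly P (w + 1)" by (simp add: poly_pcompose add.commute)
    then show ?thesis by (simp add: eq)
  qed
  have const: "poly P (of_nat i) = poly P 0" for i
  proof (induction i)
    case (Suc i)
    have "of_nat (Suc i) = of_nat i + (1 :: 'a)" by simp
    then show ?case using Suc step[of "of_nat i"] by (simp only:)
  qed simp
  define D where "D = P - [:poly P 0:]"
  have "D = 0"
  proof (rule ccontr)
    assume "D \<noteq> 0"
    have "?p = card ((of_nat :: nat \<Rightarrow> 'a) ` {..<?p})" using card_image[OF of_nat_inj_on_CHAR[where 'a = 'a]] by simp
    also have "\<dots> \<le> card {z. poly D z = 0}"
      by (intro card_mono poly_roots_finite \<open>D \<noteq> 0\<close>) (auto simp: D_def const)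
    also have "\<dots> \<le> degree D" by (rule card_poly_roots_bound[OF \<open>D \<noteq> 0\<close>])
    also have "\<dots> < ?p" unfolding D_def using P(2) prime_gt_0_nat[OF p] by (intro degree_diff_less) auto
    finally show False by simp
  qed
  then have "x = poly P 0" using P(3) by (simp add: D_def) (metis poly_const_conv)
  then show ?thesis using poly_poly_over[OF Lr P(1) subring_set_0[OF Lr]] by simp
qed

end

text \<open>An element of a field is algebraic over the prime field exactly if some power of
  Frobenius fixes it. So this says, without polynomials, that the prime field is algebraically
  closed in \<open>L\<close>.\<close>

definition constants_trivial :: "'a::comm_ring_1 set \<Rightarrow> bool" where
  "constants_trivial L \<longleftrightarrow> (\<forall>x\<in>L. \<forall>n>0. x ^ (CHAR('a) ^ n) = x \<longrightarrow> x ^ CHAR('a) = x)"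

context artin_schreier_step
begin

lemma shift_closed: "x \<in> adjoin L y \<Longrightarrow> shift x \<in> adjoin L y"
proof -
  assume "x \<in> adjoin L y"
  then obtain P where P: "P \<in> poly_over L" "x = poly P y" by (auto simp: adjoin_def)
  note A = subring_adjoin[OF Lr, of y]
  have "poly P (y + 1) \<in> adjoin L y"
    by (intro poly_poly_over[OF A poly_over_mono[OF adjoin_superset[OF Lr] P(1)]]
      subring_set_add[OF A] adjoin_gen[OF Lr] subring_set_1[OF A])
  then show ?thesis using P shift_poly by simp
qed

lemma shift_funpow:
  assumes "P \<in> poly_over L"
  shows "(shift ^^ i) (poly P y) = poly P (y + of_nat i)"
proof (induction i)
  case (Suc i)
  define Q where "Q = pcompose P [:of_nat i, 1:]"
  have Q: "Q \<in> poly_over L" unfolding Q_def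
    by (intro pcompose_poly_over[OF Lr assms] pCons_poly_over[OF Lr] const_poly_over[OF Lr]
      subring_set_of_nat[OF Lr] subring_set_1[OF Lr])
  have "(shift ^^ Suc i) (poly P y) = shift (poly Q y)"
    by (simp add: Suc Q_def poly_pcompose add.commute)
  also have "\<dots> = poly P (y + of_nat (Suc i))"
    unfolding shift_poly[OF Q] by (simp add: Q_def poly_pcompose algebra_simps)
  finally show ?case .
qed simp

text \<open>If the adjunction of \<open>y\<close> created new constants, then these would contain some \<open>z\<close> with
  \<open>shift z = z + 1\<close>, and \<open>y - z\<close> would lie in \<open>L\<close>.\<close>

lemma constants_step:
  assumes base: "constants_trivial L"
    and nores: "\<And>l j. l \<in> L \<Longrightarrow> j ^ CHAR('a) = j \<Longrightarrow> artin_schreier y \<noteq> artin_schreier l + j"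
  shows "constants_trivial (adjoin L y)"
  unfolding constants_trivial_def
proof (intro ballI allI impI)
  fix x n assume x: "x \<in> adjoin L y" and n: "n > (0 :: nat)" and xq: "x ^ (CHAR('a) ^ n) = x"
  define q where "q = CHAR('a) ^ n"
  \<comment> \<open>A finite field of constants in \<open>L(y)\<close>, stable under
    \<open>shift\<close>; the operator \<open>shift - 1\<close> is nilpotent on it because
    \<open>shift\<close> has order \<open>p\<close>.\<close>
  define V where "V = {x \<in> adjoin L y. x ^ q = x}"
  note A = subring_adjoin[OF Lr, of y]
  have const: "w ^ CHAR('a) = w" if "w \<in> V" "w \<in> L" for w
    using base that n by (auto simp: constants_trivial_def V_def q_def)
  show "x ^ CHAR('a) = x"
  proof (rule ccontr)
    assume "x ^ CHAR('a) \<noteq> x"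
    have xV: "x \<in> V" using x xq by (simp add: V_def q_def)
    then have xL: "x \<notin> L" using const \<open>x ^ CHAR('a) \<noteq> x\<close> by blast
    interpret s: hom_on "adjoin L y" shift by (rule shift_hom)
    have V_diff: "a - b \<in> V" if "a \<in> V" "b \<in> V" for a b
      using that subring_set_diff[OF A] power_char_diff[OF p, of a b n] by (simp add: V_def q_def)
    have V_mult: "a * b \<in> V" if "a \<in> V" "b \<in> V" for a b
      using that subring_set_mult[OF A] by (simp add: V_def power_mult_distrib)
    have V_shift: "shift a \<in> V" if "a \<in> V" for a
      using that shift_closed s.hom_power[of a q] by (simp add: V_def)
    define \<delta> where "\<delta> = (\<lambda>x. shift x - x)"
    have "(\<delta> ^^ (CHAR('a) ^ 1)) x = 0"
      unfolding \<delta>_def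
    proof (rule difference_operator_nilpotent[where V = V])
      show "shift (a - b) = shift a - shift b" if "a \<in> V" "b \<in> V" for a b
        using that s.hom_diff by (simp add: V_def)
      show "(shift ^^ (CHAR('a) ^ 1)) a = a" if aV: "a \<in> V" for a
      proof -
        obtain P where "P \<in> poly_over L" "a = poly P y" using aV by (auto simp: V_def adjoin_def)
        then show ?thesis using shift_funpow[of P "CHAR('a)"] by simp
      qed
    qed (use V_diff V_shift p xV in auto)
    then have ex: "\<exists>k. (\<delta> ^^ k) x \<in> L" using subring_set_0[OF Lr] by metis
    define k where "k = (LEAST k. (\<delta> ^^ k) x \<in> L)"
    have k: "(\<delta> ^^ k) x \<in> L" unfolding k_def using ex by (rule LeastI_ex)
    have "k \<noteq> 0" using k xL by (metis funpow_0)
    then obtain j where j: "k = Suc j" by (cases k) auto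
    define z where "z = (\<delta> ^^ j) x"
    have zL: "z \<notin> L" unfolding z_def using not_less_Least[of j "\<lambda>k. (\<delta> ^^ k) x \<in> L"] j by (simp add: k_def)
    have zV: "z \<in> V" unfolding z_def
      by (induction j) (use xV V_diff V_shift in \<open>auto simp: \<delta>_def\<close>)
    define c where "c = \<delta> z"
    have cL: "c \<in> L" using k by (simp add: c_def z_def j)
    have cV: "c \<in> V" using V_diff V_shift zV by (simp add: c_def \<delta>_def)
    have sz: "shift z = z + c" by (simp add: c_def \<delta>_def)
    have zA: "z \<in> adjoin L y" using zV by (simp add: V_def)
    have c0: "c \<noteq> 0" using shift_fixed[OF zA] zL sz by auto
    define w where "w = inverse c * z"
    have icL: "inverse c \<in> L" by (rule subfield_set_inverse[OF L cL])
    have icA: "inverse c \<in> adjoin L y" using icL adjoin_superset[OF Lr] by blast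
    have "inverse c \<in> V" using icA cV by (simp add: V_def power_inverse)
    then have wV: "w \<in> V" unfolding w_def using V_mult zV by blast
    then have wA: "w \<in> adjoin L y" by (simp add: V_def)
    have sw: "shift w = w + 1"
      using s.hom_mult[OF icA zA] shift_base[OF icL] c0 by (simp add: w_def sz field_simps)
    have yA: "y \<in> adjoin L y" by (rule adjoin_gen[OF Lr])
    have "shift (y - w) = y - w" using s.hom_diff[OF yA wA] by (simp add: sw shift_gen)
    then have l: "y - w \<in> L" by (rule shift_fixed[OF subring_set_diff[OF A yA wA]])
    have aw: "artin_schreier w \<in> V"
    proof -
      have "w ^ CHAR('a) \<in> V" using wV subring_set_power[OF A]
        by (simp add: V_def) (metis power_mult mult.commute)
      then show ?thesis unfolding artin_schreier_def using V_diff wV by blast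
    qed
    then have awA: "artin_schreier w \<in> adjoin L y" by (simp add: V_def)
    have "shift (artin_schreier w) = artin_schreier (shift w)"
      unfolding artin_schreier_def using s.hom_diff[OF subring_set_power[OF A wA] wA] s.hom_power[OF wA] by simp
    also have "\<dots> = artin_schreier w" by (simp add: sw artin_schreier_add[OF p] artin_schreier_def[of 1])
    finally have "artin_schreier w \<in> L" by (rule shift_fixed[OF awA])
    then have "artin_schreier w ^ CHAR('a) = artin_schreier w" using const aw by blast
    moreover have "artin_schreier y = artin_schreier (y - w) + artin_schreier w"
      by (simp flip: artin_schreier_add[OF p])
    ultimately show False using nores[OF l] by blast
  qed
qed

end

text \<open>The powers \<open>y ^ i\<close> with \<open>i < n\<close> span \<open>L(y)\<close> over
  \<open>L\<close>; the tower law does the rest.\<close>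

lemma finite_dimension_adjoin:
  fixes K L :: "'a::field set"
  assumes K: "subfield_set K" and L: "subfield_set L"
    and fin: "ring.finite_dimension ring_of_type_algebra K L"
    and low: "\<And>x. x \<in> adjoin L y \<Longrightarrow> \<exists>P\<in>poly_over L. degree P < n \<and> x = poly P y"
  shows "ring.finite_dimension ring_of_type_algebra K (adjoin L y)"
proof -
  interpret R: field "ring_of_type_algebra :: 'a ring" by rule
  note Lr = subfield_set_imp_subring_set[OF L]
  have K': "subfield K (ring_of_type_algebra :: 'a ring)" using K subfield_set_iff_subfield by blast
  have L': "subfield L (ring_of_type_algebra :: 'a ring)" using L subfield_set_iff_subfield by blast
  have carr: "set us \<subseteq> carrier (ring_of_type_algebra :: 'a ring)" for us
    by (simp add: ring_of_type_algebra_def)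
  define us where "us = map (\<lambda>i. y ^ i) [0..<n]"
  define E where "E = R.Span L us"
  have E_sub: "subgroup E (add_monoid (ring_of_type_algebra :: 'a ring))"
    unfolding E_def by (rule R.Span_is_add_subgroup[OF L' carr])
  have E_add: "a + b \<in> E" if "a \<in> E" "b \<in> E" for a b
    using subgroup.m_closed[OF E_sub that] by (simp add: ring_of_type_algebra_def)
  have E_0: "0 \<in> E" using subgroup.one_closed[OF E_sub] by (simp add: ring_of_type_algebra_def)
  have E_smult: "c * a \<in> E" if "c \<in> L" "a \<in> E" for c a
    using R.Span_smult_closed[OF L' carr that(1), of a us] that(2)
    by (simp add: E_def ring_of_type_algebra_def)
  have E_pow: "y ^ i \<in> E" if "i < n" for i
    using R.Span_base_incl[OF L' carr, of us] that by (auto simp: E_def us_def)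
  have sub: "adjoin L y \<subseteq> E"
  proof
    fix x assume "x \<in> adjoin L y"
    then obtain P where P: "P \<in> poly_over L" "degree P < n" "x = poly P y" using low by blast
    have sum_E: "(\<Sum>i\<in>I. coeff P i * y ^ i) \<in> E" if "I \<subseteq> {..<n}" for I
      using finite_subset[OF that finite_lessThan] that
      by (induction I rule: finite_induct) (auto intro!: E_0 E_add E_smult E_pow poly_overD[OF P(1)])
    have "{..degree P} \<subseteq> {..<n}" using P(2) by auto
    from sum_E[OF this] show "x \<in> E" using P(3) by (simp add: poly_altdef)
  qed
  have "subalgebra L (adjoin L y) (ring_of_type_algebra :: 'a ring)"
  proof (rule subalgebra.intro)
    have "subring (adjoin L y) (ring_of_type_algebra :: 'a ring)"
      using subring_adjoin[OF Lr] subring_set_iff_subring by blast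
    then show "subgroup (adjoin L y) (add_monoid (ring_of_type_algebra :: 'a ring))"
      by (rule subring.axioms(1))
    show "subalgebra_axioms L (adjoin L y) (ring_of_type_algebra :: 'a ring)"
      using subring_set_mult[OF subring_adjoin[OF Lr, of y]] adjoin_superset[OF Lr, of y, THEN subsetD]
      by (auto simp: subalgebra_axioms_def ring_of_type_algebra_def)
  qed
  then have "R.finite_dimension L (adjoin L y)"
    using R.subalbegra_incl_imp_finite_dimension[OF L' R.Span_finite_dimension[OF L' carr[of us]]] sub
    by (simp add: E_def)
  then show ?thesis
    using R.telescopic_base[OF K' L'] fin by (auto simp: R.finite_dimension_def)
qed

section \<open>Constants of extensions of the rational function field\<close>

lemma power_CHAR_fixed_is_const:
  fixes x :: "'p::prime_card ratfun alg_closure"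
  assumes "x ^ CARD('p) = x"
  shows "x \<in> range (\<lambda>c. to_ac (ratfun_const c))"
proof -
  obtain i where i: "x = of_nat i"
    using power_CHAR_fixed_iff[OF prime_CHAR_ratfun_ac, of x] assms unfolding CHAR_ratfun_ac by blast
  have "of_nat i = (to_fract (of_nat i) :: 'p ratfun)" by (induction i) auto
  then have "of_nat i = (ratfun_const (of_nat i) :: 'p ratfun)" by (simp add: ratfun_const_def of_nat_poly)
  then have "x = to_ac (ratfun_const (of_nat i) :: 'p ratfun)" unfolding i by (metis to_ac_of_nat)
  then show ?thesis by blast
qed

text \<open>Frobenius fixes the coefficients of \<open>f\<close>, hence maps its root
  \<open>x\<close> to further roots. Finiteness of the root set yields
  \<open>x ^ (p ^ i) = x ^ (p ^ j)\<close>, and injectivity of Frobenius cancels the smaller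
  power.\<close>

lemma geometric_extensionI:
  fixes L :: "'p::prime_card ratfun alg_closure set"
  assumes L: "constants_trivial L"
  shows "geometric_extension L"
  unfolding geometric_extension_def
proof (intro ballI impI)
  let ?c = "\<lambda>c. to_ac (ratfun_const c) :: 'p ratfun alg_closure"
  fix x assume x: "x \<in> L" and "\<exists>f :: 'p mod_ring poly. f \<noteq> 0 \<and> poly (map_poly ?c f) x = 0"
  then obtain f :: "'p mod_ring poly" where f: "f \<noteq> 0" "poly (map_poly ?c f) x = 0" by blast
  define g where "g = map_poly ?c f"
  have c0: "?c c = 0 \<longleftrightarrow> c = 0" for c by (simp add: ratfun_const_def)
  have cp: "?c c ^ CARD('p) = ?c c" for c
  proof -
    have "ratfun_const c ^ CARD('p) = ratfun_const c"
      using finite_field_power_card_eq_same[of c] by (simp add: ratfun_const_def poly_const_pow flip: to_fract_power)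
    then show ?thesis by (simp flip: to_ac_power)
  qed
  have g0: "g \<noteq> 0" using f(1) c0 by (simp add: g_def map_poly_eq_0_iff)
  have coeff_p: "coeff g i ^ CARD('p) = coeff g i" for i
    using c0[of 0] cp by (simp add: g_def coeff_map_poly)
  have step: "poly g (z ^ CARD('p)) = 0" if z: "poly g z = 0" for z
  proof -
    have "poly g z ^ CARD('p) = (\<Sum>i\<le>degree g. (coeff g i * z ^ i) ^ CARD('p))"
      unfolding poly_altdef
      by (rule freshmans_dream_sum) (simp_all only: CHAR_ratfun_ac prime_card)
    also have "\<dots> = poly g (z ^ CARD('p))"
      unfolding poly_altdef
      by (intro sum.cong refl)
        (simp add: power_mult_distrib coeff_p mult.commute flip: power_mult)
    finally show ?thesis using z by (simp add: power_0_left)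
  qed
  have root: "poly g (x ^ (CARD('p) ^ i)) = 0" for i
  proof (induction i)
    case (Suc i)
    then show ?case using step[OF Suc] by (simp add: mult.commute flip: power_mult)
  qed (use f(2) in \<open>simp add: g_def\<close>)
  have "\<not> inj (\<lambda>i. x ^ (CARD('p) ^ i))"
  proof
    assume "inj (\<lambda>i. x ^ (CARD('p) ^ i))"
    moreover have "range (\<lambda>i. x ^ (CARD('p) ^ i)) \<subseteq> {z. poly g z = 0}" using root by blast
    ultimately show False
      using poly_roots_finite[OF g0] by (meson finite_imageD finite_subset infinite_UNIV_nat)
  qed
  then obtain i j :: nat where ij: "i < j" "x ^ (CARD('p) ^ i) = x ^ (CARD('p) ^ j)"
    unfolding inj_def by (metis linorder_neqE_nat)
  have "(x - x ^ (CARD('p) ^ (j - i))) ^ (CARD('p) ^ i) = x ^ (CARD('p) ^ i) - (x ^ (CARD('p) ^ (j - i))) ^ (CARD('p) ^ i)"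
    using power_char_diff[OF prime_CHAR_ratfun_ac, of x _ i] unfolding CHAR_ratfun_ac .
  also have "(x ^ (CARD('p) ^ (j - i))) ^ (CARD('p) ^ i) = x ^ (CARD('p) ^ j)"
    using ij(1) by (simp flip: power_mult power_add)
  finally have "x ^ (CARD('p) ^ (j - i)) = x" using ij(2) by simp
  then have "x ^ CARD('p) = x" using L x ij(1) unfolding constants_trivial_def CHAR_ratfun_ac
    by (meson zero_less_diff)
  then show "x \<in> range ?c" by (rule power_CHAR_fixed_is_const)
qed

lemma constants_trivial_base: "constants_trivial (range (to_ac :: 'p::prime_card ratfun \<Rightarrow> _))"
  unfolding constants_trivial_def CHAR_ratfun_ac
proof (intro ballI allI impI)
  fix x :: "'p ratfun alg_closure" and n :: nat
  assume "x \<in> range to_ac" "n > 0" and xq: "x ^ (CARD('p) ^ n) = x"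
  then obtain u where u: "x = to_ac u" by auto
  have "u ^ (CARD('p) ^ n) = u" using xq unfolding u by (simp flip: to_ac_power)
  moreover have "CARD('p) ^ n \<ge> 2"
    using nontriv[where 'a = 'p] \<open>n > 0\<close> by (metis Suc_leI one_less_power numeral_2_eq_2 One_nat_def)
  ultimately obtain c where c: "u = ratfun_const c" by (rule ratfun_power_eq_imp_const)
  have "ratfun_const c ^ CARD('p) = ratfun_const c"
    using finite_field_power_card_eq_same[of c] by (simp add: ratfun_const_def poly_const_pow flip: to_fract_power)
  then show "x ^ CARD('p) = x" unfolding u c by (simp flip: to_ac_power)
qed

definition pol :: "'p::prime_card mod_ring poly \<Rightarrow> 'p ratfun alg_closure" where
  "pol s = to_ac (to_fract s)"

lemma pol_simps [simp]:
  "pol (a + b) = pol a + pol b" "pol (a - b) = pol a - pol b" "pol (a * b) = pol a * pol b"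
  "pol 0 = 0" "pol 1 = 1" "pol a = 0 \<longleftrightarrow> a = 0"
  by (simp_all add: pol_def)

lemma pol_power: "pol (a ^ n) = pol a ^ n"
  by (simp add: pol_def to_fract_power)

lemma subring_range_pol: "subring_set (range pol)"
  unfolding subring_set_def by (auto simp flip: pol_simps)

lemma range_pol_subset: "range pol \<subseteq> range to_ac"
  by (auto simp: pol_def)

section \<open>Unramified finite places\<close>

text \<open>Says that \<open>R / \<pi> R\<close> satisfies \<open>b ^ q = b\<close>. Such a ring has
  no nonzero nilpotents, which is the form that being unramified at \<open>\<pi>\<close> takes here.
  The exponent \<open>M\<close> depends on \<open>\<pi>\<close> but not on \<open>b\<close>, and it
  may grow from one stage of the tower to the next.\<close>

definition frobenius_closed :: "'p::prime_card ratfun alg_closure set \<Rightarrow> bool" where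
  "frobenius_closed R \<longleftrightarrow>
     (\<forall>\<pi> :: 'p mod_ring poly. irreducible \<pi> \<longrightarrow>
        (\<exists>M>0. \<forall>b\<in>R. \<exists>c\<in>R. b ^ (CARD('p) ^ M) - b = pol \<pi> * c))"

text \<open>If \<open>b ^ q \<equiv> b\<close> modulo a uniformizer \<open>\<pi>\<close> of \<open>v\<close>, then \<open>b = b ^ q - \<pi> c\<close> and
  \<open>w c = w b - e\<close> whenever \<open>w b > 0\<close>; descent shows that \<open>e\<close> divides all values of \<open>w\<close>.\<close>

lemma frobenius_closed_imp_unramified:
  fixes L R :: "'p::prime_card ratfun alg_closure set"
  assumes L: "subfield_set L" and KL: "range to_ac \<subseteq> L" and R: "subring_set R" "R \<subseteq> L" "range pol \<subseteq> R"
    and frac: "\<And>x. x \<in> L \<Longrightarrow> \<exists>s. s \<noteq> 0 \<and> pol s * x \<in> R"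
    and integral: "\<And>x. x \<in> R \<Longrightarrow> x \<noteq> 0 \<Longrightarrow> w x \<ge> 0"
    and frob: "frobenius_closed R"
    and v: "place_on UNIV v" "v (to_fract [:0, 1:]) \<ge> 0"
    and w: "place_on L w" "lies_over_with_index w v e"
  shows "e = 1"
proof -
  note vw = place_imp_valuation[OF w(1)]
  obtain \<pi> where \<pi>: "irreducible \<pi>" "v (to_fract \<pi>) = 1" by (rule place_finite[OF v])
  have \<pi>0: "\<pi> \<noteq> 0" using \<pi>(1) by auto
  have e: "e > 0" "\<And>x. x \<noteq> 0 \<Longrightarrow> w (to_ac x) = int e * v x" using w(2) by (auto simp: lies_over_with_index_def)
  have w\<pi>: "w (pol \<pi>) = int e" using e(2)[of "to_fract \<pi>"] \<pi> \<pi>0 by (simp add: pol_def)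
  have "\<exists>M>0. \<forall>b\<in>R. \<exists>c\<in>R. b ^ (CARD('p) ^ M) - b = pol \<pi> * c"
    using frob \<pi>(1) by (simp add: frobenius_closed_def)
  then obtain M where "M > 0" "\<forall>b\<in>R. \<exists>c\<in>R. b ^ (CARD('p) ^ M) - b = pol \<pi> * c"
    by (elim exE conjE)
  then have M: "M > 0" "\<And>b. b \<in> R \<Longrightarrow> \<exists>c\<in>R. b ^ (CARD('p) ^ M) - b = pol \<pi> * c" by simp_all
  define q where "q = CARD('p) ^ M"
  have q: "q > 1" unfolding q_def by (rule one_less_power[OF nontriv M(1)])
  have dvd: "int e dvd w b" if "b \<in> R" "b \<noteq> 0" for b
    using that
  proof (induction "nat (w b)" arbitrary: b rule: less_induct)
    case less
    have bL: "b \<in> L" using less.prems R(2) by blast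
    show ?case
    proof (cases "w b = 0")
      case False
      then have wb: "w b > 0" using integral[OF less.prems] by simp
      obtain c where c: "c \<in> R" "b ^ q - b = pol \<pi> * c" using M(2)[OF less.prems(1)] by (auto simp: q_def)
      have cL: "c \<in> L" using c(1) R(2) by blast
      note Lr = subfield_set_imp_subring_set[OF L]
      have "w (b ^ q) = int q * w b" by (rule val_power[OF L vw bL less.prems(2)])
      moreover have "w b < int q * w b" using q wb by simp
      ultimately have lt: "w (- b) < w (b ^ q)" using val_minus[OF L vw bL less.prems(2)] by simp
      have nz: "- b + b ^ q \<noteq> 0" and eq: "w (- b + b ^ q) = w (- b)"
        using val_add_eq[OF L vw _ _ _ _ lt] less.prems(2) bL
        by (auto intro!: subring_set_uminus[OF Lr] subring_set_power[OF Lr])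
      have prod: "- b + b ^ q = pol \<pi> * c" using c(2) by simp
      then have c0: "c \<noteq> 0" using nz by auto
      have \<pi>L: "pol \<pi> \<in> L" using R by blast
      have "w (pol \<pi> * c) = int e + w c"
        using val_mult[OF L vw \<pi>L _ cL c0] \<pi>0 by (simp add: w\<pi>)
      then have wc: "w b = int e + w c" using eq prod val_minus[OF L vw bL less.prems(2)] by simp
      have "nat (w c) < nat (w b)" using wc integral[OF c(1) c0] e(1) by simp
      then have "int e dvd w c" using less.hyps c(1) c0 by blast
      then show ?thesis using wc by simp
    qed simp
  qed
  obtain x where x: "x \<in> L" "x \<noteq> 0" "w x = 1" by (rule place_uniformizer[OF w(1)])
  \<comment> \<open>A multiple by a polynomial moves the uniformizer of \<open>w\<close> into
    \<open>R\<close>; both this multiple and \<open>pol s\<close> have values divisible by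
    \<open>e\<close>, hence \<open>e\<close> divides 1.\<close>
  obtain s where s: "s \<noteq> 0" "pol s * x \<in> R" using frac[OF x(1)] by blast
  have "int e dvd w (pol s * x)" by (rule dvd) (use s x in auto)
  moreover have "w (pol s * x) = w (pol s) + 1"
    using val_mult[OF L vw _ _ x(1,2), of "pol s"] s(1) x(3) R by auto
  moreover have "int e dvd w (pol s)" by (rule dvd) (use s R in auto)
  ultimately have "int e dvd 1" by (metis dvd_add_right_iff)
  then show ?thesis using e(1) by simp
qed

section \<open>Towers of Artin-Schreier extensions\<close>

text \<open>A stage of the tower: \<open>G\<close> acts on \<open>L\<close> with kernel \<open>H\<close>, the ring \<open>R\<close> generates \<open>L\<close> and consists of
  elements integral over \<open>F\<^sub>p[t]\<close>, \<open>T\<close> is a transversal of \<open>H\<close>, and \<open>\<theta>\<close> is an element of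
  trace 1.\<close>

locale tower_data = galois_data_ac G \<rho> L
  for G :: "('g, 'm) monoid_scheme" and \<rho> :: "'g \<Rightarrow> 'p::prime_card ratfun alg_closure \<Rightarrow> 'p ratfun alg_closure"
    and L +
  fixes H :: "'g set" and R :: "'p ratfun alg_closure set" and T :: "'g set" and \<theta> :: "'p ratfun alg_closure"
  assumes comm: "comm_group G" and H: "subgroup H G"
    and kernel: "g \<in> carrier G \<Longrightarrow> (\<forall>x\<in>L. \<rho> g x = x) \<longleftrightarrow> g \<in> H"
    and R: "subring_set R" and pol_R: "range pol \<subseteq> R" and R_L: "R \<subseteq> L"
    and act_R: "g \<in> carrier G \<Longrightarrow> x \<in> R \<Longrightarrow> \<rho> g x \<in> R"
    and frac: "x \<in> L \<Longrightarrow> \<exists>s. s \<noteq> 0 \<and> pol s * x \<in> R"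
    and integral: "valuation_on L w \<Longrightarrow> (\<And>s. s \<noteq> 0 \<Longrightarrow> w (pol s) \<ge> 0) \<Longrightarrow> x \<in> R \<Longrightarrow> x \<noteq> 0 \<Longrightarrow> w x \<ge> 0"
    and frob: "frobenius_closed R"
    and T: "T \<subseteq> carrier G" "g \<in> carrier G \<Longrightarrow> \<exists>!t. t \<in> T \<and> inv\<^bsub>G\<^esub> t \<otimes>\<^bsub>G\<^esub> g \<in> H"
    and \<theta>: "\<theta> \<in> R" "(\<Sum>t\<in>T. \<rho> t \<theta>) = 1"
    and constants: "constants_trivial L"
    and finite_dim: "ring.finite_dimension ring_of_type_algebra (range to_ac) L"

lemma tower_base:
  assumes "comm_group G" "finite (carrier G)"
  shows "tower_data G (\<lambda>_ x. x) (range (to_ac :: 'p::prime_card ratfun \<Rightarrow> _))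
    (carrier G) (range pol) {\<one>\<^bsub>G\<^esub>} 1"
proof -
  interpret G: comm_group G by fact
  interpret O: field "ring_of_type_algebra :: 'p ratfun alg_closure ring" by rule
  show ?thesis
  proof (intro tower_data.intro galois_data_ac.intro galois_data.intro tower_data_axioms.intro)
    show "group G" ..
    show "comm_group G" "finite (carrier G)" by fact+
    show "subfield_set (range (to_ac :: 'p ratfun \<Rightarrow> _))" by (rule subfield_range_to_ac)
    then show "subfield_set (range (to_ac :: 'p ratfun \<Rightarrow> _))" .
    show "hom_on (range (to_ac :: 'p ratfun \<Rightarrow> _)) (\<lambda>x. x)" by (auto simp: hom_on_def subring_range_to_ac)
    show "subgroup (carrier G) G" by (rule G.subgroup_self)
    show "subring_set (range (pol :: 'p mod_ring poly \<Rightarrow> _))" by (rule subring_range_pol)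
    show "range (pol :: 'p mod_ring poly \<Rightarrow> _) \<subseteq> range to_ac" by (rule range_pol_subset)
    show "\<exists>s. s \<noteq> 0 \<and> pol s * x \<in> range pol" if xK: "x \<in> range to_ac" for x :: "'p ratfun alg_closure"
    proof -
      obtain u where u: "x = to_ac u" using xK by auto
      obtain a b where ab: "u = to_fract a / to_fract b" "b \<noteq> 0" by (rule ratfun_cases[of u])
      have "pol b * x = pol a" using ab by (simp add: u pol_def)
      then show ?thesis using ab(2) by auto
    qed
    show "frobenius_closed (range (pol :: 'p mod_ring poly \<Rightarrow> _))"
      unfolding frobenius_closed_def
    proof (intro allI impI)
      fix \<pi> :: "'p mod_ring poly" assume irr: "irreducible \<pi>"
      obtain M where M: "M > 0" "\<And>b. \<pi> dvd b ^ (CARD('p) ^ M) - b"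
        by (rule exists_frobenius_period[OF irr]) (rule that)
      have "\<exists>c\<in>range pol. pol b ^ (CARD('p) ^ M) - pol b = pol \<pi> * c" for b
      proof -
        obtain c where "b ^ (CARD('p) ^ M) - b = \<pi> * c" using M(2)[of b] by (elim dvdE)
        then have "pol b ^ (CARD('p) ^ M) - pol b = pol \<pi> * pol c" by (simp flip: pol_power pol_simps)
        then show ?thesis by blast
      qed
      then show "\<exists>M>0. \<forall>b\<in>range pol. \<exists>c\<in>range pol. b ^ CARD('p) ^ M - b = pol \<pi> * c"
        using M(1) by blast
    qed
    show "constants_trivial (range (to_ac :: 'p ratfun \<Rightarrow> _))" by (rule constants_trivial_base)
    have "subfield (range (to_ac :: 'p ratfun \<Rightarrow> _)) ring_of_type_algebra"
      using subfield_range_to_ac subfield_set_iff_subfield by blast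
    then show "O.finite_dimension (range (to_ac :: 'p ratfun \<Rightarrow> _)) (range to_ac)"
      using O.dimension_one O.finite_dimensionI by blast
    show "1 \<in> range (pol :: 'p mod_ring poly \<Rightarrow> _)" using subring_set_1[OF subring_range_pol] .
  qed auto
qed

section \<open>Cosets of the kernel\<close>

context tower_data
begin

definition rep :: "'g \<Rightarrow> 'g" where "rep g = (THE t. t \<in> T \<and> inv\<^bsub>G\<^esub> t \<otimes>\<^bsub>G\<^esub> g \<in> H)"

lemma rep: "g \<in> carrier G \<Longrightarrow> rep g \<in> T \<and> inv\<^bsub>G\<^esub> (rep g) \<otimes>\<^bsub>G\<^esub> g \<in> H"
  unfolding rep_def by (rule theI'[OF T(2)])

lemma rep_unique: "g \<in> carrier G \<Longrightarrow> t \<in> T \<Longrightarrow> inv\<^bsub>G\<^esub> t \<otimes>\<^bsub>G\<^esub> g \<in> H \<Longrightarrow> rep g = t"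
  using T(2)[of g] rep[of g] by blast

lemma rep_mult:
  assumes g: "g \<in> carrier G"
  obtains h where "h \<in> H" "g = rep g \<otimes>\<^bsub>G\<^esub> h"
proof
  interpret G: comm_group G by (rule comm)
  have t: "rep g \<in> carrier G" using rep[OF g] T(1) by blast
  show "inv\<^bsub>G\<^esub> (rep g) \<otimes>\<^bsub>G\<^esub> g \<in> H" using rep[OF g] by blast
  show "g = rep g \<otimes>\<^bsub>G\<^esub> (inv\<^bsub>G\<^esub> (rep g) \<otimes>\<^bsub>G\<^esub> g)" using g t by (simp add: G.m_assoc[symmetric])
qed

text \<open>Left translation by \<open>g\<close> permutes the cosets of \<open>H\<close>, so it only
  changes the representatives of the transversal, to which \<open>F\<close> is blind.\<close>

lemma sum_transversal_shift:
  fixes F :: "'g \<Rightarrow> 'b::comm_monoid_add"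
  assumes g: "g \<in> carrier G"
    and F: "\<And>x h. x \<in> carrier G \<Longrightarrow> h \<in> H \<Longrightarrow> F (x \<otimes>\<^bsub>G\<^esub> h) = F x"
  shows "(\<Sum>t\<in>T. F (g \<otimes>\<^bsub>G\<^esub> t)) = (\<Sum>t\<in>T. F t)"
proof -
  interpret G: comm_group G by (rule comm)
  interpret H: subgroup H G by (rule H)
  have F_rep: "F (rep x) = F x" if x: "x \<in> carrier G" for x
  proof -
    obtain h where h: "h \<in> H" "x = rep x \<otimes>\<^bsub>G\<^esub> h" by (rule rep_mult[OF x])
    have "rep x \<in> carrier G" using rep[OF x] T(1) by blast
    from F[OF this h(1)] h(2) show ?thesis by simp
  qed
  \<comment> \<open>\<open>t \<mapsto> rep (a \<otimes> t)\<close> is a permutation of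
    \<open>T\<close>, undone by the same map for the inverse of \<open>a\<close>.\<close>
  have inverse: "rep (inv\<^bsub>G\<^esub> a \<otimes>\<^bsub>G\<^esub> rep (a \<otimes>\<^bsub>G\<^esub> t)) = t" if a: "a \<in> carrier G" and t: "t \<in> T" for a t
  proof (rule rep_unique)
    have tG: "t \<in> carrier G" using t T(1) by blast
    have at: "a \<otimes>\<^bsub>G\<^esub> t \<in> carrier G" using a tG by simp
    define r where "r = rep (a \<otimes>\<^bsub>G\<^esub> t)"
    have r: "r \<in> carrier G" "inv\<^bsub>G\<^esub> r \<otimes>\<^bsub>G\<^esub> (a \<otimes>\<^bsub>G\<^esub> t) \<in> H" using rep[OF at] T(1) by (auto simp: r_def)
    show "inv\<^bsub>G\<^esub> a \<otimes>\<^bsub>G\<^esub> rep (a \<otimes>\<^bsub>G\<^esub> t) \<in> carrier G" using a r by (simp flip: r_def)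
    show "t \<in> T" by (rule t)
    have "inv\<^bsub>G\<^esub> (inv\<^bsub>G\<^esub> r \<otimes>\<^bsub>G\<^esub> (a \<otimes>\<^bsub>G\<^esub> t)) \<in> H" using r(2) by simp
    moreover have "inv\<^bsub>G\<^esub> (inv\<^bsub>G\<^esub> r \<otimes>\<^bsub>G\<^esub> (a \<otimes>\<^bsub>G\<^esub> t)) = inv\<^bsub>G\<^esub> t \<otimes>\<^bsub>G\<^esub> (inv\<^bsub>G\<^esub> a \<otimes>\<^bsub>G\<^esub> r)"
      using a tG r(1) by (simp add: G.inv_mult_group G.m_assoc)
    ultimately show "inv\<^bsub>G\<^esub> t \<otimes>\<^bsub>G\<^esub> (inv\<^bsub>G\<^esub> a \<otimes>\<^bsub>G\<^esub> rep (a \<otimes>\<^bsub>G\<^esub> t)) \<in> H" by (simp add: r_def)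
  qed
  show ?thesis
  proof (rule sum.reindex_bij_witness[where i = "\<lambda>t. rep (inv\<^bsub>G\<^esub> g \<otimes>\<^bsub>G\<^esub> t)" and j = "\<lambda>t. rep (g \<otimes>\<^bsub>G\<^esub> t)"])
    fix t assume t: "t \<in> T"
    then have tG: "t \<in> carrier G" using T(1) by blast
    show "rep (inv\<^bsub>G\<^esub> g \<otimes>\<^bsub>G\<^esub> rep (g \<otimes>\<^bsub>G\<^esub> t)) = t" by (rule inverse[OF g t])
    show "rep (g \<otimes>\<^bsub>G\<^esub> rep (inv\<^bsub>G\<^esub> g \<otimes>\<^bsub>G\<^esub> t)) = t" using inverse[OF G.inv_closed[OF g] t] g by simp
    show "rep (g \<otimes>\<^bsub>G\<^esub> t) \<in> T" "rep (inv\<^bsub>G\<^esub> g \<otimes>\<^bsub>G\<^esub> t) \<in> T" using rep g tG by auto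
    show "F (rep (g \<otimes>\<^bsub>G\<^esub> t)) = F (g \<otimes>\<^bsub>G\<^esub> t)" using F_rep g tG by simp
  qed
qed

lemma act_mult_kernel:
  assumes "g \<in> carrier G" "h \<in> H" "x \<in> L"
  shows "\<rho> (g \<otimes>\<^bsub>G\<^esub> h) x = \<rho> g x"
proof -
  have h: "h \<in> carrier G" using assms(2) H by (rule subgroup.mem_carrier[rotated])
  then have "\<rho> h x = x" using kernel[OF h] assms by blast
  then show ?thesis using act_mult[OF assms(1) h assms(3)] by simp
qed

end

text \<open>\<open>H / N\<close> is cyclic of order \<open>p\<close>, generated by the class of
  \<open>z\<close>; \<open>G / N\<close> is a central extension of \<open>G / H\<close> by
  it.\<close>

locale tower_step = tower_data G \<rho> L H R T \<theta>
  for G :: "('g, 'm) monoid_scheme" and \<rho> :: "'g \<Rightarrow> 'p::prime_card ratfun alg_closure \<Rightarrow> 'p ratfun alg_closure"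
    and L H R T \<theta> +
  fixes N :: "'g set" and z :: 'g
  assumes N: "subgroup N G" "N \<subseteq> H" and z: "z \<in> H" "z \<notin> N" "z [^]\<^bsub>G\<^esub> CARD('p) \<in> N"
    and gen: "h \<in> H \<Longrightarrow> \<exists>n\<in>N. \<exists>i :: nat. h = n \<otimes>\<^bsub>G\<^esub> z [^]\<^bsub>G\<^esub> i"
begin

section \<open>The character of H / N\<close>

lemma zG: "z \<in> carrier G"
  using z(1) H by (rule subgroup.mem_carrier[rotated])

lemma HG: "h \<in> H \<Longrightarrow> h \<in> carrier G"
  using H by (rule subgroup.mem_carrier)

lemma z_pow_mem: "z [^]\<^bsub>G\<^esub> (i :: nat) \<in> N \<longleftrightarrow> CARD('p) dvd i"
proof -
  interpret G: comm_group G by (rule comm)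
  interpret N: subgroup N G by (rule N)
  have mult: "z [^]\<^bsub>G\<^esub> (CARD('p) * k) \<in> N" for k :: nat
  proof (induction k)
    case (Suc k)
    have "z [^]\<^bsub>G\<^esub> (CARD('p) * Suc k) = z [^]\<^bsub>G\<^esub> CARD('p) \<otimes>\<^bsub>G\<^esub> z [^]\<^bsub>G\<^esub> (CARD('p) * k)"
      using zG by (simp add: G.nat_pow_mult)
    then show ?case using Suc z(3) by simp
  qed simp
  show ?thesis
  proof
    assume zi: "z [^]\<^bsub>G\<^esub> i \<in> N"
    show "CARD('p) dvd i"
    proof (rule ccontr)
      assume "\<not> CARD('p) dvd i"
      then have "coprime i CARD('p)" using prime_imp_coprime[OF prime_card] by (simp add: coprime_commute)
      then obtain a where a: "[i * a = 1] (mod CARD('p))" using cong_solve_coprime_nat by auto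
      have pow: "z [^]\<^bsub>G\<^esub> (i * k) \<in> N" for k
      proof (induction k)
        case (Suc k)
        have "z [^]\<^bsub>G\<^esub> (i * Suc k) = z [^]\<^bsub>G\<^esub> i \<otimes>\<^bsub>G\<^esub> z [^]\<^bsub>G\<^esub> (i * k)"
          using zG by (simp add: G.nat_pow_mult)
        then show ?case using Suc zi by simp
      qed simp
      define q where "q = i * a div CARD('p)"
      have ia: "i * a = 1 + CARD('p) * q"
        using a nontriv[where 'a = 'p] unfolding cong_def q_def
        by (metis mult_div_mod_eq add.commute mod_less)
      have "z [^]\<^bsub>G\<^esub> (1 + CARD('p) * q) = z \<otimes>\<^bsub>G\<^esub> z [^]\<^bsub>G\<^esub> (CARD('p) * q)"
        using zG by (simp add: G.m_comm flip: G.nat_pow_mult)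
      then have "z = z [^]\<^bsub>G\<^esub> (i * a) \<otimes>\<^bsub>G\<^esub> inv\<^bsub>G\<^esub> (z [^]\<^bsub>G\<^esub> (CARD('p) * q))"
        using zG by (simp add: ia G.m_assoc)
      then have "z \<in> N" using pow[of a] mult[of q] by (metis N.m_closed N.m_inv_closed)
      then show False using z(2) by contradiction
    qed
  next
    assume "CARD('p) dvd i"
    then show "z [^]\<^bsub>G\<^esub> i \<in> N" using mult by (elim dvdE) simp
  qed
qed

text \<open>The exponent is a choice, determined only modulo \<open>p\<close>; its image
  \<open>\<chi>F\<close> in the prime field is the character of \<open>H\<close> with kernel
  \<open>N\<close>.\<close>

definition \<chi> :: "'g \<Rightarrow> nat" where
  "\<chi> h = (SOME i. \<exists>n\<in>N. h = n \<otimes>\<^bsub>G\<^esub> z [^]\<^bsub>G\<^esub> i)"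

definition \<chi>F :: "'g \<Rightarrow> 'p ratfun alg_closure" where "\<chi>F h = of_nat (\<chi> h)"

lemma of_nat_eq_iff_F:
  "of_nat i = (of_nat j :: 'p ratfun alg_closure) \<longleftrightarrow> [i = j] (mod CARD('p))"
proof -
  have aux: "of_nat i = (of_nat j :: 'p ratfun alg_closure) \<longleftrightarrow> [i = j] (mod CARD('p))" if "j \<le> i" for i j
  proof -
    have "of_nat i = (of_nat j :: 'p ratfun alg_closure) \<longleftrightarrow> of_nat (i - j) = (0 :: 'p ratfun alg_closure)"
      using that by (simp add: of_nat_diff)
    also have "\<dots> \<longleftrightarrow> CARD('p) dvd i - j"
      by (simp only: of_nat_eq_0_iff_char_dvd CHAR_ratfun_ac)
    also have "\<dots> \<longleftrightarrow> [i = j] (mod CARD('p))" using that by (simp add: cong_altdef_nat)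
    finally show ?thesis .
  qed
  show ?thesis using aux[of i j] aux[of j i] by (metis cong_sym nat_le_linear)
qed

lemma \<chi>F_eq:
  assumes "n \<in> N"
  shows "\<chi>F (n \<otimes>\<^bsub>G\<^esub> z [^]\<^bsub>G\<^esub> i) = of_nat i"
proof -
  interpret G: comm_group G by (rule comm)
  interpret N: subgroup N G by (rule N)
  define j where "j = \<chi> (n \<otimes>\<^bsub>G\<^esub> z [^]\<^bsub>G\<^esub> i)"
  have "\<exists>m\<in>N. n \<otimes>\<^bsub>G\<^esub> z [^]\<^bsub>G\<^esub> i = m \<otimes>\<^bsub>G\<^esub> z [^]\<^bsub>G\<^esub> j"
    unfolding j_def \<chi>_def by (rule someI_ex) (use assms in blast)
  then obtain m where m: "m \<in> N" "n \<otimes>\<^bsub>G\<^esub> z [^]\<^bsub>G\<^esub> i = m \<otimes>\<^bsub>G\<^esub> z [^]\<^bsub>G\<^esub> j" by blast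
  have aux: "of_nat i = (of_nat j :: 'p ratfun alg_closure)"
    if "n \<in> N" "m \<in> N" "n \<otimes>\<^bsub>G\<^esub> z [^]\<^bsub>G\<^esub> i = m \<otimes>\<^bsub>G\<^esub> z [^]\<^bsub>G\<^esub> j" "j \<le> i" for n m i j
  proof -
    have nm: "n \<in> carrier G" "m \<in> carrier G" using that by (auto intro: N.mem_carrier)
    have "z [^]\<^bsub>G\<^esub> i = z [^]\<^bsub>G\<^esub> (i - j) \<otimes>\<^bsub>G\<^esub> z [^]\<^bsub>G\<^esub> j" using zG that(4) by (simp add: G.nat_pow_mult)
    then have "(n \<otimes>\<^bsub>G\<^esub> z [^]\<^bsub>G\<^esub> (i - j)) \<otimes>\<^bsub>G\<^esub> z [^]\<^bsub>G\<^esub> j = m \<otimes>\<^bsub>G\<^esub> z [^]\<^bsub>G\<^esub> j"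
      using that(3) nm zG by (simp add: G.m_assoc)
    then have "n \<otimes>\<^bsub>G\<^esub> z [^]\<^bsub>G\<^esub> (i - j) = m" using nm zG by simp
    then have "z [^]\<^bsub>G\<^esub> (i - j) = inv\<^bsub>G\<^esub> n \<otimes>\<^bsub>G\<^esub> m" using nm zG by (simp add: G.inv_solve_left)
    then have "z [^]\<^bsub>G\<^esub> (i - j) \<in> N" using that(1,2) by simp
    then have "CARD('p) dvd i - j" by (simp only: z_pow_mem)
    then show ?thesis using that(4) by (simp add: of_nat_eq_iff_F cong_altdef_nat)
  qed
  have "of_nat i = (of_nat j :: 'p ratfun alg_closure)"
    using aux[OF assms m] aux[OF m(1) assms m(2)[symmetric]] by (metis nat_le_linear)
  then show ?thesis by (simp add: \<chi>F_def j_def)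
qed

lemma \<chi>F_add:
  assumes "g \<in> H" "h \<in> H"
  shows "\<chi>F (g \<otimes>\<^bsub>G\<^esub> h) = \<chi>F g + \<chi>F h"
proof -
  interpret G: comm_group G by (rule comm)
  interpret N: subgroup N G by (rule N)
  obtain m i where mi: "m \<in> N" "g = m \<otimes>\<^bsub>G\<^esub> z [^]\<^bsub>G\<^esub> (i :: nat)" using gen[OF assms(1)] by blast
  obtain n j where nj: "n \<in> N" "h = n \<otimes>\<^bsub>G\<^esub> z [^]\<^bsub>G\<^esub> (j :: nat)" using gen[OF assms(2)] by blast
  have "g \<otimes>\<^bsub>G\<^esub> h = (m \<otimes>\<^bsub>G\<^esub> n) \<otimes>\<^bsub>G\<^esub> z [^]\<^bsub>G\<^esub> (i + j)"
    using mi nj zG N.mem_carrier by (simp add: G.m_ac flip: G.nat_pow_mult)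
  then show ?thesis using \<chi>F_eq mi nj by simp
qed

lemma \<chi>F_z: "\<chi>F (z [^]\<^bsub>G\<^esub> (i :: nat)) = of_nat i"
proof -
  interpret G: comm_group G by (rule comm)
  interpret N: subgroup N G by (rule N)
  show ?thesis using \<chi>F_eq[of "\<one>\<^bsub>G\<^esub>" i] zG by simp
qed

lemma \<chi>F_eq_0_iff:
  assumes "h \<in> H"
  shows "\<chi>F h = 0 \<longleftrightarrow> h \<in> N"
proof -
  interpret G: comm_group G by (rule comm)
  interpret N: subgroup N G by (rule N)
  obtain n i where ni: "n \<in> N" "h = n \<otimes>\<^bsub>G\<^esub> z [^]\<^bsub>G\<^esub> (i :: nat)" using gen[OF assms] by blast
  have nG: "n \<in> carrier G" using ni(1) by (rule N.mem_carrier)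
  have "\<chi>F h = 0 \<longleftrightarrow> CARD('p) dvd i"
    unfolding ni(2) \<chi>F_eq[OF ni(1)] by (simp only: of_nat_eq_0_iff_char_dvd CHAR_ratfun_ac)
  also have "\<dots> \<longleftrightarrow> z [^]\<^bsub>G\<^esub> i \<in> N" by (simp add: z_pow_mem)
  also have "\<dots> \<longleftrightarrow> h \<in> N"
  proof
    assume "h \<in> N"
    moreover have "z [^]\<^bsub>G\<^esub> i = inv\<^bsub>G\<^esub> n \<otimes>\<^bsub>G\<^esub> h" using ni(2) nG zG by (simp add: G.m_assoc[symmetric])
    ultimately show "z [^]\<^bsub>G\<^esub> i \<in> N" using ni(1) by simp
  qed (use ni in simp)
  finally show ?thesis .
qed

text \<open>The averaging construction of a 1-cocycle \<open>B\<close> with values in \<open>R\<close> that extends the character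
  \<open>\<chi>F\<close> of \<open>H / N\<close>; \<open>artin_schreier \<circ> B\<close> is the coboundary of \<open>a0\<close>.\<close>

definition \<chi>T :: "'g \<Rightarrow> 'p ratfun alg_closure" where
  "\<chi>T g = \<chi>F (inv\<^bsub>G\<^esub> (rep g) \<otimes>\<^bsub>G\<^esub> g)"

definition B :: "'g \<Rightarrow> 'p ratfun alg_closure" where
  "B g = (\<Sum>t\<in>T. (\<chi>T (g \<otimes>\<^bsub>G\<^esub> t) - \<chi>T t) * \<rho> (g \<otimes>\<^bsub>G\<^esub> t) \<theta>)"

definition a0 :: "'p ratfun alg_closure" where
  "a0 = - (\<Sum>t\<in>T. artin_schreier (B t) * \<rho> t \<theta>)"

text \<open>This makes \<open>\<chi>T (g \<otimes> t) - \<chi>T t\<close> depend only on the coset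
  of \<open>t\<close>, so that the sum defining \<open>B g\<close> is independent of the
  transversal.\<close>

lemma \<chi>T_mult:
  assumes "g \<in> carrier G" "h \<in> H"
  shows "\<chi>T (g \<otimes>\<^bsub>G\<^esub> h) = \<chi>T g + \<chi>F h"
proof -
  interpret G: comm_group G by (rule comm)
  interpret H: subgroup H G by (rule H)
  have hG: "h \<in> carrier G" using assms(2) by (rule HG)
  define t where "t = rep g"
  have t: "t \<in> T" "t \<in> carrier G" "inv\<^bsub>G\<^esub> t \<otimes>\<^bsub>G\<^esub> g \<in> H" using rep[OF assms(1)] T(1) by (auto simp: t_def)
  have eq: "inv\<^bsub>G\<^esub> t \<otimes>\<^bsub>G\<^esub> (g \<otimes>\<^bsub>G\<^esub> h) = (inv\<^bsub>G\<^esub> t \<otimes>\<^bsub>G\<^esub> g) \<otimes>\<^bsub>G\<^esub> h"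
    using t assms hG by (simp add: G.m_assoc)
  have "rep (g \<otimes>\<^bsub>G\<^esub> h) = t"
    by (rule rep_unique) (use t assms hG eq in auto)
  then show ?thesis unfolding \<chi>T_def t_def[symmetric] using \<chi>F_add[OF t(3) assms(2)] eq by simp
qed

lemma \<chi>T_mem: "subring_set S \<Longrightarrow> \<chi>T g \<in> S"
  by (simp add: \<chi>T_def \<chi>F_def subring_set_of_nat)

lemma act_\<chi>T: "g \<in> carrier G \<Longrightarrow> \<rho> g (\<chi>T h) = \<chi>T h"
  using hom_on.hom_of_nat[OF act_hom] by (simp add: \<chi>T_def \<chi>F_def)

lemma Lring: "subring_set L"
  using L by blast

lemma \<theta>L: "\<theta> \<in> L"
  using \<theta>(1) R_L by blast

lemma act_\<theta>: "g \<in> carrier G \<Longrightarrow> \<rho> g \<theta> \<in> R"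
  using act_R \<theta>(1) by blast

lemma B_R: "g \<in> carrier G \<Longrightarrow> B g \<in> R"
proof -
  interpret G: comm_group G by (rule comm)
  assume g: "g \<in> carrier G"
  show ?thesis unfolding B_def
    using T(1) g by (intro subring_set_sum[OF R] subring_set_mult[OF R] subring_set_diff[OF R] \<chi>T_mem[OF R] act_\<theta>) auto
qed

lemma B_L: "g \<in> carrier G \<Longrightarrow> B g \<in> L"
  using B_R R_L by blast

text \<open>Shifting the transversal by \<open>h\<close> in \<open>B g\<close> turns its weights
  into \<open>\<chi>T (g \<otimes> h \<otimes> t) - \<chi>T (h \<otimes> t)\<close>, which telescope
  with those of \<open>\<rho> g (B h)\<close>.\<close>

lemma B_cocycle:
  assumes g: "g \<in> carrier G" and h: "h \<in> carrier G"
  shows "B (g \<otimes>\<^bsub>G\<^esub> h) = B g + \<rho> g (B h)"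
proof -
  interpret G: comm_group G by (rule comm)
  interpret g: hom_on L "\<rho> g" by (rule act_hom[OF g])
  have TG: "t \<in> carrier G" if "t \<in> T" for t using that T(1) by blast
  define F where "F x = (\<chi>T (g \<otimes>\<^bsub>G\<^esub> x) - \<chi>T x) * \<rho> (g \<otimes>\<^bsub>G\<^esub> x) \<theta>" for x
  have "F (x \<otimes>\<^bsub>G\<^esub> k) = F x" if x: "x \<in> carrier G" and k: "k \<in> H" for x k
  proof -
    have e: "g \<otimes>\<^bsub>G\<^esub> (x \<otimes>\<^bsub>G\<^esub> k) = (g \<otimes>\<^bsub>G\<^esub> x) \<otimes>\<^bsub>G\<^esub> k" using g x HG[OF k] by (simp add: G.m_assoc)
    have gx: "g \<otimes>\<^bsub>G\<^esub> x \<in> carrier G" using g x by simp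
    show ?thesis unfolding F_def e
      using \<chi>T_mult[OF gx k] \<chi>T_mult[OF x k] act_mult_kernel[OF gx k \<theta>L] by simp
  qed
  then have "(\<Sum>t\<in>T. F (h \<otimes>\<^bsub>G\<^esub> t)) = (\<Sum>t\<in>T. F t)" by (rule sum_transversal_shift[OF h])
  then have Bg: "B g = (\<Sum>t\<in>T. F (h \<otimes>\<^bsub>G\<^esub> t))" by (simp add: B_def F_def)
  have mem: "(\<chi>T (h \<otimes>\<^bsub>G\<^esub> t) - \<chi>T t) * \<rho> (h \<otimes>\<^bsub>G\<^esub> t) \<theta> \<in> L" if "t \<in> T" for t
    using TG[OF that] h R_L act_\<theta>[of "h \<otimes>\<^bsub>G\<^esub> t"]
    by (intro subring_set_mult[OF Lring] subring_set_diff[OF Lring] \<chi>T_mem[OF Lring]) auto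
  have "\<rho> g (B h) = (\<Sum>t\<in>T. \<rho> g ((\<chi>T (h \<otimes>\<^bsub>G\<^esub> t) - \<chi>T t) * \<rho> (h \<otimes>\<^bsub>G\<^esub> t) \<theta>))"
    unfolding B_def by (rule g.hom_sum[OF mem])
  also have "\<dots> = (\<Sum>t\<in>T. (\<chi>T (h \<otimes>\<^bsub>G\<^esub> t) - \<chi>T t) * \<rho> (g \<otimes>\<^bsub>G\<^esub> h \<otimes>\<^bsub>G\<^esub> t) \<theta>)"
  proof (rule sum.cong[OF refl])
    fix t assume "t \<in> T"
    then have t: "t \<in> carrier G" by (rule TG)
    have ht: "h \<otimes>\<^bsub>G\<^esub> t \<in> carrier G" using h t by simp
    have "\<rho> g ((\<chi>T (h \<otimes>\<^bsub>G\<^esub> t) - \<chi>T t) * \<rho> (h \<otimes>\<^bsub>G\<^esub> t) \<theta>)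
      = (\<chi>T (h \<otimes>\<^bsub>G\<^esub> t) - \<chi>T t) * \<rho> g (\<rho> (h \<otimes>\<^bsub>G\<^esub> t) \<theta>)"
      using g.hom_mult[OF subring_set_diff[OF Lring \<chi>T_mem[OF Lring] \<chi>T_mem[OF Lring]] act_closed[OF ht \<theta>L]]
        g.hom_diff[OF \<chi>T_mem[OF Lring] \<chi>T_mem[OF Lring]] act_\<chi>T[OF g] by simp
    also have "\<rho> g (\<rho> (h \<otimes>\<^bsub>G\<^esub> t) \<theta>) = \<rho> (g \<otimes>\<^bsub>G\<^esub> h \<otimes>\<^bsub>G\<^esub> t) \<theta>"
      using act_mult[OF g ht \<theta>L] g h t by (simp add: G.m_assoc)
    finally show "\<rho> g ((\<chi>T (h \<otimes>\<^bsub>G\<^esub> t) - \<chi>T t) * \<rho> (h \<otimes>\<^bsub>G\<^esub> t) \<theta>)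
      = (\<chi>T (h \<otimes>\<^bsub>G\<^esub> t) - \<chi>T t) * \<rho> (g \<otimes>\<^bsub>G\<^esub> h \<otimes>\<^bsub>G\<^esub> t) \<theta>" .
  qed
  finally have "B g + \<rho> g (B h) = (\<Sum>t\<in>T. F (h \<otimes>\<^bsub>G\<^esub> t) + (\<chi>T (h \<otimes>\<^bsub>G\<^esub> t) - \<chi>T t) * \<rho> (g \<otimes>\<^bsub>G\<^esub> h \<otimes>\<^bsub>G\<^esub> t) \<theta>)"
    by (simp add: Bg sum.distrib)
  also have "\<dots> = B (g \<otimes>\<^bsub>G\<^esub> h)" unfolding B_def
    by (rule sum.cong[OF refl]) (use TG g h in \<open>simp add: F_def G.m_assoc algebra_simps\<close>)
  finally show ?thesis by simp
qed

text \<open>As \<open>G\<close> is commutative, \<open>h \<otimes> t = t \<otimes> h\<close>, so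
  every weight is \<open>\<chi>F h\<close>, and the trace of \<open>\<theta>\<close> is 1.\<close>

lemma B_H:
  assumes h: "h \<in> H"
  shows "B h = \<chi>F h"
proof -
  interpret G: comm_group G by (rule comm)
  have "B h = (\<Sum>t\<in>T. \<chi>F h * \<rho> t \<theta>)"
    unfolding B_def
  proof (rule sum.cong[OF refl])
    fix t assume "t \<in> T"
    then have t: "t \<in> carrier G" using T(1) by blast
    have "h \<otimes>\<^bsub>G\<^esub> t = t \<otimes>\<^bsub>G\<^esub> h" using t HG[OF h] by (rule G.m_comm[rotated])
    then show "(\<chi>T (h \<otimes>\<^bsub>G\<^esub> t) - \<chi>T t) * \<rho> (h \<otimes>\<^bsub>G\<^esub> t) \<theta> = \<chi>F h * \<rho> t \<theta>"
      using \<chi>T_mult[OF t h] act_mult_kernel[OF t h \<theta>L] by simp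
  qed
  then show ?thesis using \<theta>(2) by (simp flip: sum_distrib_left)
qed

lemma as_B_cocycle:
  assumes g: "g \<in> carrier G" and h: "h \<in> carrier G"
  shows "artin_schreier (B (g \<otimes>\<^bsub>G\<^esub> h)) = artin_schreier (B g) + \<rho> g (artin_schreier (B h))"
proof -
  interpret g: hom_on L "\<rho> g" by (rule act_hom[OF g])
  have "\<rho> g (artin_schreier (B h)) = artin_schreier (\<rho> g (B h))"
    unfolding artin_schreier_def
    using g.hom_diff[OF subring_set_power[OF Lring B_L[OF h]] B_L[OF h]] g.hom_power[OF B_L[OF h]] by simp
  then show ?thesis using B_cocycle[OF g h] artin_schreier_add[OF prime_CHAR_ratfun_ac] by simp
qed

lemma as_B_H: "h \<in> H \<Longrightarrow> artin_schreier (B h) = 0"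
  using of_nat_power_CHAR[OF prime_CHAR_ratfun_ac, of "\<chi> h"] by (simp add: B_H \<chi>F_def artin_schreier_def)

lemma as_B_R: "g \<in> carrier G \<Longrightarrow> artin_schreier (B g) \<in> R"
  unfolding artin_schreier_def by (intro subring_set_diff[OF R] subring_set_power[OF R] B_R)

lemma a0_R: "a0 \<in> R"
  unfolding a0_def using T(1)
  by (intro subring_set_uminus[OF R] subring_set_sum[OF R] subring_set_mult[OF R] as_B_R act_\<theta>) auto

text \<open>Additive Hilbert 90. By the cocycle relation \<open>g\<close> maps the summand at
  \<open>t\<close> to the one at \<open>g \<otimes> t\<close> minus
  \<open>artin_schreier (B g)\<close> times \<open>\<rho> (g \<otimes> t) \<theta>\<close>;
  summation over the transversal and trace 1 give the claim.\<close>

lemma act_a0: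
  assumes g: "g \<in> carrier G"
  shows "\<rho> g a0 = a0 + artin_schreier (B g)"
proof -
  interpret G: comm_group G by (rule comm)
  interpret g: hom_on L "\<rho> g" by (rule act_hom[OF g])
  have TG: "t \<in> carrier G" if "t \<in> T" for t using that T(1) by blast
  define F where "F x = artin_schreier (B x) * \<rho> x \<theta>" for x
  have FL: "F x \<in> L" if "x \<in> carrier G" for x
    unfolding F_def using as_B_R[OF that] act_\<theta>[OF that] R_L by (intro subring_set_mult[OF Lring]) auto
  have "F (x \<otimes>\<^bsub>G\<^esub> k) = F x" if x: "x \<in> carrier G" and k: "k \<in> H" for x k
    unfolding F_def
    using as_B_cocycle[OF x HG[OF k]] as_B_H[OF k] hom_on.hom_0[OF act_hom[OF x]]
      act_mult_kernel[OF x k \<theta>L] by simp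
  then have F_shift: "(\<Sum>t\<in>T. F (g \<otimes>\<^bsub>G\<^esub> t)) = (\<Sum>t\<in>T. F t)" by (rule sum_transversal_shift[OF g])
  have \<theta>_shift: "(\<Sum>t\<in>T. \<rho> (g \<otimes>\<^bsub>G\<^esub> t) \<theta>) = (\<Sum>t\<in>T. \<rho> t \<theta>)"
    by (rule sum_transversal_shift[OF g]) (rule act_mult_kernel[OF _ _ \<theta>L])
  have FT: "F t \<in> L" if "t \<in> T" for t using FL TG that by blast
  have "\<rho> g a0 = - (\<Sum>t\<in>T. \<rho> g (F t))"
    unfolding a0_def F_def[symmetric]
    using g.hom_uminus[OF subring_set_sum[OF Lring, of T F]] g.hom_sum[of T F] FT by simp
  also have "(\<Sum>t\<in>T. \<rho> g (F t)) = (\<Sum>t\<in>T. F (g \<otimes>\<^bsub>G\<^esub> t) - artin_schreier (B g) * \<rho> (g \<otimes>\<^bsub>G\<^esub> t) \<theta>)"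
  proof (rule sum.cong[OF refl])
    fix t assume "t \<in> T"
    then have t: "t \<in> carrier G" by (rule TG)
    have "\<rho> g (F t) = \<rho> g (artin_schreier (B t)) * \<rho> (g \<otimes>\<^bsub>G\<^esub> t) \<theta>"
      unfolding F_def using g.hom_mult[of "artin_schreier (B t)" "\<rho> t \<theta>"] as_B_R[OF t] act_\<theta>[OF t] R_L
        act_mult[OF g t \<theta>L] by auto
    then show "\<rho> g (F t) = F (g \<otimes>\<^bsub>G\<^esub> t) - artin_schreier (B g) * \<rho> (g \<otimes>\<^bsub>G\<^esub> t) \<theta>"
      by (simp add: F_def as_B_cocycle[OF g t] algebra_simps)
  qed
  also have "\<dots> = (\<Sum>t\<in>T. F t) - artin_schreier (B g) * 1"
    unfolding sum_subtractf F_shift sum_distrib_left[symmetric] \<theta>_shift \<theta>(2) ..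
  finally show ?thesis by (simp add: a0_def F_def)
qed

end

section \<open>Choice of the twist by a power of t\<close>

lemma to_ac_const_of_fixed:
  fixes j :: "'p::prime_card ratfun"
  assumes "j ^ CARD('p) = j"
  shows "j = 0 \<or> inf_place j = 0"
proof -
  have "to_ac j ^ CARD('p) = to_ac j" using assms by (simp flip: to_ac_power)
  then have "to_ac j \<in> range (\<lambda>c. to_ac (ratfun_const c))" by (rule power_CHAR_fixed_is_const)
  then obtain c where "j = ratfun_const c" by auto
  then show ?thesis using place_const[OF place_inf_place, of c] by (cases "c = 0") (auto simp: ratfun_const_def)
qed

text \<open>The left side has a pole of order \<open>n\<close> at infinity, not divisible by
  \<open>p\<close>, while a pole of the right side has order divisible by \<open>p\<close>.\<close>

lemma monom_diff_not_artin_schreier: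
  assumes "m < n" "\<not> CARD('p) dvd n" "j ^ CARD('p) = (j :: 'p::prime_card ratfun)"
  shows "to_fract (monom 1 n - monom 1 m) \<noteq> artin_schreier h + j"
proof
  define d :: "'p mod_ring poly" where "d = monom 1 n - monom 1 m"
  assume eq: "to_fract (monom 1 n - monom 1 m) = artin_schreier h + j"
  have c: "coeff d n = 1" using assms(1) by (simp add: d_def)
  then have d0: "d \<noteq> 0" by auto
  have "degree d \<le> n" unfolding d_def using assms(1)
    by (intro degree_diff_le) (auto intro: order.trans[OF degree_monom_le])
  moreover have "n \<le> degree d" using c by (intro le_degree) simp
  ultimately have deg: "degree d = n" by simp
  have vd: "inf_place (to_fract d) = - int n" using inf_place_poly[OF d0] deg by simp
  have "int CARD('p) dvd inf_place (to_fract d)"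
  proof (rule artin_schreier_pole_dvd[OF place_inf_place, of _ h j])
    show "to_fract d = artin_schreier h + j" using eq by (simp add: d_def)
    show "j = 0 \<or> inf_place j = 0" by (rule to_ac_const_of_fixed[OF assms(3)])
    show "to_fract d \<noteq> 0" "inf_place (to_fract d) < 0" using d0 vd assms(1) by simp_all
  qed
  then show False using vd assms(2) by simp
qed

lemma val_integral_of_artin_schreier:
  assumes F: "subfield_set F" and v: "valuation_on F v" and p: "CHAR('a::field) > 1"
    and y: "y \<in> F" and int: "artin_schreier (y :: 'a) = 0 \<or> v (artin_schreier y) \<ge> 0"
  shows "y = 0 \<or> v y \<ge> 0"
proof (rule ccontr)
  note Fr = subfield_set_imp_subring_set[OF F]
  assume "\<not> ?thesis"
  then have neg: "y \<noteq> 0" "v y < 0" by auto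
  have vp: "v (y ^ CHAR('a)) = int CHAR('a) * v y" by (rule val_power[OF F v y neg(1)])
  have lt: "int CHAR('a) * v y < v y" using p neg(2) by (simp add: mult_less_cancel_right1)
  then have lt': "v (y ^ CHAR('a)) < v (- y)" using vp val_minus[OF F v y neg(1)] by simp
  have m: "y ^ CHAR('a) \<in> F" "- y \<in> F" using y by (auto intro: subring_set_power[OF Fr] subring_set_uminus[OF Fr])
  have "y ^ CHAR('a) + - y \<noteq> 0" "v (y ^ CHAR('a) + - y) = v (y ^ CHAR('a))"
    using val_add_eq[OF F v m(1) _ m(2) _ lt'] neg(1) by auto
  then show False using int vp lt neg(2) by (auto simp: artin_schreier_def)
qed

context tower_step
begin

text \<open>If \<open>a0 + t ^ m = l ^ p - l + j\<close> for all \<open>m = p k + 1\<close>, then \<open>g \<mapsto> g l - l - B g\<close> takes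
  values in the finite prime field, hence coincides for two of the exponents. The difference of the
  two \<open>l\<close> is then fixed by \<open>G\<close>, contradicting the order of the pole of \<open>t ^ m - t ^ m'\<close> at infinity.\<close>

lemma exists_twist:
  obtains m where "\<And>l j. l \<in> L \<Longrightarrow> j ^ CARD('p) = j \<Longrightarrow>
    a0 + pol (monom 1 m) \<noteq> artin_schreier l + j"
proof -
  let ?p = "CARD('p)"
  \<comment> \<open>Exponents prime to \<open>p\<close>, so that the difference of two of these
    monomials still has a pole of order prime to \<open>p\<close>.\<close>
  let ?\<alpha> = "\<lambda>k. a0 + pol (monom 1 (?p * k + 1))"
  let ?Fp = "{x :: 'p ratfun alg_closure. x ^ ?p = x}"
  have "\<exists>k. \<forall>l\<in>L. \<forall>j. j ^ ?p = j \<longrightarrow> ?\<alpha> k \<noteq> artin_schreier l + j"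
  proof (rule ccontr)
    assume "\<not> ?thesis"
    then have "\<forall>k. \<exists>l j. l \<in> L \<and> j ^ ?p = j \<and> ?\<alpha> k = artin_schreier l + j" by blast
    then obtain l j where lj: "\<And>k. l k \<in> L" "\<And>k. j k ^ ?p = j k" "\<And>k. ?\<alpha> k = artin_schreier (l k) + j k"
      by metis
    \<comment> \<open>Restricted to \<open>carrier G\<close>, so that all \<open>\<kappa> k\<close>
      lie in one finite function space. The term \<open>B g\<close> does not depend on
      \<open>k\<close> and cancels when two of them agree.\<close>
    define \<kappa> where "\<kappa> k = (\<lambda>g\<in>carrier G. \<rho> g (l k) - l k - B g)" for k
    have "?Fp \<subseteq> of_nat ` {..<?p}"
      using power_CHAR_fixed_iff[OF prime_CHAR_ratfun_ac] unfolding CHAR_ratfun_ac by blast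
    then have finFp: "finite ?Fp" by (rule finite_subset) simp
    have \<kappa>: "\<kappa> k \<in> carrier G \<rightarrow>\<^sub>E ?Fp" for k
    proof -
      have "\<rho> g (l k) - l k - B g \<in> ?Fp" if g: "g \<in> carrier G" for g
      proof -
        interpret g: hom_on L "\<rho> g" by (rule act_hom[OF g])
        have jF: "\<rho> g (j k) = j k"
        proof -
          have "j k ^ CHAR('p ratfun alg_closure) = j k" using lj(2) unfolding CHAR_ratfun_ac .
          then obtain i where "j k = of_nat i" using power_CHAR_fixed_iff[OF prime_CHAR_ratfun_ac] by blast
          then show ?thesis by (simp add: g.hom_of_nat)
        qed
        have jL: "j k \<in> L"
        proof -
          have "j k \<in> range (\<lambda>c. to_ac (ratfun_const c))" by (rule power_CHAR_fixed_is_const[OF lj(2)])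
          then show ?thesis using K_L by auto
        qed
        have asL: "artin_schreier (l k) \<in> L" unfolding artin_schreier_def
          by (intro subring_set_diff[OF Lring] subring_set_power[OF Lring] lj)
        have g_as: "\<rho> g (artin_schreier (l k)) = artin_schreier (\<rho> g (l k))"
          unfolding artin_schreier_def
          using g.hom_diff[OF subring_set_power[OF Lring lj(1)] lj(1)] g.hom_power[OF lj(1)] by simp
        have a0L: "a0 \<in> L" using a0_R R_L by blast
        have polK: "pol s \<in> range to_ac" for s :: "'p mod_ring poly" by (simp add: pol_def)
        have "\<rho> g (?\<alpha> k) = ?\<alpha> k + artin_schreier (B g)"
          using g.hom_add[OF a0L subsetD[OF K_L polK]] act_K[OF g polK] act_a0[OF g] by (simp add: algebra_simps)
        moreover have "\<rho> g (?\<alpha> k) = artin_schreier (\<rho> g (l k)) + j k"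
          unfolding lj(3) using g.hom_add[OF asL jL] g_as jF by simp
        ultimately have "artin_schreier (\<rho> g (l k)) = artin_schreier (l k) + artin_schreier (B g)"
          unfolding lj(3) by simp
        then have "artin_schreier (\<rho> g (l k) - l k - B g) = 0"
          by (simp add: artin_schreier_diff[OF prime_CHAR_ratfun_ac])
        then show ?thesis unfolding artin_schreier_def CHAR_ratfun_ac by simp
      qed
      then show ?thesis by (auto simp: \<kappa>_def)
    qed
    have "\<not> inj \<kappa>"
    proof
      assume "inj \<kappa>"
      moreover have "range \<kappa> \<subseteq> carrier G \<rightarrow>\<^sub>E ?Fp" using \<kappa> by blast
      moreover have "finite (carrier G \<rightarrow>\<^sub>E ?Fp)" by (rule finite_PiE[OF fin_G finFp])
      ultimately show False by (meson finite_imageD finite_subset infinite_UNIV_nat)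
    qed
    then obtain k k' where kk: "k < k'" "\<kappa> k = \<kappa> k'" unfolding inj_def by (metis linorder_neqE_nat)
    have "l k' - l k \<in> range to_ac"
    proof (rule act_fixed)
      show "l k' - l k \<in> L" by (intro subring_set_diff[OF Lring] lj)
      fix g assume g: "g \<in> carrier G"
      have "\<rho> g (l k) - l k - B g = \<rho> g (l k') - l k' - B g"
        using fun_cong[OF kk(2), of g] g by (simp add: \<kappa>_def)
      then have "\<rho> g (l k) - l k = \<rho> g (l k') - l k'" by (metis diff_add_cancel)
      then have "\<rho> g (l k') = \<rho> g (l k) - l k + l k'" by (simp only: diff_add_cancel)
      then have "\<rho> g (l k') - \<rho> g (l k) = l k' - l k" by simp
      then show "\<rho> g (l k' - l k) = l k' - l k"
        using hom_on.hom_diff[OF act_hom[OF g] lj(1) lj(1), of k' k] by simp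
    qed
    then obtain h where h: "l k' - l k = to_ac h" by auto
    have jj: "(j k' - j k) ^ ?p = j k' - j k"
      using power_char_diff[OF prime_CHAR_ratfun_ac, of "j k'" "j k" 1] lj(2) unfolding CHAR_ratfun_ac by simp
    then have "j k' - j k \<in> range (\<lambda>c. to_ac (ratfun_const c))" by (rule power_CHAR_fixed_is_const)
    then obtain i where i: "j k' - j k = to_ac i" by auto
    have "to_ac (i ^ ?p) = to_ac i" using jj unfolding i by simp
    then have ip: "i ^ ?p = i" by (simp only: to_ac_eq_iff)
    have "to_ac (to_fract (monom 1 (?p * k' + 1) - monom 1 (?p * k + 1))) = ?\<alpha> k' - ?\<alpha> k"
      by (simp add: pol_def)
    also have "\<dots> = artin_schreier (l k' - l k) + (j k' - j k)"
      unfolding lj(3) artin_schreier_diff[OF prime_CHAR_ratfun_ac] by simp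
    also have "\<dots> = to_ac (artin_schreier h + i)" by (simp add: h i to_ac_artin_schreier)
    finally have "to_fract (monom 1 (?p * k' + 1) - monom 1 (?p * k + 1)) = artin_schreier h + i"
      by (simp only: to_ac_eq_iff)
    moreover have "\<not> ?p dvd ?p * k' + 1" using nontriv[where 'a = 'p]
      by (metis dvd_add_right_iff dvd_triv_left nat_dvd_1_iff_1 less_irrefl)
    moreover have "?p * k + 1 < ?p * k' + 1" using kk(1) nontriv[where 'a = 'p] by simp
    ultimately show False using monom_diff_not_artin_schreier ip by blast
  qed
  then obtain k where "\<forall>l\<in>L. \<forall>j. j ^ ?p = j \<longrightarrow> ?\<alpha> k \<noteq> artin_schreier l + j" by (elim exE)
  then show ?thesis by (intro that[of "?p * k + 1"]) simp
qed

end

section \<open>Properties of the ring that pass to R[y]\<close>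

lemma map_poly_hom_poly_over:
  assumes "hom_on L \<sigma>" "P \<in> poly_over S" "\<And>x. x \<in> S \<Longrightarrow> \<sigma> x \<in> S'"
  shows "map_poly \<sigma> P \<in> poly_over S'"
proof (rule poly_overI)
  fix i
  show "coeff (map_poly \<sigma> P) i \<in> S'"
    using assms(3)[OF poly_overD[OF assms(2), of i]] by (simp add: coeff_map_poly hom_on.hom_0[OF assms(1)])
qed

text \<open>From \<open>y ^ p = y + a\<close> with \<open>a \<in> R\<close>, each Frobenius power of
  \<open>y\<close> is \<open>y + s\<close> with \<open>s \<in> R\<close>. Modulo
  \<open>\<pi>\<close> another \<open>q\<close>-th power adds the same \<open>s\<close> again, so
  after \<open>p\<close> rounds the total \<open>p s\<close> vanishes: the exponent \<open>M\<close>
  becomes \<open>M * p\<close>.\<close>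

lemma frobenius_closed_adjoin:
  fixes R :: "'p::prime_card ratfun alg_closure set"
  assumes R: "subring_set R" and pol_R: "range pol \<subseteq> R" and frob: "frobenius_closed R"
    and y: "artin_schreier y \<in> R"
  shows "frobenius_closed (adjoin R y)"
  unfolding frobenius_closed_def
proof (intro allI impI)
  fix \<pi> :: "'p mod_ring poly" assume irr: "irreducible \<pi>"
  let ?p = "CARD('p)"
  define R' where "R' = adjoin R y"
  have R': "subring_set R'" unfolding R'_def by (rule subring_adjoin[OF R])
  have RR': "R \<subseteq> R'" unfolding R'_def by (rule adjoin_superset[OF R])
  have yR': "y \<in> R'" unfolding R'_def by (rule adjoin_gen[OF R])
  have "\<exists>M>0. \<forall>b\<in>R. \<exists>c\<in>R. b ^ (?p ^ M) - b = pol \<pi> * c"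
    using frob irr by (simp add: frobenius_closed_def)
  then obtain M where M: "M > 0" "\<forall>b\<in>R. \<exists>c\<in>R. b ^ (?p ^ M) - b = pol \<pi> * c" by (elim exE conjE)
  define I where "I S = (\<lambda>c. pol \<pi> * c) ` S" for S
  have I_add: "a + b \<in> I S" if "subring_set S" "a \<in> I S" "b \<in> I S" for a b S
    using that subring_set_add[OF that(1)] by (auto simp: I_def simp flip: distrib_left)
  have I_mult: "a * b \<in> I S" if S: "subring_set S" and "a \<in> I S" "b \<in> S" for a b S
  proof -
    obtain c where c: "c \<in> S" "a = pol \<pi> * c" using \<open>a \<in> I S\<close> by (auto simp: I_def)
    then have "a * b = pol \<pi> * (c * b)" by (simp add: mult.assoc)
    then show ?thesis unfolding I_def by (rule image_eqI[OF _ subring_set_mult[OF S c(1) \<open>b \<in> S\<close>]])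
  qed
  have I_0: "0 \<in> I S" if "subring_set S" for S
    unfolding I_def by (rule image_eqI[of _ _ 0]) (use subring_set_0[OF that] in auto)
  define q where "q = ?p ^ M"
  have frobR: "b ^ q - b \<in> I R" if "b \<in> R" for b using M(2) that by (auto simp: q_def I_def)
  have iter: "b ^ (q ^ k) - b \<in> I R" if b: "b \<in> R" for b k
  proof (induction k)
    case 0
    then show ?case using I_0[OF R] by simp
  next
    case (Suc k)
    have "(b ^ (q ^ k)) ^ q - b ^ (q ^ k) \<in> I R" by (rule frobR[OF subring_set_power[OF R b]])
    then have "((b ^ (q ^ k)) ^ q - b ^ (q ^ k)) + (b ^ (q ^ k) - b) \<in> I R" using Suc by (rule I_add[OF R])
    then show ?case by (simp add: mult.commute flip: power_mult)
  qed
  have add_pow: "(a + b) ^ (?p ^ k) = a ^ (?p ^ k) + b ^ (?p ^ k)" for a b :: "'p ratfun alg_closure" and k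
    using power_char_add[OF prime_CHAR_ratfun_ac, of a b k] unfolding CHAR_ratfun_ac .
  have y_pow: "\<exists>s\<in>R. y ^ (?p ^ k) = y + s" for k
  proof (induction k)
    case 0
    then show ?case using subring_set_0[OF R] by (intro bexI[of _ 0]) auto
  next
    case (Suc k)
    then obtain s where s: "s \<in> R" "y ^ (?p ^ k) = y + s" by blast
    have yp: "y ^ ?p = y + artin_schreier y" unfolding artin_schreier_def CHAR_ratfun_ac by simp
    have "y ^ (?p ^ Suc k) = (y ^ (?p ^ k)) ^ ?p" by (simp add: mult.commute flip: power_mult)
    also have "\<dots> = y ^ ?p + s ^ ?p" using add_pow[of y s 1] by (simp add: s)
    finally have "y ^ (?p ^ Suc k) = y + (artin_schreier y + s ^ ?p)" by (simp add: yp)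
    moreover have "artin_schreier y + s ^ ?p \<in> R"
      by (intro subring_set_add[OF R] subring_set_power[OF R] y s)
    ultimately show ?case by blast
  qed
  then obtain s where s: "s \<in> R" "y ^ q = y + s" unfolding q_def by blast
  have y_iter: "y ^ (q ^ k) - (y + of_nat k * s) \<in> I R" for k
  proof (induction k)
    case 0
    then show ?case using I_0[OF R] by simp
  next
    case (Suc k)
    have "y ^ (q ^ Suc k) = (y ^ q) ^ (q ^ k)" by (simp flip: power_mult)
    also have "\<dots> = (y + s) ^ (q ^ k)" by (simp only: s(2))
    also have "\<dots> = y ^ (q ^ k) + s ^ (q ^ k)"
      using add_pow[of y s "M * k"] by (simp add: q_def power_mult)
    finally have "y ^ (q ^ Suc k) - (y + of_nat (Suc k) * s)
        = (y ^ (q ^ k) - (y + of_nat k * s)) + (s ^ (q ^ k) - s)" by (simp add: algebra_simps)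
    then show ?case using I_add[OF R Suc iter[OF s(1), of k]] by (simp only:)
  qed
  define Q where "Q = q ^ ?p"
  have QM: "Q = ?p ^ (M * ?p)" by (simp add: Q_def q_def power_mult)
  \<comment> \<open>The elements satisfying the congruence form a ring, so it suffices to check it
    on \<open>R\<close> and on \<open>y\<close>.\<close>
  define C where "C = {b \<in> R'. b ^ Q - b \<in> I R'}"
  have IR: "I R \<subseteq> I R'" using RR' by (auto simp: I_def)
  have C: "subring_set C"
  proof (rule subring_setI')
    show "1 \<in> C" using subring_set_1[OF R'] I_0[OF R'] by (simp add: C_def)
    fix a assume a: "a \<in> C"
    show "- a \<in> C"
    proof -
      have "(- a) ^ Q - - a = (a ^ Q - a) * (- 1)"
        using power_char_uminus[OF prime_CHAR_ratfun_ac, of a "M * ?p"] unfolding CHAR_ratfun_ac QM by simp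
      moreover have "(a ^ Q - a) * (- 1) \<in> I R'"
        using a by (intro I_mult[OF R'] subring_set_uminus[OF R'] subring_set_1[OF R']) (simp add: C_def)
      ultimately show ?thesis using a subring_set_uminus[OF R'] by (simp add: C_def)
    qed
    fix b assume b: "b \<in> C"
    show "a + b \<in> C"
    proof -
      have "(a + b) ^ Q - (a + b) = (a ^ Q - a) + (b ^ Q - b)"
        using add_pow[of a b "M * ?p"] by (simp add: QM)
      also have "\<dots> \<in> I R'" using a b by (intro I_add[OF R']) (simp_all add: C_def)
      finally show ?thesis using a b subring_set_add[OF R'] by (simp add: C_def)
    qed
    show "a * b \<in> C"
    proof -
      have e: "(a * b) ^ Q - a * b = (a ^ Q - a) * b ^ Q + (b ^ Q - b) * a" by (simp add: power_mult_distrib algebra_simps)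
      have "(a ^ Q - a) * b ^ Q \<in> I R'" "(b ^ Q - b) * a \<in> I R'"
        using a b by (auto simp: C_def intro!: I_mult[OF R'] subring_set_power[OF R'])
      then show ?thesis using a b e I_add[OF R'] subring_set_mult[OF R'] by (simp add: C_def)
    qed
  qed
  moreover have "R \<subseteq> C" using RR' IR iter by (auto simp: C_def Q_def)
  moreover have "y \<in> C"
  proof -
    have "of_nat ?p = (0 :: 'p ratfun alg_closure)"
      using of_nat_CHAR[where 'a = "'p ratfun alg_closure"] unfolding CHAR_ratfun_ac .
    then show ?thesis using y_iter[of ?p] IR yR' by (auto simp: C_def Q_def)
  qed
  ultimately have "R' \<subseteq> C" unfolding R'_def by (rule adjoin_least)
  moreover have "M * ?p > 0" using M(1) by simp
  ultimately show "\<exists>M>0. \<forall>b\<in>adjoin R y. \<exists>c\<in>adjoin R y. b ^ ?p ^ M - b = pol \<pi> * c"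
    by (intro exI[of _ "M * ?p"]) (auto simp: C_def I_def QM R'_def)
qed

lemma fractions_adjoin:
  fixes R L :: "'p::prime_card ratfun alg_closure set"
  assumes R: "subring_set R" and pol_R: "range pol \<subseteq> R"
    and frac: "\<And>x. x \<in> L \<Longrightarrow> \<exists>s. s \<noteq> 0 \<and> pol s * x \<in> R"
    and x: "x \<in> adjoin L y"
  shows "\<exists>s. s \<noteq> 0 \<and> pol s * x \<in> adjoin R y"
proof -
  obtain P where P: "P \<in> poly_over L" "x = poly P y" using x by (auto simp: adjoin_def)
  have "\<exists>s. s \<noteq> 0 \<and> smult (pol s) P \<in> poly_over R"
    using P(1)
  proof (induction P)
    case 0
    then show ?case using subring_set_0[OF R] by (intro exI[of _ 1]) (auto simp: poly_over_def)
  next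
    case (pCons a P)
    have a: "a \<in> L" using poly_overD[OF pCons.prems, of 0] by simp
    have "P \<in> poly_over L" using poly_overD[OF pCons.prems, of "Suc i" for i] by (auto intro!: poly_overI)
    then obtain s where s: "s \<noteq> 0" "smult (pol s) P \<in> poly_over R" using pCons.IH by blast
    obtain r where r: "r \<noteq> 0" "pol r * a \<in> R" using frac[OF a] by blast
    have "smult (pol (r * s)) (pCons a P) = pCons (pol s * (pol r * a)) (smult (pol r) (smult (pol s) P))"
      by (simp add: mult_ac)
    moreover have "pCons (pol s * (pol r * a)) (smult (pol r) (smult (pol s) P)) \<in> poly_over R"
      using pol_R by (intro pCons_poly_over[OF R] smult_poly_over[OF R] s subring_set_mult[OF R] r) auto
    moreover have "r * s \<noteq> 0" using r s by simp
    ultimately show ?case by metis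
  qed
  then obtain s where s: "s \<noteq> 0" "smult (pol s) P \<in> poly_over R" by blast
  have "pol s * x = poly (smult (pol s) P) y" by (simp add: P)
  then show ?thesis using s unfolding adjoin_def by blast
qed

context tower_step
begin

lemma step_exists: "\<exists>\<rho>' (L' :: 'p ratfun alg_closure set) R' T' \<theta>'. tower_data G \<rho>' L' N R' T' \<theta>'"
proof -
  let ?p = "CARD('p)"
  let ?K = "range (to_ac :: 'p ratfun \<Rightarrow> _)"
  interpret G: comm_group G by (rule comm)
  interpret NN: subgroup N G by (rule N)
  obtain m where tw: "\<And>l j. l \<in> L \<Longrightarrow> j ^ ?p = j \<Longrightarrow> a0 + pol (monom 1 m) \<noteq> artin_schreier l + j"
    by (rule exists_twist) (rule that)
  define \<alpha> where "\<alpha> = a0 + pol (monom 1 m)"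
  obtain y where y: "artin_schreier y = \<alpha>" by (rule exists_artin_schreier_root[OF prime_CHAR_ratfun_ac])
  have \<alpha>R: "\<alpha> \<in> R" unfolding \<alpha>_def using pol_R by (intro subring_set_add[OF R] a0_R) auto
  then have \<alpha>L: "\<alpha> \<in> L" using R_L by blast
  have yL: "y \<notin> L"
  proof
    assume "y \<in> L"
    then have "\<alpha> \<noteq> artin_schreier y + 0" unfolding \<alpha>_def by (rule tw) (simp add: power_0_left)
    then show False by (simp add: y)
  qed
  interpret S: artin_schreier_step L y
    by unfold_locales (use prime_CHAR_ratfun_ac L yL \<alpha>L y in auto)
  define L' where "L' = adjoin L y"
  define R' where "R' = adjoin R y"
  define \<rho>' where "\<rho>' g = S.lift (\<rho> g) (B g)" for g
  have L'r: "subring_set L'" unfolding L'_def by (rule subring_adjoin[OF Lring])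
  have LL': "L \<subseteq> L'" unfolding L'_def by (rule adjoin_superset[OF Lring])
  have KL': "?K \<subseteq> L'" using K_L LL' by blast
  have L'f: "subfield_set L'" by (rule subring_over_base_is_subfield[OF L'r KL'])
  have yL': "y \<in> L'" unfolding L'_def by (rule adjoin_gen[OF Lring])
  have R': "subring_set R'" unfolding R'_def by (rule subring_adjoin[OF R])
  have RR': "R \<subseteq> R'" unfolding R'_def by (rule adjoin_superset[OF R])
  have yR': "y \<in> R'" unfolding R'_def by (rule adjoin_gen[OF R])
  have R'L': "R' \<subseteq> L'" unfolding R'_def using RR' R_L LL' by (intro adjoin_least[OF L'r _ yL']) auto
  have polK: "pol s \<in> ?K" for s :: "'p mod_ring poly" by (simp add: pol_def)
  have act_\<alpha>: "\<rho> g (artin_schreier y) = artin_schreier y + artin_schreier (B g)" if g: "g \<in> carrier G" for g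
  proof -
    interpret g: hom_on L "\<rho> g" by (rule act_hom[OF g])
    have a0L: "a0 \<in> L" using a0_R R_L by blast
    show ?thesis unfolding y \<alpha>_def
      using g.hom_add[OF a0L subsetD[OF K_L polK]] act_K[OF g polK] act_a0[OF g] by (simp add: algebra_simps)
  qed
  have \<rho>'_poly: "\<rho>' g (poly P y) = poly (map_poly (\<rho> g) P) (y + B g)" if "g \<in> carrier G" "P \<in> poly_over L" for g P
    unfolding \<rho>'_def by (rule S.lift_poly[OF act_hom[OF that(1)] act_\<alpha>[OF that(1)] that(2)])
  have \<rho>'_base: "\<rho>' g x = \<rho> g x" if "g \<in> carrier G" "x \<in> L" for g x
    unfolding \<rho>'_def by (rule S.lift_base[OF act_hom[OF that(1)] act_\<alpha>[OF that(1)] that(2)])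
  have \<rho>'_y: "\<rho>' g y = y + B g" if "g \<in> carrier G" for g
    unfolding \<rho>'_def by (rule S.lift_gen[OF act_hom[OF that] act_\<alpha>[OF that]])
  have \<rho>'_hom: "hom_on L' (\<rho>' g)" if "g \<in> carrier G" for g
    unfolding \<rho>'_def L'_def by (rule S.lift_hom[OF act_hom[OF that] act_\<alpha>[OF that]])
  \<comment> \<open>For a general subring, since it serves both \<open>L\<close> and
    \<open>R\<close>.\<close>
  have closed: "\<rho>' g x \<in> adjoin S y"
    if g: "g \<in> carrier G" and S: "subring_set S" "S \<subseteq> L" "B g \<in> S" "\<And>u. u \<in> S \<Longrightarrow> \<rho> g u \<in> S" and x: "x \<in> adjoin S y"
    for g S x
  proof -
    obtain P where P: "P \<in> poly_over S" "x = poly P y" using x by (auto simp: adjoin_def)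
    note A = subring_adjoin[OF S(1), of y] and SA = adjoin_superset[OF S(1), of y]
    have "map_poly (\<rho> g) P \<in> poly_over S" by (rule map_poly_hom_poly_over[OF act_hom[OF g] P(1) S(4)])
    then have "poly (map_poly (\<rho> g) P) (y + B g) \<in> adjoin S y"
      using SA S(3) by (intro poly_poly_over[OF A] poly_over_mono[OF SA] subring_set_add[OF A] adjoin_gen[OF S(1)]) auto
    then show ?thesis using \<rho>'_poly[OF g poly_over_mono[OF S(2) P(1)]] P(2) by simp
  qed
  have closed_L': "\<rho>' g x \<in> L'" if "g \<in> carrier G" "x \<in> L'" for g x
    using closed[OF that(1) Lring _ B_L[OF that(1)] act_closed[OF that(1)]] that(2) by (simp add: L'_def)
  have closed_R': "\<rho>' g x \<in> R'" if "g \<in> carrier G" "x \<in> R'" for g x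
    using closed[OF that(1) R R_L B_R[OF that(1)] act_R[OF that(1)]] that(2) by (simp add: R'_def)
  have mult: "\<rho>' (g \<otimes>\<^bsub>G\<^esub> h) x = \<rho>' g (\<rho>' h x)" if g: "g \<in> carrier G" and h: "h \<in> carrier G" and x: "x \<in> L'" for g h x
  proof -
    interpret g': hom_on L' "\<rho>' g" by (rule \<rho>'_hom[OF g])
    obtain P where P: "P \<in> poly_over L" "x = poly P y" using x by (auto simp: L'_def adjoin_def)
    define Q where "Q = map_poly (\<rho> h) P"
    have Q: "Q \<in> poly_over L" unfolding Q_def by (rule map_poly_hom_poly_over[OF act_hom[OF h] P(1) act_closed[OF h]])
    have BL': "B h \<in> L'" using B_L[OF h] LL' by blast
    have "\<rho>' g (\<rho>' h x) = \<rho>' g (poly Q (y + B h))" using \<rho>'_poly[OF h P(1)] P(2) by (simp add: Q_def)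
    also have "\<dots> = poly (map_poly (\<rho>' g) Q) (\<rho>' g (y + B h))"
      by (rule g'.hom_poly[OF poly_over_mono[OF LL' Q] subring_set_add[OF L'r yL' BL']])
    also have "map_poly (\<rho>' g) Q = map_poly (\<rho> (g \<otimes>\<^bsub>G\<^esub> h)) P"
    proof (rule poly_eqI)
      fix i
      have c: "coeff P i \<in> L" by (rule poly_overD[OF P(1)])
      have gh: "g \<otimes>\<^bsub>G\<^esub> h \<in> carrier G" using g h by simp
      show "coeff (map_poly (\<rho>' g) Q) i = coeff (map_poly (\<rho> (g \<otimes>\<^bsub>G\<^esub> h)) P) i"
        using \<rho>'_base[OF g act_closed[OF h c]] act_mult[OF g h c]
        by (simp add: Q_def coeff_map_poly g'.hom_0 hom_on.hom_0[OF act_hom[OF h]] hom_on.hom_0[OF act_hom[OF gh]])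
    qed
    also have "\<rho>' g (y + B h) = y + B (g \<otimes>\<^bsub>G\<^esub> h)"
      using g'.hom_add[OF yL' BL'] \<rho>'_y[OF g] \<rho>'_base[OF g B_L[OF h]] B_cocycle[OF g h] by simp
    also have "poly (map_poly (\<rho> (g \<otimes>\<^bsub>G\<^esub> h)) P) \<dots> = \<rho>' (g \<otimes>\<^bsub>G\<^esub> h) x"
      using \<rho>'_poly[OF _ P(1), of "g \<otimes>\<^bsub>G\<^esub> h"] g h P(2) by simp
    finally show ?thesis by simp
  qed
  have Hid: "\<rho> h x = x" if "h \<in> H" "x \<in> L" for h x using kernel[OF HG[OF that(1)]] that by blast
  have zH: "z [^]\<^bsub>G\<^esub> (i :: nat) \<in> H" for i
    using z(1) by (induction i) (simp_all add: subgroup.one_closed[OF H] subgroup.m_closed[OF H])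
  have zG': "z [^]\<^bsub>G\<^esub> (i :: nat) \<in> carrier G" for i using zG by simp
  have H_poly: "\<rho>' h (poly P y) = poly P (y + \<chi>F h)" if h: "h \<in> H" and P: "P \<in> poly_over L" for h P
  proof -
    have "map_poly (\<rho> h) P = P"
      by (rule poly_eqI) (simp add: coeff_map_poly hom_on.hom_0[OF act_hom[OF HG[OF h]]] Hid[OF h] poly_overD[OF P])
    then show ?thesis using \<rho>'_poly[OF HG[OF h] P] B_H[OF h] by simp
  qed
  have fixed: "x \<in> ?K" if x: "x \<in> L'" and fx: "\<And>g. g \<in> carrier G \<Longrightarrow> \<rho>' g x = x" for x
  proof -
    obtain P where P: "P \<in> poly_over L" "x = poly P y" using x by (auto simp: L'_def adjoin_def)
    \<comment> \<open>\<open>z\<close> acts on \<open>L'\<close> as \<open>shift\<close>: it is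
      trivial on \<open>L\<close>, and \<open>B z = \<chi>F z = 1\<close>. So elements fixed by
      \<open>G\<close> already lie in \<open>L\<close>.\<close>
    have "S.shift x = \<rho>' z x"
      using H_poly[OF z(1) P(1)] S.shift_poly[OF P(1)] \<chi>F_z[of 1] zG by (simp add: P(2))
    then have "S.shift x = x" using fx[OF zG] by simp
    then have xL: "x \<in> L" using S.shift_fixed x by (simp add: L'_def)
    show ?thesis by (rule act_fixed[OF xL]) (use fx \<rho>'_base xL in auto)
  qed
  have kernel': "(\<forall>x\<in>L'. \<rho>' g x = x) \<longleftrightarrow> g \<in> N" if g: "g \<in> carrier G" for g
  proof
    assume all: "\<forall>x\<in>L'. \<rho>' g x = x"
    have "\<forall>x\<in>L. \<rho> g x = x"
    proof
      fix x assume x: "x \<in> L"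
      then have "x \<in> L'" using LL' by blast
      then show "\<rho> g x = x" using all \<rho>'_base[OF g x] by simp
    qed
    then have gH: "g \<in> H" using kernel[OF g] by blast
    have "y + B g = y" using all yL' \<rho>'_y[OF g] by auto
    then show "g \<in> N" using \<chi>F_eq_0_iff[OF gH] B_H[OF gH] by simp
  next
    assume gN: "g \<in> N"
    then have gH: "g \<in> H" using N(2) by blast
    have "\<chi>F g = 0" using \<chi>F_eq_0_iff[OF gH] gN by blast
    then show "\<forall>x\<in>L'. \<rho>' g x = x" using H_poly[OF gH] by (auto simp: L'_def adjoin_def)
  qed
  have integral': "w x \<ge> 0" if w: "valuation_on L' w" "\<And>s :: 'p mod_ring poly. s \<noteq> 0 \<Longrightarrow> w (pol s) \<ge> 0" and x: "x \<in> R'" "x \<noteq> 0" for w x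
  proof -
    define V where "V = {x \<in> L'. x = 0 \<or> w x \<ge> 0}"
    have V: "subring_set V" unfolding V_def by (rule subring_val_ring[OF L'f w(1)])
    have wL: "valuation_on L w" by (rule valuation_on_subset[OF w(1) LL'])
    have int: "u = 0 \<or> w u \<ge> 0" if "u \<in> R" for u using integral[OF wL w(2) that] by blast
    have "R \<subseteq> V" using int R_L LL' by (auto simp: V_def)
    moreover have "y \<in> V"
    proof -
      have "CHAR('p ratfun alg_closure) > 1" using nontriv[where 'a = 'p] by (simp only: CHAR_ratfun_ac)
      then have "y = 0 \<or> w y \<ge> 0"
        using int[OF \<alpha>R] by (intro val_integral_of_artin_schreier[OF L'f w(1) _ yL']) (auto simp: y)
      then show ?thesis using yL' by (simp add: V_def)
    qed
    ultimately have "R' \<subseteq> V" unfolding R'_def by (rule adjoin_least[OF V])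
    then show ?thesis using x by (auto simp: V_def)
  qed
  \<comment> \<open>Representatives of the cosets of \<open>N\<close>: one for each coset of
    \<open>H\<close> and each exponent of \<open>z\<close> below \<open>p\<close>.\<close>
  define f where "f = (\<lambda>(t, i). t \<otimes>\<^bsub>G\<^esub> z [^]\<^bsub>G\<^esub> (i :: nat))"
  define T' where "T' = f ` (T \<times> {..<?p})"
  \<comment> \<open>By \<open>sum_shifted_powers\<close>, the translates of
    \<open>- y ^ (p - 1)\<close> under the powers of \<open>z\<close> add up to 1, so the trace of
    \<open>\<theta>'\<close> reduces to that of \<open>\<theta>\<close>.\<close>
  define \<theta>' where "\<theta>' = - (\<theta> * y ^ (?p - 1))"
  have TG: "t \<in> carrier G" if "t \<in> T" for t using that T(1) by blast
  \<comment> \<open>The coset of \<open>g\<close> modulo \<open>N\<close> determines both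
    \<open>t\<close>, through \<open>rep\<close>, and \<open>i\<close> modulo \<open>p\<close>,
    through \<open>\<chi>F\<close>; this gives injectivity of \<open>f\<close> and uniqueness of
    representatives.\<close>
  have key: "t = rep g \<and> of_nat i = \<chi>F (inv\<^bsub>G\<^esub> t \<otimes>\<^bsub>G\<^esub> g)"
    if t: "t \<in> T" and g: "g \<in> carrier G" and mem: "inv\<^bsub>G\<^esub> (f (t, i)) \<otimes>\<^bsub>G\<^esub> g \<in> N" for t i g
  proof -
    define n where "n = inv\<^bsub>G\<^esub> (f (t, i)) \<otimes>\<^bsub>G\<^esub> g"
    have tG: "t \<in> carrier G" by (rule TG[OF t])
    have nG: "n \<in> carrier G" using NN.mem_carrier[OF mem] by (simp add: n_def)
    have fG: "f (t, i) \<in> carrier G" using tG zG' by (simp add: f_def)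
    have "g = f (t, i) \<otimes>\<^bsub>G\<^esub> n" unfolding n_def using g fG by (simp add: G.m_assoc[symmetric])
    also have "\<dots> = t \<otimes>\<^bsub>G\<^esub> (n \<otimes>\<^bsub>G\<^esub> z [^]\<^bsub>G\<^esub> i)"
      unfolding f_def using tG nG zG'[of i] by (simp add: G.m_ac)
    finally have e: "inv\<^bsub>G\<^esub> t \<otimes>\<^bsub>G\<^esub> g = n \<otimes>\<^bsub>G\<^esub> z [^]\<^bsub>G\<^esub> i"
      using tG nG zG'[of i] by (simp add: G.m_assoc[symmetric])
    have nN: "n \<in> N" using mem by (simp add: n_def)
    have "inv\<^bsub>G\<^esub> t \<otimes>\<^bsub>G\<^esub> g \<in> H" unfolding e using nN N(2) zH by (intro subgroup.m_closed[OF H]) auto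
    then have "rep g = t" by (rule rep_unique[OF g t])
    moreover have "\<chi>F (inv\<^bsub>G\<^esub> t \<otimes>\<^bsub>G\<^esub> g) = of_nat i" unfolding e by (rule \<chi>F_eq[OF nN])
    ultimately show ?thesis by simp
  qed
  have i_unique: "i = j" if "i < ?p" "j < ?p" "of_nat i = (of_nat j :: 'p ratfun alg_closure)" for i j
    using that by (simp add: of_nat_eq_iff_F cong_def)
  have inj_f: "inj_on f (T \<times> {..<?p})"
  proof (rule inj_onI)
    fix a b assume ab: "a \<in> T \<times> {..<?p}" "b \<in> T \<times> {..<?p}" "f a = f b"
    obtain t i where a: "a = (t, i)" by (cases a)
    obtain s j where b: "b = (s, j)" by (cases b)
    have g: "f a \<in> carrier G" using ab(1) TG zG' by (auto simp: f_def a)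
    have 1: "t = rep (f a) \<and> of_nat i = \<chi>F (inv\<^bsub>G\<^esub> t \<otimes>\<^bsub>G\<^esub> f a)"
      by (rule key) (use ab g a in auto)
    have 2: "s = rep (f a) \<and> of_nat j = \<chi>F (inv\<^bsub>G\<^esub> s \<otimes>\<^bsub>G\<^esub> f a)"
      by (rule key) (use ab g b in auto)
    have "t = s" using 1 2 by simp
    then have "of_nat i = (of_nat j :: 'p ratfun alg_closure)" using 1 2 by metis
    then show "a = b" using \<open>t = s\<close> i_unique[of i j] ab a b by auto
  qed
  have T'_transversal: "\<exists>!t'. t' \<in> T' \<and> inv\<^bsub>G\<^esub> t' \<otimes>\<^bsub>G\<^esub> g \<in> N" if g: "g \<in> carrier G" for g
  proof -
    define t where "t = rep g"
    have t: "t \<in> T" "inv\<^bsub>G\<^esub> t \<otimes>\<^bsub>G\<^esub> g \<in> H" using rep[OF g] by (auto simp: t_def)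
    have tG: "t \<in> carrier G" by (rule TG[OF t(1)])
    obtain n k where nk: "n \<in> N" "inv\<^bsub>G\<^esub> t \<otimes>\<^bsub>G\<^esub> g = n \<otimes>\<^bsub>G\<^esub> z [^]\<^bsub>G\<^esub> (k :: nat)" using gen[OF t(2)] by blast
    define i where "i = k mod ?p"
    have ip: "i < ?p" using nontriv[where 'a = 'p] by (simp add: i_def)
    have "[k = i] (mod ?p)" by (simp add: i_def cong_def)
    then have ki: "of_nat k = (of_nat i :: 'p ratfun alg_closure)" by (simp only: of_nat_eq_iff_F)
    have fG: "f (t, i) \<in> carrier G" using tG zG' by (simp add: f_def)
    have e: "inv\<^bsub>G\<^esub> (f (t, i)) \<otimes>\<^bsub>G\<^esub> g = (inv\<^bsub>G\<^esub> t \<otimes>\<^bsub>G\<^esub> g) \<otimes>\<^bsub>G\<^esub> inv\<^bsub>G\<^esub> (z [^]\<^bsub>G\<^esub> i)"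
      using tG g zG' by (simp add: f_def G.inv_mult_group G.m_ac)
    have izH: "inv\<^bsub>G\<^esub> (z [^]\<^bsub>G\<^esub> i) \<in> H" using zH by (simp add: subgroup.m_inv_closed[OF H])
    have "\<chi>F (z [^]\<^bsub>G\<^esub> i) + \<chi>F (inv\<^bsub>G\<^esub> (z [^]\<^bsub>G\<^esub> i)) = 0"
      using \<chi>F_add[OF zH[of i] izH] \<chi>F_z[of 0] zG' by simp
    then have "\<chi>F (inv\<^bsub>G\<^esub> (f (t, i)) \<otimes>\<^bsub>G\<^esub> g) = 0"
      unfolding e using \<chi>F_add[OF t(2) izH] \<chi>F_eq[OF nk(1), of k] \<chi>F_z[of i] nk(2) ki by (simp add: add_eq_0_iff)
    moreover have "inv\<^bsub>G\<^esub> (f (t, i)) \<otimes>\<^bsub>G\<^esub> g \<in> H" unfolding e by (rule subgroup.m_closed[OF H t(2) izH])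
    ultimately have ex: "f (t, i) \<in> T' \<and> inv\<^bsub>G\<^esub> (f (t, i)) \<otimes>\<^bsub>G\<^esub> g \<in> N"
      using \<chi>F_eq_0_iff t(1) ip by (auto simp: T'_def)
    show ?thesis
    proof (rule ex1I[where P = "\<lambda>t'. t' \<in> T' \<and> inv\<^bsub>G\<^esub> t' \<otimes>\<^bsub>G\<^esub> g \<in> N", OF ex])
      fix t' assume t': "t' \<in> T' \<and> inv\<^bsub>G\<^esub> t' \<otimes>\<^bsub>G\<^esub> g \<in> N"
      then obtain s j where sj: "s \<in> T" "j < ?p" "t' = f (s, j)" by (auto simp: T'_def)
      have 1: "s = rep g \<and> of_nat j = \<chi>F (inv\<^bsub>G\<^esub> s \<otimes>\<^bsub>G\<^esub> g)" by (rule key) (use sj t' g in auto)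
      have 2: "t = rep g \<and> of_nat i = \<chi>F (inv\<^bsub>G\<^esub> t \<otimes>\<^bsub>G\<^esub> g)" by (rule key) (use t(1) ex g in auto)
      have "s = t" using 1 2 by simp
      then have "of_nat j = (of_nat i :: 'p ratfun alg_closure)" using 1 2 by metis
      then show "t' = f (t, i)" using i_unique sj(2,3) ip \<open>s = t\<close> by auto
    qed
  qed
  have \<theta>L': "\<theta> \<in> L'" using \<theta>L LL' by blast
  have sum': "(\<Sum>t'\<in>T'. \<rho>' t' \<theta>') = 1"
  proof -
    have summand: "\<rho>' (f (t, i)) \<theta>' = \<rho>' t (- (\<theta> * (y + of_nat i) ^ (?p - 1)))" if t: "t \<in> T" for t i
    proof -
      interpret h: hom_on L' "\<rho>' (z [^]\<^bsub>G\<^esub> i)" by (rule \<rho>'_hom[OF zG'])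
      have yp: "y ^ (?p - 1) \<in> L'" by (rule subring_set_power[OF L'r yL'])
      have m: "\<theta> * y ^ (?p - 1) \<in> L'" by (rule subring_set_mult[OF L'r \<theta>L' yp])
      have "\<rho>' (f (t, i)) \<theta>' = \<rho>' t (\<rho>' (z [^]\<^bsub>G\<^esub> i) \<theta>')"
        unfolding f_def using mult[OF TG[OF t] zG' subring_set_uminus[OF L'r m], of i] by (simp add: \<theta>'_def)
      also have "\<rho>' (z [^]\<^bsub>G\<^esub> i) \<theta>' = - (\<theta> * (y + of_nat i) ^ (?p - 1))"
        unfolding \<theta>'_def h.hom_uminus[OF m] h.hom_mult[OF \<theta>L' yp] h.hom_power[OF yL']
        using \<rho>'_base[OF zG' \<theta>L] Hid[OF zH \<theta>L] \<rho>'_y[OF zG', of i] B_H[OF zH] \<chi>F_z by simp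
      finally show ?thesis .
    qed
    have inner: "(\<Sum>i<?p. \<rho>' (f (t, i)) \<theta>') = \<rho> t \<theta>" if t: "t \<in> T" for t
    proof -
      interpret h: hom_on L' "\<rho>' t" by (rule \<rho>'_hom[OF TG[OF t]])
      have m: "- (\<theta> * (y + of_nat i) ^ (?p - 1)) \<in> L'" for i
        by (intro subring_set_uminus[OF L'r] subring_set_mult[OF L'r] subring_set_power[OF L'r]
          subring_set_add[OF L'r] subring_set_of_nat[OF L'r] \<theta>L' yL')
      have "(\<Sum>i<?p. \<rho>' (f (t, i)) \<theta>') = \<rho>' t (\<Sum>i<?p. - (\<theta> * (y + of_nat i) ^ (?p - 1)))"
        unfolding summand[OF t] by (rule h.hom_sum[OF m, symmetric])
      also have "(\<Sum>i<?p. - (\<theta> * (y + of_nat i) ^ (?p - 1))) = - (\<theta> * (\<Sum>i<?p. (y + of_nat i) ^ (?p - 1)))"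
        by (simp add: sum_negf sum_distrib_left)
      also have "(\<Sum>i<?p. (y + of_nat i) ^ (?p - 1)) = - 1"
        using sum_shifted_powers[OF prime_CHAR_ratfun_ac, of y] unfolding CHAR_ratfun_ac .
      finally show ?thesis using \<rho>'_base[OF TG[OF t] \<theta>L] by simp
    qed
    have "(\<Sum>t'\<in>T'. \<rho>' t' \<theta>') = (\<Sum>a\<in>T \<times> {..<?p}. \<rho>' (f a) \<theta>')"
      unfolding T'_def by (subst sum.reindex[OF inj_f]) simp
    also have "\<dots> = (\<Sum>t\<in>T. \<Sum>i<?p. \<rho>' (f (t, i)) \<theta>')"
      using sum.cartesian_product[of "\<lambda>t i. \<rho>' (f (t, i)) \<theta>'" "{..<?p}" T] by (simp add: case_prod_unfold)
    also have "\<dots> = 1" using inner \<theta>(2) by simp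
    finally show ?thesis .
  qed
  have "tower_data G \<rho>' L' N R' T' \<theta>'"
  proof (intro tower_data.intro galois_data_ac.intro galois_data.intro tower_data_axioms.intro)
    show "group G" by (rule G)
    show "finite (carrier G)" by (rule fin_G)
    show "subfield_set L'" by (rule L'f)
    show "subfield_set ?K" by (rule subfield_range_to_ac)
    show "?K \<subseteq> L'" by (rule KL')
    show "hom_on L' (\<rho>' g)" if "g \<in> carrier G" for g by (rule \<rho>'_hom[OF that])
    show "\<rho>' g x \<in> L'" if "g \<in> carrier G" "x \<in> L'" for g x by (rule closed_L'[OF that])
    show "\<rho>' (g \<otimes>\<^bsub>G\<^esub> h) x = \<rho>' g (\<rho>' h x)" if "g \<in> carrier G" "h \<in> carrier G" "x \<in> L'" for g h x
      by (rule mult[OF that])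
    show "x \<in> ?K" if "x \<in> L'" "\<And>g. g \<in> carrier G \<Longrightarrow> \<rho>' g x = x" for x by (rule fixed[OF that])
    show "\<rho>' g x = x" if "g \<in> carrier G" "x \<in> ?K" for g x
      using \<rho>'_base[OF that(1) subsetD[OF K_L that(2)]] act_K[OF that] by simp
    show "comm_group G" by (rule comm)
    show "subgroup N G" by (rule N)
    show "(\<forall>x\<in>L'. \<rho>' g x = x) \<longleftrightarrow> g \<in> N" if "g \<in> carrier G" for g by (rule kernel'[OF that])
    show "subring_set R'" by (rule R')
    show "range pol \<subseteq> R'" using pol_R RR' by blast
    show "R' \<subseteq> L'" by (rule R'L')
    show "\<rho>' g x \<in> R'" if "g \<in> carrier G" "x \<in> R'" for g x by (rule closed_R'[OF that])
    show "\<exists>s. s \<noteq> 0 \<and> pol s * x \<in> R'" if "x \<in> L'" for x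
      using fractions_adjoin[OF R pol_R frac] that by (simp add: L'_def R'_def)
    show "0 \<le> w x" if "valuation_on L' w" "\<And>s. s \<noteq> 0 \<Longrightarrow> 0 \<le> w (pol s)" "x \<in> R'" "x \<noteq> 0" for w x
      by (rule integral'[OF that])
    show "frobenius_closed R'" unfolding R'_def
      by (rule frobenius_closed_adjoin[OF R pol_R frob]) (simp add: y \<alpha>R)
    show "T' \<subseteq> carrier G" using TG zG' by (auto simp: T'_def f_def)
    show "\<exists>!t. t \<in> T' \<and> inv\<^bsub>G\<^esub> t \<otimes>\<^bsub>G\<^esub> g \<in> N" if "g \<in> carrier G" for g by (rule T'_transversal[OF that])
    show "\<theta>' \<in> R'" unfolding \<theta>'_def using \<theta>(1) RR'
      by (intro subring_set_uminus[OF R'] subring_set_mult[OF R'] subring_set_power[OF R'] yR') auto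
    show "(\<Sum>t\<in>T'. \<rho>' t \<theta>') = 1" by (rule sum')
    show "constants_trivial L'" unfolding L'_def
    proof (rule S.constants_step[OF constants])
      fix l j :: "'p ratfun alg_closure" assume "l \<in> L" "j ^ CHAR('p ratfun alg_closure) = j"
      then show "artin_schreier y \<noteq> artin_schreier l + j"
        unfolding y \<alpha>_def by (simp only: CHAR_ratfun_ac) (rule tw)
    qed
    show "ring.finite_dimension ring_of_type_algebra ?K L'" unfolding L'_def
    proof (rule finite_dimension_adjoin[OF subfield_range_to_ac L finite_dim])
      show "\<exists>P\<in>poly_over L. degree P < CHAR('p ratfun alg_closure) \<and> x = poly P y" if "x \<in> adjoin L y" for x
        by (rule S.adjoin_low_degree[OF that]) blast
    qed
  qed
  then show ?thesis by (intro exI)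
qed

end

text \<open>Among the powers \<open>g [^] (p ^ j)\<close> of an element outside \<open>N\<close>,
  the one just before the first that lies in \<open>N\<close> serves as \<open>z\<close>, and
  \<open>H\<close> is generated by \<open>N\<close> and \<open>z\<close>.\<close>

lemma (in comm_group) exists_cyclic_extension:
  fixes p n :: nat
  assumes N: "subgroup N G" "N \<noteq> carrier G" and p: "p > 0"
    and exponent: "\<And>g. g \<in> carrier G \<Longrightarrow> g [^] (p ^ n) = \<one>"
  obtains H z where "subgroup H G" "N \<subseteq> H" "z \<in> H" "z \<notin> N" "z [^] p \<in> N"
    "\<And>h. h \<in> H \<Longrightarrow> \<exists>n\<in>N. \<exists>i :: nat. h = n \<otimes> z [^] i"
proof -
  interpret N: subgroup N G by (rule N(1))
  obtain g where g: "g \<in> carrier G" "g \<notin> N" using N(2) N.subset by blast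
  define k where "k = (LEAST k. g [^] (p ^ k) \<in> N)"
  have "g [^] (p ^ n) \<in> N" by (simp add: exponent[OF g(1)])
  then have kN: "g [^] (p ^ k) \<in> N" unfolding k_def by (rule LeastI)
  have "k \<noteq> 0" using kN g by (intro notI) simp
  then obtain j where j: "k = Suc j" by (cases k) auto
  define z where "z = g [^] (p ^ j)"
  have zG: "z \<in> carrier G" using g(1) by (simp add: z_def)
  have zN: "z \<notin> N" unfolding z_def
    using not_less_Least[of j "\<lambda>k. g [^] (p ^ k) \<in> N"] j by (simp flip: k_def)
  have zp: "z [^] p \<in> N" using kN g(1) by (simp add: z_def j nat_pow_pow mult.commute)
  define H where "H = {n \<otimes> z [^] i | n i :: nat. n \<in> N}"
  have NG: "m \<in> carrier G" if "m \<in> N" for m using that by (rule N.mem_carrier)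
  have H: "subgroup H G"
  proof
    show "H \<subseteq> carrier G" using zG NG by (auto simp: H_def)
    show "\<one> \<in> H" unfolding H_def using zG by (auto intro!: exI[of _ "\<one>"] exI[of _ "0 :: nat"])
    fix x y assume "x \<in> H" "y \<in> H"
    then obtain m i l k where x: "x = m \<otimes> z [^] (i :: nat)" "m \<in> N" and y: "y = l \<otimes> z [^] (k :: nat)" "l \<in> N"
      by (auto simp: H_def)
    have "x \<otimes> y = (m \<otimes> l) \<otimes> z [^] (i + k)" using x y zG NG by (simp add: m_ac flip: nat_pow_mult)
    then show "x \<otimes> y \<in> H" using x y by (auto simp: H_def)
  next
    fix x assume "x \<in> H"
    then obtain m i where x: "x = m \<otimes> z [^] (i :: nat)" "m \<in> N" by (auto simp: H_def)
    \<comment> \<open>As \<open>z\<close> has order dividing \<open>p ^ n\<close>, inverses of its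
      powers are again powers with natural exponents.\<close>
    have "z [^] (i * (p ^ n - 1)) \<otimes> z [^] i = z [^] (i * (p ^ n - 1) + i)" using zG by (simp add: nat_pow_mult)
    also have "i * (p ^ n - 1) + i = p ^ n * i" using p by (simp add: diff_mult_distrib2 mult.commute)
    also have "z [^] (p ^ n * i) = \<one>" using zG exponent[OF zG] by (simp flip: nat_pow_pow)
    finally have "inv (z [^] i) = z [^] (i * (p ^ n - 1))" using zG by (intro inv_equality) auto
    then have "inv x = inv m \<otimes> z [^] (i * (p ^ n - 1))" using x zG NG[OF x(2)] by (simp add: inv_mult)
    then show "inv x \<in> H" using x(2) by (auto simp: H_def)
  qed
  have NH: "N \<subseteq> H"
  proof
    fix m assume "m \<in> N"
    then show "m \<in> H" unfolding H_def using NG by (auto intro!: exI[of _ m] exI[of _ "0 :: nat"])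
  qed
  have zH: "z \<in> H" unfolding H_def using zG by (auto intro!: exI[of _ "\<one>"] exI[of _ "1 :: nat"])
  show thesis
    by (rule that[OF H NH zH zN zp]) (auto simp: H_def)
qed

text \<open>The stage with kernel \<open>G\<close> is the base field; from there the kernel is
  lowered to \<open>N\<close> in steps of index \<open>p\<close>. Hence the induction on the size of
  the complement, applied to a subgroup \<open>H\<close> above \<open>N\<close>.\<close>

lemma tower_exists:
  fixes G :: "('g, 'm) monoid_scheme"
  assumes G: "comm_group G" "finite (carrier G)"
    and ord: "Coset.order G = CARD('p::prime_card) ^ n" and N: "subgroup N G"
  shows "\<exists>\<rho> (L :: 'p ratfun alg_closure set) R T \<theta>. tower_data G \<rho> L N R T \<theta>"
  using N
proof (induction "card (carrier G) - card N" arbitrary: N rule: less_induct)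
  case less
  interpret G: comm_group G by (rule G)
  show ?case
  proof (cases "N = carrier G")
    case True
    then show ?thesis using tower_base[OF G] by metis
  next
    case False
    have exponent: "g [^]\<^bsub>G\<^esub> (CARD('p) ^ n) = \<one>\<^bsub>G\<^esub>" if "g \<in> carrier G" for g
      using G.pow_order_eq_1[OF that] ord by simp
    obtain H z where Hz: "subgroup H G" "N \<subseteq> H" "z \<in> H" "z \<notin> N" "z [^]\<^bsub>G\<^esub> CARD('p) \<in> N"
      and gen: "\<And>h. h \<in> H \<Longrightarrow> \<exists>n\<in>N. \<exists>i :: nat. h = n \<otimes>\<^bsub>G\<^esub> z [^]\<^bsub>G\<^esub> i"
      by (rule G.exists_cyclic_extension[OF less.prems False _ exponent]) (simp, assumption, rule that)
    have HG: "H \<subseteq> carrier G" using Hz(1) by (rule subgroup.subset)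
    then have finH: "finite H" using G(2) by (rule finite_subset)
    have "card N < card H" using Hz finH by (intro psubset_card_mono) auto
    moreover have "card H \<le> card (carrier G)" using G(2) HG by (rule card_mono)
    ultimately have "card (carrier G) - card H < card (carrier G) - card N" by simp
    from less.hyps[OF this Hz(1)] obtain \<rho> and L :: "'p ratfun alg_closure set" and R T \<theta>
      where D: "tower_data G \<rho> L H R T \<theta>" by blast
    have "tower_step G \<rho> L H R T \<theta> N z"
      by (intro tower_step.intro[OF D] tower_step_axioms.intro less.prems Hz gen)
    then show ?thesis by (rule tower_step.step_exists)
  qed
qed

lemma (in tower_data) realization:
  assumes "H = {\<one>\<^bsub>G\<^esub>}"
  shows "geometric_galois_realization G L"
proof -
  have "galois_group L \<cong> G"
    by (rule galois_group_iso[OF infinite_ratfun]) (use kernel assms in blast)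
  moreover have "finite_extension L"
    using L K_L finite_dim subfield_set_iff_subfield by (auto simp: finite_extension_def)
  ultimately show ?thesis
    using normal separable geometric_extensionI[OF constants]
    by (simp add: geometric_galois_realization_def galois_extension_def)
qed

text \<open>A ramified place must be one where \<open>t\<close> has a pole, since the others are
  covered by \<open>frobenius_closed_imp_unramified\<close>; only infinity remains.\<close>

lemma (in tower_data) ramified_places_subset: "ramified_places L \<subseteq> {inf_place}"
proof
  fix v assume "v \<in> ramified_places L"
  then obtain w e where v: "place_on UNIV v" and w: "place_on L w" "lies_over_with_index w v e" and e: "e > 1"
    by (auto simp: ramified_places_def)
  have "v (to_fract [:0, 1:]) < 0"
  proof (rule ccontr)
    assume "\<not> ?thesis"
    then have nonneg: "v (to_fract [:0, 1:]) \<ge> 0" by simp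
    have pol_int: "w (pol s) \<ge> 0" if "s \<noteq> 0" for s
      using place_integral_on_polys[OF v nonneg that] w(2) that
      by (simp add: lies_over_with_index_def pol_def)
    have "e = 1"
      by (rule frobenius_closed_imp_unramified[OF L K_L R R_L pol_R frac
        integral[OF place_imp_valuation[OF w(1)] pol_int] frob v nonneg w])
    then show False using e by simp
  qed
  then show "v \<in> {inf_place}" using place_pole_at_t[OF v] by simp
qed

theorem theorem2p3:
  fixes G :: "('g, 'm) monoid_scheme"
  assumes "comm_group G"
    and "finite (carrier G)"
    and "carrier G \<noteq> {\<one>\<^bsub>G\<^esub>}"
    and "\<exists>n. Coset.order G = CARD('p::prime_card) ^ n"
  shows "(\<exists>L :: 'p ratfun alg_closure set.
            geometric_galois_realization G L \<and> (\<exists>!v. v \<in> ramified_places L))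
       \<and> \<not> (\<exists>L :: 'p ratfun alg_closure set.
            geometric_galois_realization G L \<and> ramified_places L = {})
       \<and> ram TYPE('p) G = 1"
proof -
  interpret G: comm_group G by (rule assms)
  obtain n where ord: "Coset.order G = CARD('p) ^ n" using assms(4) by blast
  have ramified: "ramified_places L \<noteq> {}" if "geometric_galois_realization G L" for L :: "'p ratfun alg_closure set"
    by (rule exists_ramified_place[OF assms(1-3) ord that])
  obtain \<rho> and L :: "'p ratfun alg_closure set" and R T \<theta> where "tower_data G \<rho> L {\<one>\<^bsub>G\<^esub>} R T \<theta>"
    using tower_exists[OF assms(1,2) ord G.triv_subgroup] by blast
  then interpret tower_data G \<rho> L "{\<one>\<^bsub>G\<^esub>}" R T \<theta> .
  have real: "geometric_galois_realization G L" by (rule realization) simp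
  \<comment> \<open>The construction leaves at most the infinite place, and the general lower bound
    excludes that the set is empty.\<close>
  then have single: "ramified_places L = {inf_place}"
    using ramified ramified_places_subset by blast
  have "ram TYPE('p) G = 1"
    unfolding ram_def
  proof (rule Least_equality)
    show "\<exists>L :: 'p ratfun alg_closure set. geometric_galois_realization G L \<and> finite (ramified_places L)
        \<and> card (ramified_places L) = 1"
      using real single by (intro exI[of _ L]) simp
  next
    fix m
    assume "\<exists>L :: 'p ratfun alg_closure set. geometric_galois_realization G L \<and> finite (ramified_places L)
        \<and> card (ramified_places L) = m"
    then show "1 \<le> m" using ramified by (auto simp: Suc_le_eq card_gt_0_iff)
  qed
  moreover have "\<exists>!v. v \<in> ramified_places L" by (simp add: single)
  ultimately show ?thesis using real ramified by blast
qed

end
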